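(* Let $G=G(\Gamma)$ be the fundamental group of a graph of groups over a finite connected graph $\Gamma$ with all vertex groups isomorphic to $\mathbb{Z}^2$ and all edge groups isomorphic to $\mathbb{Z}$, such that all inclusions of edge groups in vertex groups are maximal. Then there is a finite index subgroup $H$ of $G$ such that for every subgroup $S$ of $H$ (not necessarily finitely generated), either $S$ surjects to $F_2$ or $S$ is free abelian (therefore isomorphic to $\{e\}$, $\mathbb{Z}$ or $\mathbb{Z}^2$).
   Context: An inclusion of an edge group into a vertex group $V\cong\mathbb{Z}^2$ is maximal if its image $\langle x\rangle$ is a maximal cyclic subgroup of $V$, i.e. there are no $g\in V\setminus\{id\}$ and $n>1$ with $x=g^n$. $F_2$ denotes the free group of rank 2; a group surjects to $F_2$ if it admits a surjective homomorphism onto $F_2$. *)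

theory Defs
  imports "HOL-Algebra.Free_Abelian_Groups" "Graph_Theory.Digraph_Component"
begin

section \<open>Groups given by generators and relations\<close>

text \<open>
  A letter \<open>(x, True)\<close> stands for the generator \<open>x\<close>, and \<open>(x, False)\<close> for its formal inverse.
\<close>

type_synonym 'a word = "('a \<times> bool) list"

abbreviation words :: "'a set \<Rightarrow> 'a word set" where
  "words X \<equiv> lists (X \<times> UNIV)"

text \<open>
  A relation \<open>l = r\<close> is encoded as the pair \<open>(l, r)\<close>. The congruence below consists of pairs of
  words over \<open>X\<close>; relations that mention letters outside \<open>X\<close> are ignored.
\<close>

inductive_set word_cong :: "'a set \<Rightarrow> ('a word \<times> 'a word) set \<Rightarrow> ('a word \<times> 'a word) set"
  for X :: "'a set" and R :: "('a word \<times> 'a word) set" where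
  refl: "w \<in> words X \<Longrightarrow> (w, w) \<in> word_cong X R"
| sym: "(v, w) \<in> word_cong X R \<Longrightarrow> (w, v) \<in> word_cong X R"
| trans: "(u, v) \<in> word_cong X R \<Longrightarrow> (v, w) \<in> word_cong X R \<Longrightarrow> (u, w) \<in> word_cong X R"
| cancel: "u \<in> words X \<Longrightarrow> v \<in> words X \<Longrightarrow> x \<in> X \<Longrightarrow>
    (u @ [(x, b), (x, \<not> b)] @ v, u @ v) \<in> word_cong X R"
| rel: "u \<in> words X \<Longrightarrow> v \<in> words X \<Longrightarrow> l \<in> words X \<Longrightarrow> r \<in> words X \<Longrightarrow> (l, r) \<in> R \<Longrightarrow>
    (u @ l @ v, u @ r @ v) \<in> word_cong X R"

definition presented_group :: "'a set \<Rightarrow> ('a word \<times> 'a word) set \<Rightarrow> 'a word set monoid" where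
  "presented_group X R =
    \<lparr>carrier = words X // word_cong X R,
     monoid.mult = (\<lambda>A B. \<Union>u\<in>A. \<Union>v\<in>B. word_cong X R `` {u @ v}),
     one = word_cong X R `` {[]}\<rparr>"

definition free_group :: "'a set \<Rightarrow> 'a word set monoid" where
  "free_group X = presented_group X {}"

definition F2 :: "bool word set monoid" where
  "F2 = free_group UNIV"

subsection \<open>The presented group is a group with the expected universal property\<close>

lemma word_cong_in_words:
  "(u, v) \<in> word_cong X R \<Longrightarrow> u \<in> words X \<and> v \<in> words X"
  by (induction rule: word_cong.induct) auto

lemma equiv_word_cong: "equiv (words X) (word_cong X R)"
proof (rule equivI)
  show "word_cong X R \<subseteq> words X \<times> words X"
    using word_cong_in_words by (metis SigmaI subrelI)
  show "refl_on (words X) (word_cong X R)"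
    by (simp add: refl_on_def word_cong.refl)
  show "Relation.sym (word_cong X R)" "Relation.trans (word_cong X R)"
    by (auto intro: symI transI word_cong.sym word_cong.trans)
qed

lemma word_cong_append_left:
  "(v, w) \<in> word_cong X R \<Longrightarrow> u \<in> words X \<Longrightarrow> (u @ v, u @ w) \<in> word_cong X R"
proof (induction rule: word_cong.induct)
  case (cancel u' v x b)
  then show ?case using word_cong.cancel[of "u @ u'" X v x b R] by simp
next
  case (rel u' v l r)
  then show ?case using word_cong.rel[of "u @ u'" X v l r R] by simp
next
  case (refl w)
  then show ?case by (intro word_cong.refl) simp
next
  case (sym v w)
  then show ?case by (simp add: word_cong.sym)
next
  case (trans v w z)
  then show ?case by (metis word_cong.trans)
qed

lemma word_cong_append_right:
  "(v, w) \<in> word_cong X R \<Longrightarrow> u \<in> words X \<Longrightarrow> (v @ u, w @ u) \<in> word_cong X R"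
proof (induction rule: word_cong.induct)
  case (cancel u' v x b)
  then show ?case using word_cong.cancel[of u' X "v @ u" x b R] by simp
next
  case (rel u' v l r)
  then show ?case using word_cong.rel[of u' X "v @ u" l r R] by simp
next
  case (refl w)
  then show ?case by (intro word_cong.refl) simp
next
  case (sym v w)
  then show ?case by (simp add: word_cong.sym)
next
  case (trans v w z)
  then show ?case by (metis word_cong.trans)
qed

lemma word_cong_append:
  assumes "(u, u') \<in> word_cong X R" "(v, v') \<in> word_cong X R"
  shows "(u @ v, u' @ v') \<in> word_cong X R"
  using assms word_cong_append_left word_cong_append_right word_cong_in_words word_cong.trans
  by metis

lemma word_cong_class_eq_iff:
  "u \<in> words X \<Longrightarrow> v \<in> words X \<Longrightarrow>
    word_cong X R `` {u} = word_cong X R `` {v} \<longleftrightarrow> (u, v) \<in> word_cong X R"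
  by (rule eq_equiv_class_iff[OF equiv_word_cong])

lemma presented_group_mult:
  assumes "u \<in> words X" "v \<in> words X"
  shows "word_cong X R `` {u} \<otimes>\<^bsub>presented_group X R\<^esub> word_cong X R `` {v} = word_cong X R `` {u @ v}"
proof -
  let ?A = "word_cong X R `` {u}" and ?B = "word_cong X R `` {v}"
  have eq: "word_cong X R `` {u' @ v'} = word_cong X R `` {u @ v}"
    if "u' \<in> ?A" "v' \<in> ?B" for u' v'
  proof -
    have "(u @ v, u' @ v') \<in> word_cong X R"
      using that by (intro word_cong_append) auto
    then show ?thesis
      by (rule equiv_class_eq[OF equiv_word_cong, symmetric])
  qed
  have "u \<in> ?A" "v \<in> ?B"
    using assms by (auto intro: word_cong.refl)
  have "(\<Union>u'\<in>?A. \<Union>v'\<in>?B. word_cong X R `` {u' @ v'}) =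
      (\<Union>u'\<in>?A. \<Union>v'\<in>?B. word_cong X R `` {u @ v})"
    by (intro SUP_cong HOL.refl eq)
  also have "\<dots> = word_cong X R `` {u @ v}"
    using \<open>u \<in> ?A\<close> \<open>v \<in> ?B\<close> by blast
  finally show ?thesis
    by (simp add: presented_group_def)
qed

lemma presented_group_one: "\<one>\<^bsub>presented_group X R\<^esub> = word_cong X R `` {[]}"
  by (simp add: presented_group_def)

lemma presented_group_carrierI:
  "w \<in> words X \<Longrightarrow> word_cong X R `` {w} \<in> carrier (presented_group X R)"
  by (simp add: presented_group_def quotientI)

lemma presented_group_carrierE:
  assumes "A \<in> carrier (presented_group X R)"
  obtains w where "w \<in> words X" "A = word_cong X R `` {w}"
  using assms by (auto simp: presented_group_def simp del: in_lists_conv_set elim!: quotientE)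

definition inverse_word :: "'a word \<Rightarrow> 'a word" where
  "inverse_word w = rev (map (\<lambda>(x, b). (x, \<not> b)) w)"

lemma inverse_word_in_words: "w \<in> words X \<Longrightarrow> inverse_word w \<in> words X"
  by (auto simp: inverse_word_def in_lists_conv_set)

lemma word_cong_left_inverse:
  "w \<in> words X \<Longrightarrow> (inverse_word w @ w, []) \<in> word_cong X R"
proof (induction w)
  case Nil
  then show ?case by (simp add: inverse_word_def word_cong.refl)
next
  case (Cons a w)
  obtain x b where a: "a = (x, b)" by force
  have "(inverse_word w @ [(x, \<not> b), (x, \<not> \<not> b)] @ w, inverse_word w @ w) \<in> word_cong X R"
    using Cons.prems a inverse_word_in_words[of w X] by (intro word_cong.cancel) auto
  then show ?case
    using Cons a word_cong.trans by (fastforce simp: inverse_word_def)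
qed

lemma group_presented_group: "group (presented_group X R)"
proof (rule groupI)
  let ?G = "presented_group X R"
  show "\<one>\<^bsub>?G\<^esub> \<in> carrier ?G"
    by (simp add: presented_group_one presented_group_carrierI)
  fix A assume "A \<in> carrier ?G"
  then obtain u where u: "u \<in> words X" "A = word_cong X R `` {u}"
    by (rule presented_group_carrierE)
  show "\<one>\<^bsub>?G\<^esub> \<otimes>\<^bsub>?G\<^esub> A = A"
    using u presented_group_mult[of "[]" X u R] by (simp add: presented_group_one)
  have "word_cong X R `` {inverse_word u @ u} = word_cong X R `` {[]}"
    using u word_cong_left_inverse equiv_class_eq[OF equiv_word_cong] by metis
  then show "\<exists>B\<in>carrier ?G. B \<otimes>\<^bsub>?G\<^esub> A = \<one>\<^bsub>?G\<^esub>"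
    using u inverse_word_in_words presented_group_mult presented_group_carrierI
    by (metis presented_group_one)
  fix B assume "B \<in> carrier ?G"
  then obtain v where v: "v \<in> words X" "B = word_cong X R `` {v}"
    by (rule presented_group_carrierE)
  show "A \<otimes>\<^bsub>?G\<^esub> B \<in> carrier ?G"
    using u v by (simp add: presented_group_mult presented_group_carrierI)
  fix C assume "C \<in> carrier ?G"
  then obtain w where "w \<in> words X" "C = word_cong X R `` {w}"
    by (rule presented_group_carrierE)
  then show "A \<otimes>\<^bsub>?G\<^esub> B \<otimes>\<^bsub>?G\<^esub> C = A \<otimes>\<^bsub>?G\<^esub> (B \<otimes>\<^bsub>?G\<^esub> C)"
    using u v by (simp add: presented_group_mult)
qed

definition eval_word :: "('b, 'm) monoid_scheme \<Rightarrow> ('a \<Rightarrow> 'b) \<Rightarrow> 'a word \<Rightarrow> 'b" where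
  "eval_word K f w =
    foldr (\<lambda>(x, b) y. (if b then f x else inv\<^bsub>K\<^esub> f x) \<otimes>\<^bsub>K\<^esub> y) w \<one>\<^bsub>K\<^esub>"

lemma eval_word_closed:
  assumes "group K" "f \<in> X \<rightarrow> carrier K" "w \<in> words X"
  shows "eval_word K f w \<in> carrier K"
proof -
  interpret K: group K by fact
  show ?thesis
    using assms(3,2) by (induction w) (auto simp: eval_word_def Pi_iff)
qed

lemma eval_word_append:
  assumes "group K" "f \<in> X \<rightarrow> carrier K" "u \<in> words X" "v \<in> words X"
  shows "eval_word K f (u @ v) = eval_word K f u \<otimes>\<^bsub>K\<^esub> eval_word K f v"
proof -
  interpret K: group K by fact
  have v: "eval_word K f v \<in> carrier K"
    using eval_word_closed assms by blast
  show ?thesis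
    using assms(3)
  proof (induction u)
    case Nil
    then show ?case using v by (simp add: eval_word_def)
  next
    case (Cons a u)
    obtain x b where a: "a = (x, b)" by force
    have x: "f x \<in> carrier K" and u: "u \<in> words X"
      using Cons.hyps a assms(2) by (auto simp: Pi_iff)
    have "eval_word K f u \<in> carrier K"
      using eval_word_closed[OF assms(1,2) u] .
    then show ?case
      using Cons.IH u x v a by (cases b) (simp_all add: eval_word_def K.m_assoc)
  qed
qed

lemma presented_group_hom:
  assumes K: "group K" and f: "f \<in> X \<rightarrow> carrier K"
    and R: "\<And>l r. \<lbrakk>(l, r) \<in> R; l \<in> words X; r \<in> words X\<rbrakk> \<Longrightarrow> eval_word K f l = eval_word K f r"
  obtains h where "h \<in> hom (presented_group X R) K"
    "\<And>w. w \<in> words X \<Longrightarrow> h (word_cong X R `` {w}) = eval_word K f w"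
proof
  interpret K: group K by fact
  note closed = eval_word_closed[OF K f] and append = eval_word_append[OF K f]
  have cong: "eval_word K f u = eval_word K f v" if "(u, v) \<in> word_cong X R" for u v
    using that
  proof (induction rule: word_cong.induct)
    case (cancel u v x b)
    have x: "f x \<in> carrier K"
      using cancel f by auto
    have "eval_word K f [(x, b), (x, \<not> b)] = \<one>\<^bsub>K\<^esub>"
      using x by (cases b) (simp_all add: eval_word_def)
    moreover have "[(x, b), (x, \<not> b)] \<in> words X" "[(x, b), (x, \<not> b)] @ v \<in> words X"
      using cancel by auto
    ultimately show ?case
      using cancel append closed by (metis K.l_one)
  next
    case (rel u v l r)
    moreover have "l @ v \<in> words X" "r @ v \<in> words X"
      using rel by auto
    ultimately show ?case
      using append R by metis
  qed auto
  let ?h = "\<lambda>A. eval_word K f (SOME w. w \<in> A)"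
  show h: "?h (word_cong X R `` {w}) = eval_word K f w" if "w \<in> words X" for w
  proof -
    have "w \<in> word_cong X R `` {w}"
      using that by (simp add: word_cong.refl)
    then have "(SOME u. u \<in> word_cong X R `` {w}) \<in> word_cong X R `` {w}"
      by (rule someI)
    then show ?thesis
      using cong by (metis Image_singleton_iff)
  qed
  show "?h \<in> hom (presented_group X R) K"
  proof (rule homI)
    fix A assume "A \<in> carrier (presented_group X R)"
    then obtain u where u: "u \<in> words X" "A = word_cong X R `` {u}"
      by (rule presented_group_carrierE)
    then show "?h A \<in> carrier K"
      using h closed by simp
    fix B assume "B \<in> carrier (presented_group X R)"
    then obtain v where v: "v \<in> words X" "B = word_cong X R `` {v}"
      by (rule presented_group_carrierE)
    have "u @ v \<in> words X"
      using u v by simp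
    then show "?h (A \<otimes>\<^bsub>presented_group X R\<^esub> B) = ?h A \<otimes>\<^bsub>K\<^esub> ?h B"
      using u v h append by (simp only: presented_group_mult)
  qed
qed

section \<open>Spanning trees of undirected multigraphs\<close>

text \<open>
  A graph is given by an arbitrary orientation of its edges, with loops and multiple edges allowed.
  Then \<^const>\<open>connected\<close> is connectedness of the underlying undirected graph, but
  \<^const>\<open>forest\<close> and \<^const>\<open>spanning_tree\<close> only exclude \<^emph>\<open>directed\<close> cycles and cannot be used. A circuit
  is a cycle that may traverse edges in either direction but no edge twice.
\<close>

definition both_directions :: "('v, 'e) pre_digraph \<Rightarrow> ('v, 'e \<times> bool) pre_digraph" where
  "both_directions \<Gamma> =
    \<lparr>verts = verts \<Gamma>, arcs = arcs \<Gamma> \<times> UNIV,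
     tail = (\<lambda>(e, b). if b then tail \<Gamma> e else head \<Gamma> e),
     head = (\<lambda>(e, b). if b then head \<Gamma> e else tail \<Gamma> e)\<rparr>"

definition circuit :: "('v, 'e) pre_digraph \<Rightarrow> ('e \<times> bool) list \<Rightarrow> bool" where
  "circuit \<Gamma> p \<longleftrightarrow> pre_digraph.cycle (both_directions \<Gamma>) p \<and> distinct (map fst p)"

definition undirected_spanning_tree :: "('v, 'e) pre_digraph \<Rightarrow> ('v, 'e) pre_digraph \<Rightarrow> bool" where
  "undirected_spanning_tree T \<Gamma> \<longleftrightarrow> spanning T \<Gamma> \<and> connected T \<and> (\<nexists>p. circuit T p)"

section \<open>Graphs of groups\<close>

record ('v, 'e, 'g, 'h) pre_graph_of_groups =
  base_graph :: "('v, 'e) pre_digraph"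
  vgroup :: "'v \<Rightarrow> 'g monoid"
  egroup :: "'e \<Rightarrow> 'h monoid"
  tail_incl :: "'e \<Rightarrow> 'h \<Rightarrow> 'g"
  head_incl :: "'e \<Rightarrow> 'h \<Rightarrow> 'g"

locale graph_of_groups =
  fixes \<G> :: "('v, 'e, 'g, 'h) pre_graph_of_groups"
  assumes wf: "wf_digraph (base_graph \<G>)"
    and group_vgroup: "v \<in> verts (base_graph \<G>) \<Longrightarrow> group (vgroup \<G> v)"
    and group_egroup: "e \<in> arcs (base_graph \<G>) \<Longrightarrow> group (egroup \<G> e)"
    and tail_incl: "e \<in> arcs (base_graph \<G>) \<Longrightarrow>
      tail_incl \<G> e \<in> mon (egroup \<G> e) (vgroup \<G> (tail (base_graph \<G>) e))"
    and head_incl: "e \<in> arcs (base_graph \<G>) \<Longrightarrow>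
      head_incl \<G> e \<in> mon (egroup \<G> e) (vgroup \<G> (head (base_graph \<G>) e))"

datatype ('v, 'e, 'g) generator = Vertex 'v 'g | Stable 'e

definition fg_generators :: "('v, 'e, 'g, 'h) pre_graph_of_groups \<Rightarrow> ('v, 'e, 'g) generator set" where
  "fg_generators \<G> =
    {Vertex v g | v g. v \<in> verts (base_graph \<G>) \<and> g \<in> carrier (vgroup \<G> v)} \<union> Stable ` arcs (base_graph \<G>)"

text \<open>
  The relations are those of the vertex groups, \<open>t\<^sub>e \<cdot> head_incl e c \<cdot> t\<^sub>e\<inverse> = tail_incl e c\<close>
  for every edge \<open>e\<close> and \<open>c\<close> in its edge group, and \<open>t\<^sub>e = 1\<close> for the edges \<open>e\<close> of \<open>T\<close>.
\<close>

definition fg_relations :: "('v, 'e, 'g, 'h) pre_graph_of_groups \<Rightarrow> ('v, 'e) pre_digraph \<Rightarrow>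
    (('v, 'e, 'g) generator word \<times> ('v, 'e, 'g) generator word) set" where
  "fg_relations \<G> T =
    {([(Vertex v g, True), (Vertex v h, True)], [(Vertex v (g \<otimes>\<^bsub>vgroup \<G> v\<^esub> h), True)]) | v g h.
       v \<in> verts (base_graph \<G>) \<and> g \<in> carrier (vgroup \<G> v) \<and> h \<in> carrier (vgroup \<G> v)} \<union>
    {([(Stable e, True), (Vertex (head (base_graph \<G>) e) (head_incl \<G> e c), True), (Stable e, False)],
      [(Vertex (tail (base_graph \<G>) e) (tail_incl \<G> e c), True)]) | e c.
       e \<in> arcs (base_graph \<G>) \<and> c \<in> carrier (egroup \<G> e)} \<union>
    {([(Stable e, True)], []) | e. e \<in> arcs T}"

text \<open>
  The fundamental group with respect to a spanning tree \<open>T\<close>. Its isomorphism type does not depend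
  on \<open>T\<close>.
\<close>

definition fundamental_group :: "('v, 'e, 'g, 'h) pre_graph_of_groups \<Rightarrow> ('v, 'e) pre_digraph \<Rightarrow>
    ('v, 'e, 'g) generator word set monoid" where
  "fundamental_group \<G> T = presented_group (fg_generators \<G>) (fg_relations \<G> T)"

definition maximal_inclusion ::
    "('h, 'm) monoid_scheme \<Rightarrow> ('g, 'n) monoid_scheme \<Rightarrow> ('h \<Rightarrow> 'g) \<Rightarrow> bool" where
  "maximal_inclusion E V \<phi> \<longleftrightarrow>
    (\<exists>x\<in>carrier V. \<phi> ` carrier E = generate V {x} \<and>
      \<not> (\<exists>g\<in>carrier V - {\<one>\<^bsub>V\<^esub>}. \<exists>n::nat. n > 1 \<and> x = g [^]\<^bsub>V\<^esub> n))"

section \<open>Properties of groups\<close>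

definition surjects_to_F2 :: "('a, 'm) monoid_scheme \<Rightarrow> bool" where
  "surjects_to_F2 G \<longleftrightarrow> epi G F2 \<noteq> {}"

text \<open>Taking the basis in the type \<open>'a\<close> is no restriction, as a basis of \<open>G\<close> is a subset of \<open>G\<close>.\<close>

definition free_abelian :: "('a, 'm) monoid_scheme \<Rightarrow> bool" where
  "free_abelian G \<longleftrightarrow> (\<exists>B :: 'a set. G \<cong> free_Abelian_group B)"

end

theory Submission
  imports Defs "HOL-Library.Product_Plus"
begin

text \<open>
  The group acts on its Bass--Serre tree with vertex stabilisers \<open>\<int>\<^sup>2\<close> and infinite cyclic edge
  stabilisers. Since the edge groups are generated by primitive vectors, the vertex groups can be
  identified with one lattice \<open>\<int>\<^sup>2\<close> in such a way that the whole group acts on it by affine maps. Let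
  \<open>H\<close> be the finite index subgroup of the elements whose linear part is trivial modulo an integer that
  is large compared with all edge directions: no element of \<open>H\<close> carries an edge direction to another
  one, or to a negative, at the same vertex.

  A subgroup \<open>S\<close> of \<open>H\<close> acts on the same tree. Choose a subtree \<open>X\<close> that meets every vertex orbit once.
  Homomorphisms from \<open>S\<close> to the free group are glued from linear functionals on the stabilisers of the
  vertices of \<open>X\<close>, with free values on the orbits of the edges that do not lie in a translate of \<open>X\<close>.
  Two such orbits give a surjection to \<open>F\<^sub>2\<close>. Without any, either \<open>S\<close> fixes a vertex, or two vertices of
  \<open>X\<close> carry independent functionals. With one such orbit and its stable letter \<open>t\<close>, a nonzero functional
  that vanishes on both edge groups identified by \<open>t\<close> gives a surjection; if there is none, then by the
  choice of \<open>H\<close> the two edge directions agree, \<open>t\<close> centralises the vertex stabilisers, which are all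
  contained in one cyclic group, and \<open>S\<close> is abelian.
\<close>

section \<open>Preliminaries\<close>

subsection \<open>Subgroups and cosets\<close>

text \<open>Passing to a subgroup cannot be avoided. Let a, b, t generate a group with the relations
  ab = ba and t a t^-1 = b. It is generated by a and t alone, so a surjection to \<open>F2\<close>
  would be an isomorphism, free groups of finite rank being Hopfian; but a and b generate a free
  abelian group of rank two. With t a t^-1 = a^-1 instead, a and t generate a Klein bottle group.
  The congruence on linear parts excludes both: edge directions at one vertex that are matched by a
  stable letter become parallel, and no direction is reversed. Maximality of the inclusions gives
  primitive vectors, and any two of these are related by an automorphism of the lattice. So the
  linear parts are invertible integer matrices, which can be reduced modulo an integer. Since
  \<open>S\<close> may be infinitely generated, its quotient graph may be infinite. Homomorphisms
  are therefore built from the action itself, and the possibly infinitely many values of a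
  functional are divided by their greatest common divisor to make them surjective. No normal form
  theorem enters: one affine action shows that the vertex groups embed, another that the coset graph
  is a tree.\<close>

lemma subgroup_of_int:
  fixes J :: "int set"
  assumes "0 \<in> J" "\<And>a b. a \<in> J \<Longrightarrow> b \<in> J \<Longrightarrow> a - b \<in> J"
  obtains j where "J = {k. j dvd k}"
proof (cases "J \<subseteq> {0}")
  case True
  then show thesis using that[of 0] assms(1) by auto
next
  case False
  have neg: "- a \<in> J" if "a \<in> J" for a
    using assms(2)[OF assms(1) that] by simp
  have add: "a + b \<in> J" if "a \<in> J" "b \<in> J" for a b
    using assms(2)[OF that(1) neg[OF that(2)]] by simp
  have mult: "c * a \<in> J" if "a \<in> J" for a c
  proof -
    have nat: "int n * a \<in> J" for n
      using assms(1) add that by (induction n) (auto simp: algebra_simps)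
    show ?thesis
      using nat[of "nat c"] neg[OF nat[of "nat (- c)"]] by (cases "c \<ge> 0") auto
  qed
  obtain a where a: "a \<in> J" "a \<noteq> 0" using False by auto
  define P where "P n \<longleftrightarrow> 0 < n \<and> int n \<in> J" for n
  have "P (nat \<bar>a\<bar>)"
    using a neg[OF a(1)] by (auto simp: P_def abs_if)
  then obtain j where "P j" and min: "\<And>i. i < j \<Longrightarrow> \<not> P i"
    using exists_least_iff[of P] by blast
  then have j: "0 < j" "int j \<in> J" by (auto simp: P_def)
  have "int j dvd k" if "k \<in> J" for k
  proof -
    have "k mod int j = k - (k div int j) * int j"
      by (simp add: minus_div_mult_eq_mod)
    then have "k mod int j \<in> J"
      using assms(2) mult j that by metis
    moreover have "0 \<le> k mod int j" "k mod int j < int j" using j by auto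
    ultimately have "\<not> P (nat (k mod int j)) \<Longrightarrow> k mod int j = 0"
      by (auto simp: P_def)
    moreover have "\<not> P (nat (k mod int j))"
      using \<open>k mod int j < int j\<close> \<open>0 \<le> k mod int j\<close> by (intro min) (simp add: nat_less_iff)
    ultimately show ?thesis by auto
  qed
  moreover have "k \<in> J" if "int j dvd k" for k
    using that mult j by (metis dvd_def mult.commute)
  ultimately show thesis using that[of "int j"] by blast
qed

lemma (in group) mult_inv_cancel:
  "x \<in> carrier G \<Longrightarrow> y \<in> carrier G \<Longrightarrow> x \<otimes> (inv x \<otimes> y) = y"
  "x \<in> carrier G \<Longrightarrow> y \<in> carrier G \<Longrightarrow> inv x \<otimes> (x \<otimes> y) = y"
  by (simp_all flip: m_assoc)

text \<open>Every coset contains the element chosen from the fibre of \<open>f\<close> through one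
  of its members, so there are at most as many cosets as values of \<open>f\<close>.\<close>

lemma (in group) finite_rcosets_if:
  assumes H: "subgroup H G" and f: "finite (f ` carrier G)"
    and eq: "\<And>a b. a \<in> carrier G \<Longrightarrow> b \<in> carrier G \<Longrightarrow> f a = f b \<Longrightarrow> a \<otimes> inv b \<in> H"
  shows "finite (rcosets H)"
proof (rule finite_subset)
  show "rcosets H \<subseteq> (\<lambda>c. H #> inv_into (carrier G) f c) ` (f ` carrier G)"
  proof
    fix X assume "X \<in> rcosets H"
    then obtain a where a: "a \<in> carrier G" "X = H #> a" unfolding RCOSETS_def by blast
    let ?b = "inv_into (carrier G) f (f a)"
    have b: "?b \<in> carrier G" "f ?b = f a" using a(1) by (simp_all add: inv_into_into f_inv_into_f)
    have "a \<otimes> inv ?b \<otimes> ?b = a" using a(1) b(1) by (simp add: m_assoc)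
    moreover have "a \<otimes> inv ?b \<in> H" using eq[OF a(1) b(1)] b(2) by simp
    ultimately have "a \<in> H #> ?b" unfolding r_coset_def by force
    then have "H #> ?b = X" unfolding a(2) by (rule repr_independence[OF _ b(1) H])
    then show "X \<in> (\<lambda>c. H #> inv_into (carrier G) f c) ` (f ` carrier G)" using a(1) by blast
  qed
qed (use f in simp)

text \<open>The left coset of \<open>g\<close>, written as a membership condition so that
  translating it amounts to a substitution, see \<open>lcs_translate\<close>.\<close>

definition (in group) lcs :: "'a set \<Rightarrow> 'a \<Rightarrow> 'a set" where
  "lcs H g = {x \<in> carrier G. inv g \<otimes> x \<in> H}"

lemma (in group) lcs_eq_iff:
  assumes H: "subgroup H G" and g: "g \<in> carrier G" "k \<in> carrier G"
  shows "lcs H g = lcs H k \<longleftrightarrow> inv g \<otimes> k \<in> H"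
proof
  assume "lcs H g = lcs H k"
  moreover have "k \<in> lcs H k" using g subgroup.one_closed[OF H] by (simp add: lcs_def)
  ultimately have "k \<in> lcs H g" by (simp only:)
  then show "inv g \<otimes> k \<in> H" by (simp add: lcs_def)
next
  assume gk: "inv g \<otimes> k \<in> H"
  have kg: "inv k \<otimes> g \<in> H"
    using subgroup.m_inv_closed[OF H gk] g by (simp add: inv_mult_group)
  have *: "inv a \<otimes> x \<in> H" if "inv a \<otimes> b \<in> H" "inv b \<otimes> x \<in> H" "a \<in> carrier G" "b \<in> carrier G" "x \<in> carrier G" for a b x
  proof -
    have "(inv a \<otimes> b) \<otimes> (inv b \<otimes> x) = inv a \<otimes> x"
      using that(3-5) by (simp add: m_assoc mult_inv_cancel)
    then show ?thesis using subgroup.m_closed[OF H that(1,2)] by simp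
  qed
  show "lcs H g = lcs H k"
    using *[OF gk _ g] *[OF kg _ g(2,1)] unfolding lcs_def by blast
qed

lemma (in group) lcs_translate:
  assumes "g \<in> carrier G" "k \<in> carrier G"
  shows "{x \<in> carrier G. inv g \<otimes> x \<in> lcs H k} = lcs H (g \<otimes> k)"
proof -
  have "inv k \<otimes> (inv g \<otimes> x) = inv (g \<otimes> k) \<otimes> x" if "x \<in> carrier G" for x
    using assms that by (simp add: inv_mult_group m_assoc)
  then show ?thesis using assms unfolding lcs_def by auto
qed

subsection \<open>The lattice of integer vectors\<close>

type_synonym vec = "int \<times> int"

definition scl :: "int \<Rightarrow> vec \<Rightarrow> vec" where
  "scl k z = (k * fst z, k * snd z)"

text \<open>Every integral functional on the lattice has the form \<open>det y\<close>, and for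
  primitive \<open>y\<close> its kernel is \<open>line y\<close>. An edge direction thus doubles as
  the functional that kills the edge group.\<close>

definition det :: "vec \<Rightarrow> vec \<Rightarrow> int" where
  "det y z = fst y * snd z - snd y * fst z"

definition line :: "vec \<Rightarrow> vec set" where
  "line y = range (\<lambda>k. scl k y)"

text \<open>The zero vector is excluded, being \<open>scl 0 z\<close>.\<close>

definition primitive :: "vec \<Rightarrow> bool" where
  "primitive y \<longleftrightarrow> (\<forall>k z. y = scl k z \<longrightarrow> \<bar>k\<bar> = 1)"

definition mod_eq :: "int \<Rightarrow> vec \<Rightarrow> vec \<Rightarrow> bool" where
  "mod_eq m y z \<longleftrightarrow> m dvd fst (y - z) \<and> m dvd snd (y - z)"

lemma det_add: "det y (z + w) = det y z + det y w"
  by (simp add: det_def algebra_simps)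

lemma det_scl: "det y (scl k z) = k * det y z"
  by (simp add: det_def scl_def algebra_simps)

lemma det_self [simp]: "det y y = 0" "det y 0 = 0"
  by (simp_all add: det_def)

lemma primitive_iff_coprime: "primitive y \<longleftrightarrow> coprime (fst y) (snd y)"
proof
  assume L: "primitive y"
  show "coprime (fst y) (snd y)"
  proof (rule coprimeI)
    fix c assume "c dvd fst y" "c dvd snd y"
    then obtain a b where "y = scl c (a, b)"
      by (metis dvd_def fst_conv prod.collapse scl_def snd_conv)
    then show "is_unit c" using L by (auto simp: primitive_def)
  qed
next
  assume R: "coprime (fst y) (snd y)"
  show "primitive y"
    unfolding primitive_def
  proof (intro allI impI)
    fix k z assume "y = scl k z"
    then have "k dvd fst y" "k dvd snd y" by (auto simp: scl_def)
    then have "is_unit k" using R by (rule coprime_common_divisor[rotated 1])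
    then show "\<bar>k\<bar> = 1" by simp
  qed
qed

lemma det_eq_0_iff:
  assumes "primitive y"
  shows "det y z = 0 \<longleftrightarrow> z \<in> line y"
proof
  assume "z \<in> line y"
  then show "det y z = 0" by (auto simp: line_def det_scl)
next
  assume d: "det y z = 0"
  have cop: "coprime (fst y) (snd y)" using assms primitive_iff_coprime by blast
  then obtain p q where pq: "p * fst y + q * snd y = 1"
    using bezout_int[of "fst y" "snd y"] by auto
  have e: "fst y * snd z = snd y * fst z" using d by (simp add: det_def)
  \<comment> \<open>The functional with coefficients \<open>p\<close> and \<open>q\<close> takes the
    value 1 on \<open>y\<close>, so its value on \<open>z\<close> is the required multiple.\<close>
  have "fst z = (p * fst z + q * snd z) * fst y"
    using pq e by algebra
  moreover have "snd z = (p * fst z + q * snd z) * snd y"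
    using pq e by algebra
  ultimately have "z = scl (p * fst z + q * snd z) y"
    by (auto simp: scl_def prod_eq_iff)
  then show "z \<in> line y" unfolding line_def by blast
qed

lemma primitive_parallel:
  assumes "primitive y" "primitive z" "det y z = 0"
  shows "z = y \<or> z = - y"
proof -
  obtain k where k: "z = scl k y" using assms det_eq_0_iff by (auto simp: line_def)
  then have "\<bar>k\<bar> = 1" using assms(2) unfolding primitive_def by blast
  then have "k = 1 \<or> k = -1" by auto
  then show ?thesis using k by (auto simp: scl_def prod_eq_iff)
qed

lemma det_parallel:
  assumes "primitive y" "primitive y'" "det y y' = 0"
  shows "det y z = 0 \<longleftrightarrow> det y' z = 0"
  using primitive_parallel[OF assms] by (auto simp: det_def)

lemma det_scl_left: "det (scl k z) w = k * det z w"
  by (simp add: det_def scl_def algebra_simps)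

lemma det_zero_left [simp]: "det 0 w = 0"
  by (simp add: det_def)

lemma scl_minus_one: "scl (- 1) z = - z"
  by (simp add: scl_def prod_eq_iff)

lemma nonzero_functional:
  fixes z :: vec
  assumes "z \<noteq> 0" obtains c where "det c z \<noteq> 0"
proof (cases "fst z = 0")
  case True
  then have "det (1, 0) z \<noteq> 0" using assms by (auto simp: det_def prod_eq_iff)
  then show thesis using that by blast
next
  case False
  then have "det (0, 1) z \<noteq> 0" by (auto simp: det_def)
  then show thesis using that by blast
qed

lemma parallel_det:
  assumes "primitive a" "det a z = 0" "det a w = 0"
  shows "det z w = 0"
proof -
  obtain k where "z = scl k a" using assms(2) det_eq_0_iff[OF assms(1)] by (auto simp: line_def)
  then have "det z w = k * det a w" by (simp add: det_def scl_def algebra_simps)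
  then show ?thesis using assms by simp
qed

lemma mod_eq_sym: "mod_eq m a b \<Longrightarrow> mod_eq m b a"
  by (simp add: mod_eq_def dvd_diff_commute[of m "fst b"] dvd_diff_commute[of m "snd b"])

lemma mod_eq_trans: "mod_eq m a b \<Longrightarrow> mod_eq m b c \<Longrightarrow> mod_eq m a c"
proof -
  assume "mod_eq m a b" "mod_eq m b c"
  then have "m dvd fst (a - b) + fst (b - c)" "m dvd snd (a - b) + snd (b - c)"
    unfolding mod_eq_def by (blast intro: dvd_add)+
  then show ?thesis by (simp add: mod_eq_def)
qed

lemma mod_eq_up_to_sign:
  assumes "mod_eq m a b" "a' = a \<or> a' = - a" "b' = b \<or> b' = - b"
  shows "mod_eq m a' b' \<or> mod_eq m a' (- b')"
proof -
  have "mod_eq m (- a) (- b)"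
    using assms(1) unfolding mod_eq_def by (auto simp: dvd_diff_commute)
  then show ?thesis using assms by auto
qed

text \<open>Otherwise \<open>m\<close> would divide both entries of \<open>2 a\<close>, hence 2 by
  Bezout. This is what the bound 3 is for: no element of the congruence subgroup can invert an edge
  direction as in the Klein bottle group.\<close>

lemma primitive_not_mod_eq_minus:
  assumes "primitive a" "m \<ge> 3" "mod_eq m (- a) a"
  shows False
proof -
  have cop: "coprime (fst a) (snd a)" using assms primitive_iff_coprime by blast
  then obtain p q where pq: "p * fst a + q * snd a = 1"
    using bezout_int[of "fst a" "snd a"] by auto
  have eq: "fst (- a - a) = - 2 * fst a" "snd (- a - a) = - 2 * snd a" by simp_all
  have d: "m dvd - 2 * fst a" "m dvd - 2 * snd a" using assms(3) unfolding mod_eq_def eq by blast+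
  have "m dvd p * (- 2 * fst a) + q * (- 2 * snd a)"
    by (rule dvd_add[OF dvd_mult[OF d(1)] dvd_mult[OF d(2)]])
  also have "\<dots> = - 2 * (p * fst a + q * snd a)" by (simp add: algebra_simps)
  finally have "m dvd 2" using pq by simp
  then show False using assms(2) zdvd_imp_le[of m 2] by simp
qed

subsection \<open>Permutation groups\<close>

definition perms :: "('x \<Rightarrow> 'x) monoid" where
  "perms = \<lparr>carrier = {f. bij f}, monoid.mult = (\<circ>), one = id\<rparr>"

lemma perms_simps [simp]:
  "carrier perms = {f. bij f}" "f \<otimes>\<^bsub>perms\<^esub> g = f \<circ> g" "\<one>\<^bsub>perms\<^esub> = id"
  by (simp_all add: perms_def)

lemma group_perms: "group perms"
proof (rule groupI)
  fix f :: "'x \<Rightarrow> 'x" assume "f \<in> carrier perms"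
  then have "inv_into UNIV f \<in> carrier perms" "inv_into UNIV f \<circ> f = id"
    by (auto simp: bij_imp_bij_inv bij_is_inj)
  then show "\<exists>g\<in>carrier perms. g \<otimes>\<^bsub>perms\<^esub> f = \<one>\<^bsub>perms\<^esub>" by auto
qed (auto simp: bij_comp comp_assoc)

subsection \<open>The free group of rank two\<close>

lemma presented_group_generated:
  assumes J: "subgroup J (presented_group X R)" and gen: "\<And>x. x \<in> X \<Longrightarrow> word_cong X R `` {[(x, True)]} \<in> J"
  shows "J = carrier (presented_group X R)"
proof
  let ?G = "presented_group X R" and ?C = "\<lambda>w. word_cong X R `` {w}"
  interpret group ?G by (rule group_presented_group)
  show "J \<subseteq> carrier ?G" using J by (rule subgroup.subset)
  have letter: "?C [(x, b)] \<in> J" if x: "x \<in> X" for x b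
  proof (cases b)
    case False
    have "([] @ [(x, False), (x, \<not> False)] @ [], [] @ []) \<in> word_cong X R"
      using x by (intro word_cong.cancel) auto
    then have "?C [(x, False), (x, True)] = ?C []"
      by (intro equiv_class_eq[OF equiv_word_cong]) simp
    then have "?C [(x, False)] \<otimes>\<^bsub>?G\<^esub> ?C [(x, True)] = \<one>\<^bsub>?G\<^esub>"
      using presented_group_mult[of "[(x, False)]" X "[(x, True)]" R] x by (simp add: presented_group_one)
    then have "inv\<^bsub>?G\<^esub> ?C [(x, True)] = ?C [(x, False)]"
      using x by (intro inv_equality) (auto intro!: presented_group_carrierI)
    then show ?thesis using False subgroup.m_inv_closed[OF J gen[OF x]] by simp
  qed (use gen x in simp)
  have wJ: "w \<in> words X \<Longrightarrow> ?C w \<in> J" for w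
  proof (induction w)
    case Nil
    then show ?case using subgroup.one_closed[OF J] by (simp add: presented_group_one)
  next
    case (Cons a w)
    then have a: "fst a \<in> X" and w: "w \<in> words X" by auto
    have "?C (a # w) = ?C [a] \<otimes>\<^bsub>?G\<^esub> ?C w"
      using presented_group_mult[of "[a]" X w R] a w by (cases a) auto
    moreover have "?C [a] \<in> J" using letter[OF a, of "snd a"] by simp
    ultimately show ?case using Cons.IH[OF w] subgroup.m_closed[OF J] by simp
  qed
  show "carrier ?G \<subseteq> J"
  proof
    fix A assume "A \<in> carrier ?G"
    then obtain w where "w \<in> words X" "A = ?C w" by (rule presented_group_carrierE)
    then show "A \<in> J" using wJ by blast
  qed
qed

definition fgen :: "bool \<Rightarrow> bool word set" where
  "fgen i = word_cong UNIV {} `` {[(i, True)]}"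

lemma group_F2: "group F2"
  by (simp add: F2_def free_group_def group_presented_group)

lemma fgen_closed [simp]: "fgen i \<in> carrier F2"
  by (simp add: F2_def free_group_def fgen_def presented_group_carrierI)

lemma F2_generated:
  assumes "subgroup J F2" "\<And>i. fgen i \<in> J"
  shows "J = carrier F2"
  using presented_group_generated[of J UNIV "{}"] assms by (simp add: F2_def free_group_def fgen_def)

lemma surjects_to_F2I:
  assumes "group S" "\<phi> \<in> hom S F2" "\<And>i. fgen i \<in> \<phi> ` carrier S"
  shows "surjects_to_F2 S"
proof -
  interpret group_hom S F2 \<phi>
    using assms group_F2 by (simp add: group_hom_def group_hom_axioms_def)
  have "\<phi> ` carrier S = carrier F2"
    by (rule F2_generated[OF img_is_subgroup assms(3)])
  then show ?thesis
    using assms(2) unfolding surjects_to_F2_def epi_def by blast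
qed

text \<open>Dividing all exponents by their greatest common divisor makes the image contain \<open>g\<close> itself.\<close>

lemma Gcd_exponents:
  assumes "group K" "g \<in> carrier K" "subgroup J K" and V: "v \<in> V" "(v::int) \<noteq> 0"
    and J: "\<And>v. v \<in> V \<Longrightarrow> g [^]\<^bsub>K\<^esub> (v div Gcd V) \<in> J"
  shows "g \<in> J"
proof -
  interpret K: group K by fact
  let ?J = "{k :: int. g [^]\<^bsub>K\<^esub> k \<in> J}"
  have "a - b \<in> ?J" if "a \<in> ?J" "b \<in> ?J" for a b
    using that assms(2) subgroup.m_closed[OF assms(3)] subgroup.m_inv_closed[OF assms(3)]
    by (simp add: K.int_pow_diff)
  moreover have "0 \<in> ?J" using subgroup.one_closed[OF assms(3)] by simp
  ultimately obtain j where j: "?J = {k. j dvd k}" using subgroup_of_int by metis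
  \<comment> \<open>The exponents available in \<open>J\<close> are the multiples of
    \<open>j\<close>. If \<open>j\<close> were not a unit, \<open>j * Gcd V\<close> would be a
    larger common divisor of \<open>V\<close>.\<close>
  have "j * Gcd V dvd v" if "v \<in> V" for v
  proof -
    have "j dvd v div Gcd V" using J[OF that] j by blast
    moreover have "Gcd V dvd v" using that by (rule Gcd_dvd)
    ultimately show ?thesis by (metis dvd_div_mult_self dvd_refl mult_dvd_mono)
  qed
  then have "j * Gcd V dvd Gcd V" by (rule Gcd_greatest)
  moreover have "Gcd V \<noteq> 0" using V by (auto simp: Gcd_0_iff)
  ultimately have "j dvd 1" by simp
  then have "1 \<in> ?J" using j by auto
  then show ?thesis using assms(2) by simp
qed

subsection \<open>Free abelian groups of rank at most two\<close>

definition small_free_abelian :: "('a, 'm) monoid_scheme \<Rightarrow> bool" where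
  "small_free_abelian G \<longleftrightarrow> free_abelian G \<and>
     (trivial_group G \<or> G \<cong> integer_group \<or> G \<cong> integer_group \<times>\<times> integer_group)"

lemma free_Abelian_group_pair:
  assumes "x \<noteq> y"
  shows "integer_group \<times>\<times> integer_group \<cong> free_Abelian_group {x, y}"
proof -
  let ?f = "\<lambda>(m, n). frag_cmul m (frag_of x) + frag_cmul n (frag_of y)"
  have "?f \<in> iso (integer_group \<times>\<times> integer_group) (free_Abelian_group {x, y})"
  proof (rule isoI[OF homI])
    show "bij_betw ?f (carrier (integer_group \<times>\<times> integer_group)) (carrier (free_Abelian_group {x, y}))"
    proof (rule bij_betwI[where g = "\<lambda>c. (Poly_Mapping.lookup c x, Poly_Mapping.lookup c y)"])
      show "?f \<in> carrier (integer_group \<times>\<times> integer_group) \<rightarrow> carrier (free_Abelian_group {x, y})"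
        by (auto dest!: subsetD[OF keys_add] subsetD[OF keys_cmul])
      show "(Poly_Mapping.lookup (?f c) x, Poly_Mapping.lookup (?f c) y) = c" for c
        using assms by (cases c) (auto simp: lookup_add)
      show "?f (Poly_Mapping.lookup c x, Poly_Mapping.lookup c y) = c"
        if "c \<in> carrier (free_Abelian_group {x, y})" for c
        using that assms
        by (intro poly_mapping_eqI) (auto simp: lookup_add lookup_single in_keys_iff subset_iff when_def)
    qed auto
  next
    fix a assume "a \<in> carrier (integer_group \<times>\<times> integer_group)"
    show "?f a \<in> carrier (free_Abelian_group {x, y})"
      by (auto dest!: subsetD[OF keys_add] subsetD[OF keys_cmul] split: prod.splits)
  qed (auto simp: frag_cmul_distrib)
  then show ?thesis by (auto simp: is_iso_def)
qed

lemma image_hom_integer_group: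
  assumes "group S" "\<chi> \<in> hom S integer_group"
  obtains d where "\<chi> ` carrier S = {k. d dvd k}"
proof -
  interpret h: group_hom S integer_group \<chi>
    using assms by (simp add: group_hom_def group_hom_axioms_def)
  show thesis
  proof (rule subgroup_of_int[of "\<chi> ` carrier S"])
    show "0 \<in> \<chi> ` carrier S"
      using imageI[OF h.G.one_closed, of \<chi>] h.hom_one by (simp only: one_integer_group)
    show "a - b \<in> \<chi> ` carrier S" if ab: "a \<in> \<chi> ` carrier S" "b \<in> \<chi> ` carrier S" for a b
    proof -
      obtain x where "x \<in> carrier S" "a = \<chi> x" using ab(1) by blast
      moreover obtain y where "y \<in> carrier S" "b = \<chi> y" using ab(2) by blast
      ultimately
      have "\<chi> (x \<otimes>\<^bsub>S\<^esub> inv\<^bsub>S\<^esub> y) = a - b" "x \<otimes>\<^bsub>S\<^esub> inv\<^bsub>S\<^esub> y \<in> carrier S"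
        using h.hom_mult[of x "inv\<^bsub>S\<^esub> y"] h.hom_inv[of y] by (simp_all only: h.G.inv_closed h.G.m_closed mult_integer_group inv_integer_group)
      then show ?thesis by (metis imageI)
    qed
  qed (rule that)
qed

lemma small_free_abelian_cases:
  fixes S :: "('a, 'm) monoid_scheme"
  assumes "S \<cong> integer_group \<times>\<times> integer_group \<or> S \<cong> integer_group \<or> trivial_group S"
  shows "small_free_abelian S"
proof -
    have "free_abelian S"
      using assms
    proof (elim disjE)
      assume i: "S \<cong> integer_group \<times>\<times> integer_group"
      then obtain h where h: "h \<in> iso S (integer_group \<times>\<times> integer_group)" unfolding is_iso_def by blast
      then have img: "h ` carrier S = UNIV" by (simp add: iso_def bij_betw_def)
      \<comment> \<open>The basis must consist of elements of the type of \<open>S\<close>; any two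
        distinct elements can serve as names, here preimages of two different pairs.\<close>
      have "(0, 0) \<in> h ` carrier S" "(1, 0) \<in> h ` carrier S" unfolding img by (rule UNIV_I)+
      then obtain x y where xy: "(0, 0) = h x" "(1, 0) = h y" unfolding image_iff by blast
      have "h x \<noteq> h y" unfolding xy[symmetric] prod.inject by (simp only: zero_neq_one simp_thms)
      then have "x \<noteq> y" by blast
      then have "S \<cong> free_Abelian_group {x, y}"
        by (rule iso_trans[OF i free_Abelian_group_pair])
      then show ?thesis unfolding free_abelian_def by blast
    next
      assume "S \<cong> integer_group"
      then have "S \<cong> free_Abelian_group {\<one>\<^bsub>S\<^esub>}"
        using isomorphic_group_integer_free_Abelian_group_singleton by (rule iso_trans)
      then show ?thesis unfolding free_abelian_def by blast
    next
      assume "trivial_group S"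
      then have "carrier S = {\<one>\<^bsub>S\<^esub>}" by (simp add: trivial_group_def)
      then have "(\<lambda>_. 0) \<in> iso S (free_Abelian_group ({} :: 'a set))"
        by (auto simp: iso_def hom_def bij_betw_def)
      then have "S \<cong> free_Abelian_group ({} :: 'a set)" by (rule is_isoI)
      then show ?thesis unfolding free_abelian_def by blast
    qed
    then show ?thesis using assms by (auto simp: small_free_abelian_def)
qed

text \<open>The image of \<open>\<chi>\<close> and the image of its kernel under
  \<open>\<psi>\<close> are subgroups of the integers, generated by \<open>d\<close> and
  \<open>e\<close>. Lifts \<open>s1\<close> and \<open>s2\<close> of these generators yield the
  normal form \<open>s1^m s2^n\<close>, and the vanishing of \<open>d\<close> and \<open>e\<close>
  decides the rank.\<close>

lemma small_free_abelianI:
  assumes "group S"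
    and comm: "\<And>x y. x \<in> carrier S \<Longrightarrow> y \<in> carrier S \<Longrightarrow> x \<otimes>\<^bsub>S\<^esub> y = y \<otimes>\<^bsub>S\<^esub> x"
    and \<chi>: "\<chi> \<in> hom S integer_group"
    and \<psi>: "\<And>s t. \<lbrakk>s \<in> carrier S; t \<in> carrier S; \<chi> s = 0; \<chi> t = 0\<rbrakk> \<Longrightarrow> \<psi> (s \<otimes>\<^bsub>S\<^esub> t) = (\<psi> s + \<psi> t :: int)"
    and \<psi>_inj: "\<And>s. \<lbrakk>s \<in> carrier S; \<chi> s = 0; \<psi> s = 0\<rbrakk> \<Longrightarrow> s = \<one>\<^bsub>S\<^esub>"
  shows "small_free_abelian S"
proof -
  interpret S: comm_group S
    using assms(1) comm by (simp add: group.group_comm_groupI)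
  interpret h: group_hom S integer_group \<chi>
    using \<chi> by (simp add: group_hom_def group_hom_axioms_def)
  let ?K = "{s \<in> carrier S. \<chi> s = 0}"
  have K: "subgroup ?K S"
    by (rule S.subgroupI) auto
  interpret K: group "S\<lparr>carrier := ?K\<rparr>" using K by (rule S.subgroup_imp_group)
  interpret k: group_hom "S\<lparr>carrier := ?K\<rparr>" integer_group \<psi>
    using \<psi> by (auto simp: group_hom_def group_hom_axioms_def hom_def)
  have \<psi>_pow: "\<psi> (s [^]\<^bsub>S\<^esub> (n::int)) = n * \<psi> s" if "s \<in> ?K" for s n
    using k.hom_int_pow[of s n] S.int_pow_consistent[OF K] that by (simp add: mult.commute)
  have \<chi>_pow: "\<chi> (s [^]\<^bsub>S\<^esub> (n::int)) = n * \<chi> s" if "s \<in> carrier S" for s n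
    using h.hom_int_pow[of s n] that by (simp add: mult.commute)
  obtain d where d: "\<chi> ` carrier S = {k. d dvd k}"
    using image_hom_integer_group[OF S.is_group \<chi>] .
  obtain e where e: "\<psi> ` ?K = {k. e dvd k}"
    using image_hom_integer_group[OF K.is_group k.homh] by auto
  have "\<exists>s\<in>carrier S. \<chi> s = d" using d by (metis (mono_tags) dvd_refl imageE mem_Collect_eq)
  \<comment> \<open>The trivial lift is taken when \<open>d = 0\<close>, so that its powers
    disappear from the normal form; likewise for \<open>s2\<close> below.\<close>
  then obtain s1 where s1: "s1 \<in> carrier S" "\<chi> s1 = d" "d = 0 \<Longrightarrow> s1 = \<one>\<^bsub>S\<^esub>"
    by (cases "d = 0") (use h.hom_one in auto)
  have "e \<in> \<psi> ` ?K" using e by simp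
  then have "\<exists>s\<in>?K. \<psi> s = e" by blast
  then obtain s2 where s2: "s2 \<in> carrier S" "\<chi> s2 = 0" "\<psi> s2 = e" "e = 0 \<Longrightarrow> s2 = \<one>\<^bsub>S\<^esub>"
    by (cases "e = 0") (use h.hom_one k.hom_one in auto)
  let ?f = "\<lambda>(m::int, n::int). s1 [^]\<^bsub>S\<^esub> m \<otimes>\<^bsub>S\<^esub> s2 [^]\<^bsub>S\<^esub> n"
  have f: "?f \<in> hom (integer_group \<times>\<times> integer_group) S"
    using s1 s2 by (intro homI) (auto simp: S.int_pow_mult S.m_ac)
  have surj: "\<exists>m n. s = ?f (m, n)" if s: "s \<in> carrier S" for s
  proof -
    obtain m where m: "\<chi> s = m * d" using d s by (metis (mono_tags) dvd_def image_eqI mem_Collect_eq mult.commute)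
    let ?t = "s \<otimes>\<^bsub>S\<^esub> s1 [^]\<^bsub>S\<^esub> (- m)"
    have t: "?t \<in> ?K" using s s1 m \<chi>_pow[of s1 "- m"] by simp
    then have "\<psi> ?t \<in> {k. e dvd k}" using e by blast
    then obtain n where n: "\<psi> ?t = n * e" by (metis dvd_def mem_Collect_eq mult.commute)
    have s2': "s2 \<in> ?K" "s2 [^]\<^bsub>S\<^esub> (- n) \<in> ?K" using s2 \<chi>_pow[of s2 "- n"] by simp_all
    have "\<psi> (?t \<otimes>\<^bsub>S\<^esub> s2 [^]\<^bsub>S\<^esub> (- n)) = \<psi> ?t + \<psi> (s2 [^]\<^bsub>S\<^esub> (- n))"
      using \<psi> t s2' by blast
    also have "\<dots> = 0" using n \<psi>_pow[OF s2'(1), of "- n"] s2 by simp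
    finally have "?t \<otimes>\<^bsub>S\<^esub> s2 [^]\<^bsub>S\<^esub> (- n) = \<one>\<^bsub>S\<^esub>"
      using \<psi>_inj t s2' subgroup.m_closed[OF K t s2'(2)] by blast
    then have "inv\<^bsub>S\<^esub> (s2 [^]\<^bsub>S\<^esub> (- n)) = ?t"
      using s s1 s2 by (intro S.inv_equality) simp_all
    then have "?t = s2 [^]\<^bsub>S\<^esub> n" using s2 by (simp add: S.int_pow_neg)
    moreover have "s = ?t \<otimes>\<^bsub>S\<^esub> s1 [^]\<^bsub>S\<^esub> m" using s s1 by (simp add: S.int_pow_neg S.m_assoc)
    ultimately have "s = ?f (m, n)"
      using s1 s2 by (simp add: S.m_comm)
    then show ?thesis by blast
  qed
  have cyc: "S \<cong> integer_group"
    if "x \<in> carrier S" "\<And>s. s \<in> carrier S \<Longrightarrow> \<exists>n::int. s = x [^]\<^bsub>S\<^esub> n" "\<And>n::int. x [^]\<^bsub>S\<^esub> n = \<one>\<^bsub>S\<^esub> \<Longrightarrow> n = 0" for x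
  proof -
    interpret c: group_hom integer_group S "\<lambda>n::int. x [^]\<^bsub>S\<^esub> n"
      using S.hom_integer_group_pow[OF that(1)] by (simp add: group_hom_def group_hom_axioms_def S.is_group)
    have "kernel integer_group S (\<lambda>n::int. x [^]\<^bsub>S\<^esub> n) = {0}"
      using that(3) by (auto simp: kernel_def)
    then have "inj_on (\<lambda>n::int. x [^]\<^bsub>S\<^esub> n) (carrier integer_group)"
      by (intro c.trivial_ker_imp_inj) simp
    moreover have "range (\<lambda>n::int. x [^]\<^bsub>S\<^esub> n) = carrier S" using that by auto
    ultimately have "(\<lambda>n::int. x [^]\<^bsub>S\<^esub> n) \<in> iso integer_group S"
      using c.homh by (simp add: iso_def bij_betw_def)
    then show ?thesis by (meson group.iso_sym group_integer_group is_isoI)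
  qed
  note free = small_free_abelian_cases
  consider "d \<noteq> 0" "e \<noteq> 0" | "d = 0" "e \<noteq> 0" | "d \<noteq> 0" "e = 0" | "d = 0" "e = 0" by blast
  then show ?thesis
  proof cases
    case 1
    have "(m, n) = (0, 0)" if "?f (m, n) = \<one>\<^bsub>S\<^esub>" for m n
    proof -
      have "\<chi> (?f (m, n)) = m * d" using s1 s2 \<chi>_pow by simp
      then have "m = 0" using that 1 by simp
      then have "\<psi> (s2 [^]\<^bsub>S\<^esub> n) = 0" using that s2 k.hom_one by simp
      then show ?thesis using \<psi>_pow[of s2 n] s2 1 \<open>m = 0\<close> by simp
    qed
    then have ker: "kernel (integer_group \<times>\<times> integer_group) S ?f = {(0, 0)}"
      by (auto simp: kernel_def)
    have fh: "group_hom (integer_group \<times>\<times> integer_group) S ?f"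
      by (intro group_hom.intro group_hom_axioms.intro DirProd_group group_integer_group S.is_group f)
    have "\<one>\<^bsub>integer_group \<times>\<times> integer_group\<^esub> = (0, 0)" by (simp add: DirProd_def)
    then have "inj_on ?f (carrier (integer_group \<times>\<times> integer_group))"
      using ker by (intro group_hom.trivial_ker_imp_inj[OF fh]) simp
    moreover have "?f ` carrier (integer_group \<times>\<times> integer_group) = carrier S"
    proof (intro equalityI subsetI)
      fix s assume "s \<in> carrier S"
      then obtain m n where "s = ?f (m, n)" using surj by blast
      then show "s \<in> ?f ` carrier (integer_group \<times>\<times> integer_group)" by (rule image_eqI) simp
    qed (use s1 s2 in auto)
    ultimately have "?f \<in> iso (integer_group \<times>\<times> integer_group) S"
      using f by (simp add: iso_def bij_betw_def)
    then have "S \<cong> integer_group \<times>\<times> integer_group"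
      by (meson DirProd_group group.iso_sym group_integer_group is_isoI)
    then show ?thesis using free by blast
  next
    case 2
    have "\<exists>n::int. s = s2 [^]\<^bsub>S\<^esub> n" if "s \<in> carrier S" for s
      using surj[OF that] s1 s2 2 by auto
    moreover have "n = 0" if "s2 [^]\<^bsub>S\<^esub> n = \<one>\<^bsub>S\<^esub>" for n :: int
      using that \<psi>_pow[of s2 n] s2 2 k.hom_one by simp
    ultimately show ?thesis using cyc s2 free by blast
  next
    case 3
    have "\<exists>n::int. s = s1 [^]\<^bsub>S\<^esub> n" if "s \<in> carrier S" for s
      using surj[OF that] s1 s2 3 by auto
    moreover have "n = 0" if "s1 [^]\<^bsub>S\<^esub> n = \<one>\<^bsub>S\<^esub>" for n :: int
      using that \<chi>_pow[of s1 n] s1 3 by simp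
    ultimately show ?thesis using cyc s1 free by blast
  next
    case 4
    have "s = \<one>\<^bsub>S\<^esub>" if "s \<in> carrier S" for s
      using surj[OF that] s1 s2 4 by auto
    then have "trivial_group S" using S.is_group by (auto simp: trivial_group_def)
    then show ?thesis using free by blast
  qed
qed

section \<open>Groups acting on trees\<close>

text \<open>A tree is encoded by a parent and a depth function for each choice of root, every edge
  joining a vertex to its parent. \<open>E\<close> is an orientation preserved by the action, so no
  edge is inverted.\<close>

locale tree_action = S: group S for S :: "('a, 'm) monoid_scheme" (structure) +
  fixes VT :: "'x set" and act :: "'a \<Rightarrow> 'x \<Rightarrow> 'x" and E :: "('x \<times> 'x) set"
  assumes act_closed: "\<lbrakk>g \<in> carrier S; v \<in> VT\<rbrakk> \<Longrightarrow> act g v \<in> VT"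
    and act_one: "v \<in> VT \<Longrightarrow> act \<one> v = v"
    and act_mult: "\<lbrakk>g \<in> carrier S; h \<in> carrier S; v \<in> VT\<rbrakk> \<Longrightarrow> act (g \<otimes> h) v = act g (act h v)"
    and E_verts: "(u, v) \<in> E \<Longrightarrow> u \<in> VT \<and> v \<in> VT"
    and E_act: "\<lbrakk>(u, v) \<in> E; g \<in> carrier S\<rbrakk> \<Longrightarrow> (act g u, act g v) \<in> E"
    and E_asym: "(u, v) \<in> E \<Longrightarrow> (v, u) \<notin> E"
    and VT_nonempty: "VT \<noteq> {}"
    and tree_ex: "r \<in> VT \<Longrightarrow> \<exists>p (d :: 'x \<Rightarrow> nat).
      (\<forall>v\<in>VT - {r}. p v \<in> VT \<and> d v = Suc (d (p v)) \<and> ((p v, v) \<in> E \<or> (v, p v) \<in> E)) \<and>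
      (\<forall>(u, v)\<in>E. (v \<noteq> r \<and> u = p v) \<or> (u \<noteq> r \<and> v = p u))"
begin

definition adj :: "'x \<Rightarrow> 'x \<Rightarrow> bool" where
  "adj u v \<longleftrightarrow> (u, v) \<in> E \<or> (v, u) \<in> E"

definition rooted :: "'x \<Rightarrow> ('x \<Rightarrow> 'x) \<Rightarrow> ('x \<Rightarrow> nat) \<Rightarrow> bool" where
  "rooted r p d \<longleftrightarrow> (\<forall>v\<in>VT - {r}. p v \<in> VT \<and> d v = Suc (d (p v)) \<and> adj (p v) v) \<and>
    (\<forall>u v. adj u v \<longrightarrow> (v \<noteq> r \<and> u = p v) \<or> (u \<noteq> r \<and> v = p u))"

lemma rooted_ex:
  assumes "r \<in> VT" obtains p d where "rooted r p d"
proof -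
  obtain p d where pd: "\<forall>v\<in>VT - {r}. p v \<in> VT \<and> d v = Suc (d (p v)) \<and> ((p v, v) \<in> E \<or> (v, p v) \<in> E)"
    "\<forall>(u, v)\<in>E. (v \<noteq> r \<and> u = p v) \<or> (u \<noteq> r \<and> v = p u)"
    using tree_ex[OF assms] by blast
  have "rooted r p d" unfolding rooted_def adj_def
    using pd by blast
  then show thesis using that by blast
qed

lemma adj_sym: "adj u v \<Longrightarrow> adj v u"
  by (auto simp: adj_def)

lemma adj_verts: "adj u v \<Longrightarrow> u \<in> VT \<and> v \<in> VT"
  using E_verts by (auto simp: adj_def)

lemma adj_act: "adj u v \<Longrightarrow> g \<in> carrier S \<Longrightarrow> adj (act g u) (act g v)"
  using E_act by (auto simp: adj_def)

lemma act_inv [simp]: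
  "g \<in> carrier S \<Longrightarrow> v \<in> VT \<Longrightarrow> act (inv g) (act g v) = v"
  "g \<in> carrier S \<Longrightarrow> v \<in> VT \<Longrightarrow> act g (act (inv g) v) = v"
  using act_mult act_one S.l_inv S.r_inv S.inv_closed by metis+

lemma act_inv_eq: "g \<in> carrier S \<Longrightarrow> v \<in> VT \<Longrightarrow> act g v = w \<Longrightarrow> act (inv g) w = v"
  by auto

lemma adj_act_iff:
  "g \<in> carrier S \<Longrightarrow> u \<in> VT \<Longrightarrow> v \<in> VT \<Longrightarrow> adj (act g u) (act g v) \<longleftrightarrow> adj u v"
  using adj_act[of "act g u" "act g v" "inv g"] adj_act[of u v g] by auto

definition stab :: "'x \<Rightarrow> 'a set" where
  "stab v = {g \<in> carrier S. act g v = v}"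

lemma stab_carrier: "s \<in> stab v \<Longrightarrow> s \<in> carrier S"
  by (simp add: stab_def)

lemma stab_mult: "v \<in> VT \<Longrightarrow> s \<in> stab v \<Longrightarrow> t \<in> stab v \<Longrightarrow> s \<otimes> t \<in> stab v"
  by (auto simp: stab_def act_mult)

lemma stab_one: "v \<in> VT \<Longrightarrow> \<one> \<in> stab v"
  by (auto simp: stab_def act_one)

lemma stab_inv: "v \<in> VT \<Longrightarrow> s \<in> stab v \<Longrightarrow> inv s \<in> stab v"
  by (auto simp: stab_def act_inv_eq)

lemma stab_conj:
  assumes "v \<in> VT" "g \<in> carrier S" "s \<in> stab v"
  shows "g \<otimes> s \<otimes> inv g \<in> stab (act g v)"
  using assms by (auto simp: stab_def act_mult act_closed)

lemma stab_conj':
  assumes "v \<in> VT" "g \<in> carrier S" "s \<in> stab (act g v)"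
  shows "inv g \<otimes> s \<otimes> g \<in> stab v"
  using assms by (auto simp: stab_def act_mult act_closed)

section \<open>Connected transversals of the vertex orbits\<close>

definition conn :: "'x set \<Rightarrow> bool" where
  "conn X \<longleftrightarrow> (\<forall>x\<in>X. \<forall>y\<in>X. (x, y) \<in> {(u, v). u \<in> X \<and> v \<in> X \<and> adj u v}\<^sup>*)"

definition partial_transversal :: "'x set \<Rightarrow> bool" where
  "partial_transversal X \<longleftrightarrow> X \<subseteq> VT \<and> conn X \<and>
    (\<forall>x\<in>X. \<forall>y\<in>X. \<forall>g\<in>carrier S. act g x = y \<longrightarrow> x = y)"

definition transversal :: "'x set \<Rightarrow> bool" where
  "transversal X \<longleftrightarrow> partial_transversal X \<and> (\<forall>v\<in>VT. \<exists>x\<in>X. \<exists>g\<in>carrier S. act g x = v)"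

text \<open>The image of a transversal in the quotient graph is a spanning tree. The edges that are
  not inner lie over the edges outside this spanning tree, the ones that contribute stable letters;
  below they are called outer.\<close>

definition inner :: "'x set \<Rightarrow> 'x \<Rightarrow> 'x \<Rightarrow> bool" where
  "inner X u v \<longleftrightarrow> (\<exists>g\<in>carrier S. act g u \<in> X \<and> act g v \<in> X)"

lemma inner_sym: "inner X u v \<longleftrightarrow> inner X v u"
  by (auto simp: inner_def)

lemma inner_act:
  assumes "g \<in> carrier S" "u \<in> VT" "v \<in> VT"
  shows "inner X (act g u) (act g v) \<longleftrightarrow> inner X u v"
proof
  assume "inner X (act g u) (act g v)"
  then show "inner X u v"
    using assms unfolding inner_def by (metis S.m_closed act_mult)
next
  assume "inner X u v"
  then obtain h where h: "h \<in> carrier S" "act h u \<in> X" "act h v \<in> X" by (auto simp: inner_def)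
  have "act (h \<otimes> inv g) (act g u) = act h u" "act (h \<otimes> inv g) (act g v) = act h v"
    using h assms by (simp_all add: act_mult act_closed)
  then show "inner X (act g u) (act g v)"
    using h assms unfolding inner_def by (metis S.inv_closed S.m_closed)
qed

lemma inner_I: "X \<subseteq> VT \<Longrightarrow> u \<in> X \<Longrightarrow> v \<in> X \<Longrightarrow> inner X u v"
  unfolding inner_def by (metis S.one_closed act_one subsetD)

text \<open>A walk in a tree from the root to \<open>x\<close> passes through all ancestors of
  \<open>x\<close>, and connectedness supplies such a walk inside \<open>X\<close>.\<close>

lemma conn_parent_closed:
  assumes "conn X" "X \<subseteq> VT" "rooted r p d" "r \<in> X" "x \<in> X" "x \<noteq> r"
  shows "p x \<in> X"
proof -
  let ?R = "{(u, v). u \<in> X \<and> v \<in> X \<and> adj u v}"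
  have "(r, x) \<in> ?R\<^sup>*" using assms by (auto simp: conn_def)
  \<comment> \<open>The invariant speaks of all ancestors before the root because the walk may step
    up as well as down. Nothing is known about \<open>p r\<close>, so iterates of \<open>p\<close>
    are followed only while they avoid \<open>r\<close>; the second conjunct covers a parent equal
    to \<open>r\<close>.\<close>
  then have "(\<forall>n. \<not> (\<exists>k\<le>n. (p ^^ k) x = r) \<longrightarrow> (p ^^ n) x \<in> X) \<and> (x \<noteq> r \<longrightarrow> p x \<in> X)"
  proof (induction rule: rtrancl_induct)
    case base
    then show ?case by auto
  next
    case (step y z)
    then have yz: "y \<in> X" "z \<in> X" "adj y z" by auto
    then consider "z \<noteq> r" "y = p z" | "y \<noteq> r" "z = p y" using assms(3) by (auto simp: rooted_def)
    then show ?case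
    proof cases
      case 1
      have "(p ^^ n) z \<in> X" if "\<not> (\<exists>k\<le>n. (p ^^ k) z = r)" for n
      proof (cases n)
        case (Suc m)
        have "\<not> (\<exists>k\<le>m. (p ^^ k) y = r)"
          using that Suc 1 by (metis Suc_le_mono funpow_Suc_right o_apply)
        then show ?thesis using step.IH Suc 1 by (simp add: funpow_swap1)
      qed (use yz in simp)
      then show ?thesis using 1 yz by auto
    next
      case 2
      have A: "(p ^^ n) z \<in> X" if "\<not> (\<exists>k\<le>n. (p ^^ k) z = r)" for n
      proof -
        have "(p ^^ k) y \<noteq> r" if "k \<le> Suc n" for k
          using that \<open>\<not> (\<exists>k\<le>n. (p ^^ k) z = r)\<close> 2 by (cases k) (auto simp: funpow_swap1)
        then have "(p ^^ (Suc n)) y \<in> X" using step.IH by blast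
        then show ?thesis using 2 by (simp add: funpow_swap1)
      qed
      moreover have "p z \<in> X" if "z \<noteq> r"
      proof (cases "p z = r")
        case True
        then show ?thesis using assms by simp
      next
        case False
        then have "(p ^^ k) z \<noteq> r" if "k \<le> 1" for k using that \<open>z \<noteq> r\<close> by (cases k) auto
        then show ?thesis using A[of 1] by simp
      qed
      ultimately show ?thesis by blast
    qed
  qed
  then show ?thesis using assms by blast
qed

text \<open>\<open>D\<close> is the branch beyond \<open>a\<close>, consisting of \<open>a\<close>
  and its descendants. The edge from \<open>a\<close> to \<open>p a\<close> is the only one leaving
  it, so functionals can be prescribed independently on \<open>D\<close> and its complement as long
  as they agree on one edge group.\<close>

lemma descendants:
  assumes pd: "rooted r p d" and r: "r \<in> VT" and a: "a \<in> VT" "a \<noteq> r"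
  obtains D where "D \<subseteq> VT" "a \<in> D" "r \<notin> D" "p a \<notin> D" "\<And>v. v \<in> VT \<Longrightarrow> v \<noteq> r \<Longrightarrow> v \<noteq> a \<Longrightarrow> v \<in> D \<longleftrightarrow> p v \<in> D"
    "\<And>u v. adj u v \<Longrightarrow> u \<in> D \<Longrightarrow> v \<notin> D \<Longrightarrow> u = a \<and> v = p a"
proof -
  note p = pd[unfolded rooted_def, THEN conjunct1, rule_format]
  let ?R = "{(v, p v) | v. v \<in> VT \<and> v \<noteq> r}"
  let ?D = "{v. (v, a) \<in> ?R\<^sup>*}"
  have depth: "d a \<le> d v \<and> v \<in> VT" if "(v, a) \<in> ?R\<^sup>*" for v
    using that
  proof (induction rule: converse_rtrancl_induct)
    case (step u v)
    then have "u \<in> VT" "u \<noteq> r" "v = p u" by auto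
    then have "d u = Suc (d v)" using p[of u] by auto
    then show ?case using step.IH \<open>u \<in> VT\<close> by simp
  qed (use a in simp)
  have iff: "v \<in> ?D \<longleftrightarrow> p v \<in> ?D" if "v \<in> VT" "v \<noteq> r" "v \<noteq> a" for v
  proof
    assume "v \<in> ?D"
    then have "(v, a) \<in> ?R\<^sup>*" by simp
    then show "p v \<in> ?D" by (cases rule: converse_rtranclE) (use that in auto)
  next
    assume "p v \<in> ?D"
    then show "v \<in> ?D" using that by (auto intro: converse_rtrancl_into_rtrancl)
  qed
  have DV: "?D \<subseteq> VT" using depth by blast
  have rD: "r \<notin> ?D"
  proof
    assume "r \<in> ?D"
    then have "(r, a) \<in> ?R\<^sup>*" by simp
    then show False by (cases rule: converse_rtranclE) (use a in auto)
  qed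
  have paD: "p a \<notin> ?D"
  proof
    assume "p a \<in> ?D"
    then have "d a \<le> d (p a)" using depth by blast
    moreover have "d a = Suc (d (p a))" using p[of a] a by auto
    ultimately show False by simp
  qed
  have cross: "u = a \<and> v = p a" if uv: "adj u v" "u \<in> ?D" "v \<notin> ?D" for u v
  proof -
    have V: "u \<in> VT" "v \<in> VT" using adj_verts uv by auto
    have "v \<noteq> a" using uv(3) by auto
    consider "v \<noteq> r" "u = p v" | "u \<noteq> r" "v = p u" using pd uv(1) unfolding rooted_def by blast
    then show ?thesis
    proof cases
      case 1
      then show ?thesis using iff[OF V(2) 1(1) \<open>v \<noteq> a\<close>] uv by blast
    next
      case 2
      then show ?thesis using iff[OF V(1) 2(1)] uv by blast
    qed
  qed
  show thesis by (rule that[of ?D]) (use DV rD paD iff cross in auto)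
qed

text \<open>A maximal connected set without two vertices of one orbit exists by Zorn. If it missed
  an orbit, connectedness of the tree would give a missed vertex adjacent to a translate of it, and
  this could be added after a translation.\<close>

lemma transversal_ex:
  assumes r: "r \<in> VT"
  obtains X where "transversal X" "r \<in> X"
proof -
  let ?A = "{X. partial_transversal X \<and> r \<in> X}"
  have "partial_transversal {r}" using r by (auto simp: partial_transversal_def conn_def)
  then have ne: "?A \<noteq> {}" by blast
  have "\<exists>M\<in>?A. \<forall>X\<in>?A. M \<subseteq> X \<longrightarrow> X = M"
  proof (rule subset_Zorn_nonempty[OF ne])
    fix C assume C: "C \<noteq> {}" "subset.chain ?A C"
    then have CA: "\<And>X. X \<in> C \<Longrightarrow> partial_transversal X \<and> r \<in> X" by (auto simp: subset.chain_def)
    have two: "\<exists>X\<in>C. x \<in> X \<and> y \<in> X" if "x \<in> \<Union>C" "y \<in> \<Union>C" for x y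
      using that C(2) unfolding subset_chain_def by blast
    have "conn (\<Union>C)"
      unfolding conn_def
    proof (intro ballI)
      fix x y assume "x \<in> \<Union>C" "y \<in> \<Union>C"
      then obtain X where X: "X \<in> C" "x \<in> X" "y \<in> X" using two by blast
      then have "(x, y) \<in> {(u, v). u \<in> X \<and> v \<in> X \<and> adj u v}\<^sup>*"
        using CA by (auto simp: partial_transversal_def conn_def)
      then show "(x, y) \<in> {(u, v). u \<in> \<Union>C \<and> v \<in> \<Union>C \<and> adj u v}\<^sup>*"
        by (rule rtrancl_mono[THEN subsetD, rotated]) (use X in blast)
    qed
    moreover have "\<Union>C \<subseteq> VT" using CA unfolding partial_transversal_def by blast
    moreover have "x = y" if "x \<in> \<Union>C" "y \<in> \<Union>C" "g \<in> carrier S" "act g x = y" for x y g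
      using two[OF that(1,2)] that CA by (metis partial_transversal_def)
    ultimately have "partial_transversal (\<Union>C)"
      unfolding partial_transversal_def by blast
    moreover have "r \<in> \<Union>C" using CA C(1) by blast
    ultimately show "\<Union>C \<in> ?A" by blast
  qed
  then obtain M where M: "partial_transversal M" "r \<in> M"
    and max: "\<And>X. partial_transversal X \<Longrightarrow> M \<subseteq> X \<Longrightarrow> X = M"
    by blast
  have MV: "M \<subseteq> VT" using M by (simp add: partial_transversal_def)
  let ?cov = "\<lambda>v. \<exists>x\<in>M. \<exists>g\<in>carrier S. act g x = v"
  obtain p d where pd: "rooted r p d" using rooted_ex[OF r] .
  have extend: "?cov w" if v: "?cov v" and vw: "adj v w" for v w
  proof (rule ccontr)
    assume n: "\<not> ?cov w"
    obtain x g where x: "x \<in> M" "g \<in> carrier S" "act g x = v" using v by blast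
    \<comment> \<open>Translated back by \<open>g\<close>, the missed vertex is adjacent to
      \<open>M\<close> itself, which keeps the enlarged set connected.\<close>
    define w' where "w' = act (inv g) w"
    have w: "w \<in> VT" "v \<in> VT" using vw adj_verts by auto
    have w': "w' \<in> VT" "act g w' = w" using x w by (auto simp: w'_def act_closed)
    have xw': "adj x w'" using x w w' vw MV adj_act_iff[of g x w'] by auto
    have cov': "\<not> ?cov w'"
    proof
      assume "?cov w'"
      then obtain y h where "y \<in> M" "h \<in> carrier S" "act h y = w'" by blast
      then have "act (g \<otimes> h) y = w" using x w' MV by (metis act_mult subsetD)
      then show False using n \<open>y \<in> M\<close> \<open>h \<in> carrier S\<close> x by blast
    qed
    have w'M: "w' \<notin> M" using cov' act_one[OF w'(1)] S.one_closed by metis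
    let ?X = "insert w' M" and ?R = "\<lambda>X. {(u, v). u \<in> X \<and> v \<in> X \<and> adj u v}"
    have sub: "(?R M)\<^sup>* \<subseteq> (?R ?X)\<^sup>*" by (rule rtrancl_mono) auto
    have tox: "(y, x) \<in> (?R ?X)\<^sup>*" "(x, y) \<in> (?R ?X)\<^sup>*" if "y \<in> M" for y
      using that x M sub by (auto simp: partial_transversal_def conn_def)
    have tow: "(w', x) \<in> (?R ?X)\<^sup>*" "(x, w') \<in> (?R ?X)\<^sup>*"
      using xw' adj_sym[OF xw'] x by (blast intro: r_into_rtrancl)+
    have "conn ?X"
      unfolding conn_def
    proof (intro ballI)
      fix a b assume ab: "a \<in> ?X" "b \<in> ?X"
      have "(a, x) \<in> (?R ?X)\<^sup>*" using ab(1) tow tox by blast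
      moreover have "(x, b) \<in> (?R ?X)\<^sup>*" using ab(2) tow tox by blast
      ultimately show "(a, b) \<in> (?R ?X)\<^sup>*" by (rule rtrancl_trans)
    qed
    moreover have "a = b" if ab: "a \<in> ?X" "b \<in> ?X" "h \<in> carrier S" "act h a = b" for a b h
    proof -
      have *: "act (inv h) b = a" using ab act_inv_eq MV w' by blast
      consider "a \<in> M" "b \<in> M" | "a \<in> M" "b = w'" | "a = w'" "b \<in> M" | "a = w'" "b = w'"
        using ab by blast
      then show ?thesis
      proof cases
        case 1
        then show ?thesis using ab M(1) unfolding partial_transversal_def by blast
      next
        case 2
        then show ?thesis using ab cov' by blast
      next
        case 3
        then show ?thesis using * ab(3) cov' S.inv_closed by blast
      qed simp
    qed
    ultimately have "partial_transversal ?X"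
      using MV w' by (auto simp: partial_transversal_def)
    then show False using max w'M by blast
  qed
  have "?cov v" if "v \<in> VT" for v
    using that
  proof (induction "d v" arbitrary: v rule: less_induct)
    case less
    show ?case
    proof (cases "v = r")
      case True
      then show ?thesis using M(2) act_one r by blast
    next
      case False
      then have "p v \<in> VT" "d (p v) < d v" "adj (p v) v" using pd less.prems by (auto simp: rooted_def)
      then show ?thesis using less.hyps extend by blast
    qed
  qed
  then have "transversal M" using M by (simp add: transversal_def)
  then show thesis using that M by blast
qed

lemma adj_closed_eq:
  assumes "A \<subseteq> VT" "A \<noteq> {}" "\<And>u v. u \<in> A \<Longrightarrow> adj u v \<Longrightarrow> v \<in> A"
  shows "A = VT"
proof -
  obtain r where r: "r \<in> A" using assms by blast
  obtain p d where pd: "rooted r p d" using rooted_ex r assms by blast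
  have "v \<in> A" if "v \<in> VT" for v
    using that
  proof (induction "d v" arbitrary: v rule: less_induct)
    case less
    show ?case
    proof (cases "v = r")
      case False
      then have "p v \<in> VT" "d (p v) < d v" "adj (p v) v" using pd less.prems by (auto simp: rooted_def)
      then show ?thesis using less.hyps assms(3) by blast
    qed (use r in simp)
  qed
  then show ?thesis using assms by blast
qed

text \<open>
  Homomorphisms out of a group acting on a tree are glued from homomorphisms on the stabilisers of
  the vertices in a transversal. A map \<open>c\<close> on the action groupoid is extended by labels \<open>\<kappa>\<close> on
  oriented edges with \<open>\<kappa> (g u) (g v) = c g u \<cdot> \<kappa> u v \<cdot> (c g v)\<inverse>\<close>; multiplying the labels along
  paths from the root is unambiguous in a tree.
\<close>

lemma hom_from_tree_action:
  assumes K: "group K" and X: "transversal X"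
    and f_closed: "\<And>x s. x \<in> X \<Longrightarrow> s \<in> stab x \<Longrightarrow> f x s \<in> carrier K"
    and f_mult: "\<And>x s t. x \<in> X \<Longrightarrow> s \<in> stab x \<Longrightarrow> t \<in> stab x \<Longrightarrow> f x (s \<otimes> t) = f x s \<otimes>\<^bsub>K\<^esub> f x t"
    and f_compat: "\<And>x y s. x \<in> X \<Longrightarrow> y \<in> X \<Longrightarrow> adj x y \<Longrightarrow> s \<in> stab x \<Longrightarrow> s \<in> stab y \<Longrightarrow> f x s = f y s"
    and f_kill: "\<And>x y s. x \<in> X \<Longrightarrow> adj x y \<Longrightarrow> \<not> inner X x y \<Longrightarrow> s \<in> stab x \<Longrightarrow> s \<in> stab y \<Longrightarrow> f x s = \<one>\<^bsub>K\<^esub>"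
    and lab_closed: "\<And>u v. lab u v \<in> carrier K"
    and lab_act: "\<And>u v g. (u, v) \<in> E \<Longrightarrow> g \<in> carrier S \<Longrightarrow> lab (act g u) (act g v) = lab u v"
    and lab_inner: "\<And>u v. (u, v) \<in> E \<Longrightarrow> inner X u v \<Longrightarrow> lab u v = \<one>\<^bsub>K\<^esub>"
  obtains \<phi> where "\<phi> \<in> hom S K" "\<And>x s. x \<in> X \<Longrightarrow> s \<in> stab x \<Longrightarrow> \<phi> s = f x s"
    "\<And>u x t. u \<in> X \<Longrightarrow> x \<in> X \<Longrightarrow> t \<in> carrier S \<Longrightarrow> (u, act t x) \<in> E \<Longrightarrow> \<not> inner X u (act t x) \<Longrightarrow>
      \<exists>h\<in>stab u. \<exists>s\<in>stab x. \<phi> (h \<otimes> t \<otimes> s) = lab u (act t x)"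
proof -
  interpret K: group K by fact
  have XV: "X \<subseteq> VT" and Xconn: "conn X"
    and Xinj: "\<And>x y g. x \<in> X \<Longrightarrow> y \<in> X \<Longrightarrow> g \<in> carrier S \<Longrightarrow> act g x = y \<Longrightarrow> x = y"
    and Xcov: "\<And>v. v \<in> VT \<Longrightarrow> \<exists>x\<in>X. \<exists>g\<in>carrier S. act g x = v"
    using X by (auto simp: transversal_def partial_transversal_def)
  have f_one: "f x \<one> = \<one>\<^bsub>K\<^esub>" if "x \<in> X" for x
    using f_mult[OF that, of \<one> \<one>] f_closed[OF that, of \<one>] stab_one[of x] XV that
    by (metis K.r_cancel_one S.l_one S.one_closed subsetD)

  \<comment> \<open>\<open>rep v\<close> is the vertex of \<open>X\<close> in the orbit of
    \<open>v\<close>, and \<open>\<gamma> v\<close> carries it to \<open>v\<close>. Normalising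
    \<open>\<gamma>\<close> to be trivial on \<open>X\<close> makes the final homomorphism restrict
    to \<open>f x\<close> itself and not to a conjugate.\<close>
  have "\<exists>x g. v \<in> VT \<longrightarrow> x \<in> X \<and> g \<in> carrier S \<and> act g x = v \<and> (v \<in> X \<longrightarrow> g = \<one>)" for v
  proof (cases "v \<in> X")
    case True
    then have "v \<in> X \<and> \<one> \<in> carrier S \<and> act \<one> v = v" using act_one XV by auto
    then show ?thesis by blast
  next
    case False
    then show ?thesis using Xcov by blast
  qed
  then obtain rep \<gamma> where "\<forall>v. v \<in> VT \<longrightarrow> rep v \<in> X \<and> \<gamma> v \<in> carrier S \<and> act (\<gamma> v) (rep v) = v \<and> (v \<in> X \<longrightarrow> \<gamma> v = \<one>)"
    by metis
  then have rep: "\<And>v. v \<in> VT \<Longrightarrow> rep v \<in> X" and \<gamma>: "\<And>v. v \<in> VT \<Longrightarrow> \<gamma> v \<in> carrier S"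
    and \<gamma>_rep: "\<And>v. v \<in> VT \<Longrightarrow> act (\<gamma> v) (rep v) = v" and \<gamma>_X: "\<And>v. v \<in> X \<Longrightarrow> \<gamma> v = \<one>"
    using XV by auto
  have rep_VT: "rep v \<in> VT" if "v \<in> VT" for v using rep[OF that] XV by auto
  have rep_eq: "rep v = x" if "x \<in> X" "g \<in> carrier S" "act g x = v" for v x g
  proof -
    have v: "v \<in> VT" "x \<in> VT" using that XV act_closed by auto
    have "act (inv (\<gamma> v) \<otimes> g) x = rep v"
      using v that \<gamma> act_inv(1)[OF \<gamma>[OF v(1)] rep_VT[OF v(1)]] \<gamma>_rep by (simp add: act_mult)
    then show ?thesis using Xinj that rep \<gamma> v by (metis S.inv_closed S.m_closed)
  qed
  have rep_act: "rep (act g v) = rep v" if "g \<in> carrier S" "v \<in> VT" for g v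
    using rep_eq[of "rep v" "g \<otimes> \<gamma> v"] that rep \<gamma> \<gamma>_rep rep_VT by (simp add: act_mult)
  have rep_X: "rep x = x" if "x \<in> X" for x
    using rep_eq[of x \<one>] that XV act_one by auto

  \<comment> \<open>The action of \<open>g\<close> at \<open>v\<close>, moved to the representative
    by \<open>\<gamma>\<close>, is an element of its stabiliser. This is a cocycle, and
    \<open>f\<close> turns it into the map \<open>c\<close> on the action groupoid.\<close>
  define \<sigma> where "\<sigma> g v = inv (\<gamma> (act g v)) \<otimes> g \<otimes> \<gamma> v" for g v
  have \<sigma>: "\<sigma> g v \<in> stab (rep v)" if "g \<in> carrier S" "v \<in> VT" for g v
  proof -
    have gv: "act g v \<in> VT" using that act_closed by auto
    have "act (\<sigma> g v) (rep v) = act (inv (\<gamma> (act g v))) (act g v)"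
      using that \<gamma> gv rep_VT \<gamma>_rep by (simp add: \<sigma>_def act_mult)
    also have "\<dots> = rep (act g v)" using act_inv_eq[OF \<gamma>[OF gv] rep_VT[OF gv]] \<gamma>_rep[OF gv] by auto
    finally show ?thesis using that \<gamma> gv rep_act by (auto simp: stab_def \<sigma>_def)
  qed
  define c where "c g v = f (rep v) (\<sigma> g v)" for g v
  have c_closed [simp]: "c g v \<in> carrier K" if "g \<in> carrier S" "v \<in> VT" for g v
    using that f_closed rep \<sigma> by (simp add: c_def)
  have c_mult: "c (g \<otimes> h) v = c g (act h v) \<otimes>\<^bsub>K\<^esub> c h v"
    if "g \<in> carrier S" "h \<in> carrier S" "v \<in> VT" for g h v
  proof -
    have hv: "act h v \<in> VT" "act g (act h v) \<in> VT" using that act_closed by auto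
    have "\<sigma> (g \<otimes> h) v = \<sigma> g (act h v) \<otimes> \<sigma> h v"
      using that \<gamma> hv by (simp add: \<sigma>_def S.m_assoc act_mult S.mult_inv_cancel)
    then show ?thesis
      using that rep_act[of h v] \<sigma>[of g "act h v"] \<sigma>[of h v] hv f_mult rep by (simp add: c_def)
  qed
  have c_X: "c s x = f x s" if "x \<in> X" "s \<in> stab x" for x s
    using that \<gamma>_X rep_X XV by (auto simp: c_def \<sigma>_def stab_def)
  have c_kill: "c s v = \<one>\<^bsub>K\<^esub>" if "adj u v" "\<not> inner X u v" "s \<in> stab u" "s \<in> stab v" for s u v
  proof -
    have uv: "u \<in> VT" "v \<in> VT" using that(1) adj_verts by auto
    have s: "s \<in> carrier S" "act s v = v" using that(4) by (auto simp: stab_def)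
    let ?u = "act (inv (\<gamma> v)) u"
    have v: "act (inv (\<gamma> v)) v = rep v" using act_inv_eq[OF \<gamma> rep_VT \<gamma>_rep] uv by blast
    have "adj (rep v) ?u" using adj_act[OF adj_sym[OF that(1)], of "inv (\<gamma> v)"] \<gamma> uv v by simp
    moreover have "\<not> inner X (rep v) ?u"
      using that(2) inner_act[of "inv (\<gamma> v)" u v X] inner_sym v \<gamma> uv by (metis S.inv_closed)
    moreover have "inv (\<gamma> v) \<otimes> s \<otimes> \<gamma> v \<in> stab ?u"
      using stab_conj[OF uv(1), of "inv (\<gamma> v)" s] that(3) \<gamma> uv by simp
    moreover have "\<sigma> s v = inv (\<gamma> v) \<otimes> s \<otimes> \<gamma> v" by (simp add: \<sigma>_def s)
    ultimately show ?thesis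
      using f_kill[of "rep v" ?u "\<sigma> s v"] \<sigma>[OF s(1) uv(2)] rep uv by (simp add: c_def)
  qed

  define orb where "orb u v = {(act g u, act g v) | g. g \<in> carrier S}" for u v
  have orb_act: "orb (act g u) (act g v) = orb u v" if "g \<in> carrier S" "u \<in> VT" "v \<in> VT" for g u v
  proof
    show "orb (act g u) (act g v) \<subseteq> orb u v"
      using that unfolding orb_def by (auto simp: act_mult[symmetric])
    show "orb u v \<subseteq> orb (act g u) (act g v)"
    proof
      fix e assume "e \<in> orb u v"
      then obtain h where h: "h \<in> carrier S" "e = (act h u, act h v)" by (auto simp: orb_def)
      then have "e = (act (h \<otimes> inv g) (act g u), act (h \<otimes> inv g) (act g v))" "h \<otimes> inv g \<in> carrier S"
        using that by (simp_all add: act_mult act_closed)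
      then show "e \<in> orb (act g u) (act g v)" unfolding orb_def by blast
    qed
  qed
  \<comment> \<open>The condition depends only on the orbit of the edge, hence so does the choice.
    An inner edge is moved into \<open>X\<close> entirely, any other edge with its first
    end.\<close>
  define er where "er u v = (SOME e. e \<in> orb u v \<and> fst e \<in> X \<and> (inner X u v \<longrightarrow> snd e \<in> X))" for u v
  have er: "er u v \<in> orb u v \<and> fst (er u v) \<in> X \<and> (inner X u v \<longrightarrow> snd (er u v) \<in> X)" if "(u, v) \<in> E" for u v
    unfolding er_def
  proof (rule someI_ex, cases "inner X u v")
    case True
    then show "\<exists>e. e \<in> orb u v \<and> fst e \<in> X \<and> (inner X u v \<longrightarrow> snd e \<in> X)"
      unfolding inner_def orb_def by (metis (mono_tags, lifting) fst_conv mem_Collect_eq snd_conv)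
  next
    case False
    have u: "u \<in> VT" using that E_verts by blast
    have "act (inv (\<gamma> u)) u = rep u" using act_inv_eq[OF \<gamma> rep_VT \<gamma>_rep] u by blast
    then have "(rep u, act (inv (\<gamma> u)) v) \<in> orb u v" using \<gamma>[OF u] unfolding orb_def by force
    then show "\<exists>e. e \<in> orb u v \<and> fst e \<in> X \<and> (inner X u v \<longrightarrow> snd e \<in> X)"
      using False rep[OF u] by (metis fst_conv)
  qed
  have er_act: "er (act g u) (act g v) = er u v" if "g \<in> carrier S" "(u, v) \<in> E" for g u v
    using orb_act inner_act that E_verts[OF that(2)] by (simp add: er_def)
  have "\<exists>g. (u, v) \<in> E \<longrightarrow> g \<in> carrier S \<and> act g (fst (er u v)) = u \<and> act g (snd (er u v)) = v" for u v
  proof (cases "(u, v) \<in> E")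
    case True
    then obtain h where h: "h \<in> carrier S" "er u v = (act h u, act h v)" using er[OF True] by (auto simp: orb_def)
    then have "act (inv h) (fst (er u v)) = u" "act (inv h) (snd (er u v)) = v" "inv h \<in> carrier S"
      using E_verts[OF True] by auto
    then show ?thesis by blast
  qed simp
  then obtain eg where eg: "\<And>u v. (u, v) \<in> E \<Longrightarrow> eg u v \<in> carrier S"
    "\<And>u v. (u, v) \<in> E \<Longrightarrow> act (eg u v) (fst (er u v)) = u"
    "\<And>u v. (u, v) \<in> E \<Longrightarrow> act (eg u v) (snd (er u v)) = v"
    by metis
  have er_E: "(fst (er u v), snd (er u v)) \<in> E" if "(u, v) \<in> E" for u v
    using er[OF that] E_act[OF that] by (auto simp: orb_def)
  have er_lab: "lab (fst (er u v)) (snd (er u v)) = lab u v" if "(u, v) \<in> E" for u v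
    using er[OF that] lab_act[OF that] by (auto simp: orb_def)
  have er_inner: "inner X (fst (er u v)) (snd (er u v)) = inner X u v" if "(u, v) \<in> E" for u v
    using er[OF that] inner_act[of _ u v X] E_verts[OF that] by (auto simp: orb_def)
  have c_edge: "c s (fst (er u v)) \<otimes>\<^bsub>K\<^esub> lab u v = lab u v \<otimes>\<^bsub>K\<^esub> c s (snd (er u v))"
    if uv: "(u, v) \<in> E" and s: "s \<in> stab (fst (er u v))" "s \<in> stab (snd (er u v))" for u v s
  proof -
    have a: "adj (fst (er u v)) (snd (er u v))" using er_E[OF uv] by (auto simp: adj_def)
    show ?thesis
    proof (cases "inner X u v")
      case True
      then have "fst (er u v) \<in> X" "snd (er u v) \<in> X" using er[OF uv] by auto
      then show ?thesis using c_X s f_compat a f_closed lab_inner[OF uv True] by simp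
    next
      case False
      then have "\<not> inner X (fst (er u v)) (snd (er u v))" using er_inner[OF uv] by simp
      then show ?thesis
        using c_kill[OF a _ s] c_kill[OF adj_sym[OF a] _ s(2,1)] lab_closed inner_sym by simp
    qed
  qed
  \<comment> \<open>The label is prescribed on the representative edge and carried to
    \<open>(u, v)\<close> by \<open>eg u v\<close>. Another carrying element differs by one that
    fixes the representative, and \<open>c_edge\<close> says that such an element changes
    nothing.\<close>
  define \<kappa> where "\<kappa> u v = c (eg u v) (fst (er u v)) \<otimes>\<^bsub>K\<^esub> lab u v \<otimes>\<^bsub>K\<^esub> inv\<^bsub>K\<^esub> c (eg u v) (snd (er u v))" for u v
  have \<kappa>_closed: "\<kappa> u v \<in> carrier K" if "(u, v) \<in> E" for u v
    using E_verts[OF er_E[OF that]] eg(1)[OF that] lab_closed by (simp add: \<kappa>_def)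
  have \<kappa>_act: "\<kappa> (act g u) (act g v) = c g u \<otimes>\<^bsub>K\<^esub> \<kappa> u v \<otimes>\<^bsub>K\<^esub> inv\<^bsub>K\<^esub> c g v"
    if g: "g \<in> carrier S" and uv: "(u, v) \<in> E" for g u v
  proof -
    let ?a = "fst (er u v)" and ?b = "snd (er u v)" and ?h = "eg u v" and ?k = "eg (act g u) (act g v)"
    have guv: "(act g u, act g v) \<in> E" using E_act[OF uv g] .
    have V: "u \<in> VT" "v \<in> VT" "?a \<in> VT" "?b \<in> VT" using E_verts uv er_E[OF uv] by blast+
    have er': "er (act g u) (act g v) = er u v" using er_act[OF g uv] .
    have h: "?h \<in> carrier S" "act ?h ?a = u" "act ?h ?b = v" using eg[OF uv] by auto
    have k: "?k \<in> carrier S" "act ?k ?a = act g u" "act ?k ?b = act g v" using eg[OF guv] er' by auto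
    define s where "s = inv ?k \<otimes> (g \<otimes> ?h)"
    have gh: "g \<otimes> ?h = ?k \<otimes> s"
      using g h(1) k(1) by (simp add: s_def S.m_assoc[symmetric])
    have sc: "s \<in> carrier S" using g h k by (simp add: s_def)
    have "act s ?a = act (inv ?k) (act ?k ?a)" "act s ?b = act (inv ?k) (act ?k ?b)"
      using g h V k by (simp_all add: s_def act_mult act_closed)
    then have s: "s \<in> stab ?a" "s \<in> stab ?b" using V k(1) sc by (simp_all add: stab_def)
    have 1: "c g u \<otimes>\<^bsub>K\<^esub> c ?h ?a = c ?k ?a \<otimes>\<^bsub>K\<^esub> c s ?a"
      using c_mult[OF g h(1) V(3)] c_mult[OF k(1) sc V(3)] h gh s by (simp add: stab_def)
    have 2: "c g v \<otimes>\<^bsub>K\<^esub> c ?h ?b = c ?k ?b \<otimes>\<^bsub>K\<^esub> c s ?b"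
      using c_mult[OF g h(1) V(4)] c_mult[OF k(1) sc V(4)] h gh s by (simp add: stab_def)
    note cl = c_closed[OF g V(1)] c_closed[OF g V(2)] c_closed[OF h(1) V(3)] c_closed[OF h(1) V(4)]
      c_closed[OF k(1) V(3)] c_closed[OF k(1) V(4)] c_closed[OF sc V(3)] c_closed[OF sc V(4)] lab_closed
    have "c g u \<otimes>\<^bsub>K\<^esub> \<kappa> u v \<otimes>\<^bsub>K\<^esub> inv\<^bsub>K\<^esub> c g v
        = (c g u \<otimes>\<^bsub>K\<^esub> c ?h ?a) \<otimes>\<^bsub>K\<^esub> lab u v \<otimes>\<^bsub>K\<^esub> inv\<^bsub>K\<^esub> (c g v \<otimes>\<^bsub>K\<^esub> c ?h ?b)"
      using cl by (simp add: \<kappa>_def K.m_assoc K.inv_mult_group)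
    also have "\<dots> = c ?k ?a \<otimes>\<^bsub>K\<^esub> (c s ?a \<otimes>\<^bsub>K\<^esub> lab u v) \<otimes>\<^bsub>K\<^esub> inv\<^bsub>K\<^esub> (c ?k ?b \<otimes>\<^bsub>K\<^esub> c s ?b)"
      using 1 2 cl by (simp add: K.m_assoc)
    also have "\<dots> = c ?k ?a \<otimes>\<^bsub>K\<^esub> (lab u v \<otimes>\<^bsub>K\<^esub> c s ?b) \<otimes>\<^bsub>K\<^esub> inv\<^bsub>K\<^esub> (c ?k ?b \<otimes>\<^bsub>K\<^esub> c s ?b)"
      using c_edge[OF uv s] by simp
    also have "\<dots> = \<kappa> (act g u) (act g v)"
      using cl er' lab_act[OF uv g] by (simp add: \<kappa>_def K.m_assoc K.inv_mult_group K.mult_inv_cancel)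
    finally show ?thesis by simp
  qed
  define \<kappa>' where "\<kappa>' u v = (if (u, v) \<in> E then \<kappa> u v else inv\<^bsub>K\<^esub> \<kappa> v u)" for u v
  have \<kappa>'_closed: "\<kappa>' u v \<in> carrier K" if "adj u v" for u v
    using that \<kappa>_closed by (auto simp: \<kappa>'_def adj_def)
  have \<kappa>'_inv: "\<kappa>' v u = inv\<^bsub>K\<^esub> \<kappa>' u v" if "adj u v" for u v
    using that \<kappa>_closed E_asym by (auto simp: \<kappa>'_def adj_def)
  have \<kappa>'_act: "\<kappa>' (act g u) (act g v) = c g u \<otimes>\<^bsub>K\<^esub> \<kappa>' u v \<otimes>\<^bsub>K\<^esub> inv\<^bsub>K\<^esub> c g v"
    if g: "g \<in> carrier S" and uv: "adj u v" for g u v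
  proof (cases "(u, v) \<in> E")
    case True
    then show ?thesis using \<kappa>_act[OF g True] E_act[OF True g] by (simp add: \<kappa>'_def)
  next
    case False
    then have vu: "(v, u) \<in> E" using uv by (auto simp: adj_def)
    have "(act g u, act g v) \<notin> E" using E_asym E_act[OF vu g] by blast
    then show ?thesis
      using False \<kappa>_act[OF g vu] \<kappa>_closed[OF vu] g E_verts[OF vu]
      by (simp add: \<kappa>'_def K.inv_mult_group K.m_assoc)
  qed
  have \<kappa>'_X: "\<kappa>' x y = \<one>\<^bsub>K\<^esub>" if xy: "x \<in> X" "y \<in> X" "adj x y" for x y
  proof -
    have "\<kappa> x y = \<one>\<^bsub>K\<^esub>" if xy: "x \<in> X" "y \<in> X" "(x, y) \<in> E" for x y
    proof -
      have inn: "inner X x y" using inner_I XV xy by blast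
      have er_xy: "fst (er x y) = x" "snd (er x y) = y"
        using Xinj er[OF xy(3)] inn eg[OF xy(3)] xy by blast+
      have st: "eg x y \<in> stab x" "eg x y \<in> stab y" using eg[OF xy(3)] unfolding er_xy stab_def by blast+
      have "adj x y" using xy(3) by (simp add: adj_def)
      then have "c (eg x y) x = c (eg x y) y"
        using c_X[OF xy(1) st(1)] c_X[OF xy(2) st(2)] f_compat[OF xy(1,2) _ st] by simp
      moreover have "c (eg x y) y \<in> carrier K" using c_closed stab_carrier[OF st(1)] xy(2) XV by blast
      ultimately show ?thesis
        unfolding \<kappa>_def er_xy lab_inner[OF xy(3) inn] by simp
    qed
    then show ?thesis using that by (auto simp: \<kappa>'_def adj_def)
  qed

  obtain v0 where "v0 \<in> VT" using VT_nonempty by blast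
  then obtain r where r: "r \<in> X" using Xcov by blast
  then have rV: "r \<in> VT" using XV by auto
  obtain p d where pd: "rooted r p d" using rooted_ex[OF rV] .
  note p = pd[unfolded rooted_def, THEN conjunct1, rule_format]
  \<comment> \<open>Recursion on the depth multiplies the labels on the path from the root. Since
    \<open>d r\<close> need not be 0, the recursion also stops on reaching \<open>r\<close>.\<close>
  define P where "P = rec_nat (\<lambda>v. \<one>\<^bsub>K\<^esub>) (\<lambda>n F v. if v = r then \<one>\<^bsub>K\<^esub> else F (p v) \<otimes>\<^bsub>K\<^esub> \<kappa>' (p v) v)"
  define \<pi> where "\<pi> v = (if v = r then \<one>\<^bsub>K\<^esub> else P (d v) v)" for v
  have \<pi>_r: "\<pi> r = \<one>\<^bsub>K\<^esub>" by (simp add: \<pi>_def)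
  have P_r: "P n r = \<one>\<^bsub>K\<^esub>" for n by (cases n) (simp_all add: P_def)
  have \<pi>_p: "\<pi> v = \<pi> (p v) \<otimes>\<^bsub>K\<^esub> \<kappa>' (p v) v" if "v \<in> VT" "v \<noteq> r" for v
  proof -
    have "d v = Suc (d (p v))" using p that by auto
    then have "\<pi> v = P (d (p v)) (p v) \<otimes>\<^bsub>K\<^esub> \<kappa>' (p v) v" using that by (simp add: \<pi>_def P_def)
    then show ?thesis by (simp add: \<pi>_def P_r)
  qed
  have depth_induct: "Q v" if "v \<in> VT" "Q r" "\<And>v. v \<in> VT \<Longrightarrow> v \<noteq> r \<Longrightarrow> Q (p v) \<Longrightarrow> Q v" for Q v
    using that(1)
  proof (induction "d v" arbitrary: v rule: less_induct)
    case less
    show ?case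
    proof (cases "v = r")
      case False
      then have "p v \<in> VT" "d (p v) < d v" using p less.prems by auto
      then show ?thesis using that(3) less False by blast
    qed (use that(2) in simp)
  qed
  have \<pi>_closed: "\<pi> v \<in> carrier K" if "v \<in> VT" for v
    by (rule depth_induct[OF that]) (use \<pi>_r \<pi>_p p \<kappa>'_closed in auto)
  have \<pi>_adj: "\<pi> v = \<pi> u \<otimes>\<^bsub>K\<^esub> \<kappa>' u v" if uv: "adj u v" for u v
  proof -
    have V: "u \<in> VT" "v \<in> VT" using adj_verts[OF uv] by auto
    consider "v \<noteq> r" "u = p v" | "u \<noteq> r" "v = p u" using pd uv by (auto simp: rooted_def)
    then show ?thesis
    proof cases
      case 1
      then show ?thesis using \<pi>_p V by blast
    next
      case 2
      then show ?thesis
        using \<pi>_p[OF V(1) 2(1)] \<kappa>'_inv[OF adj_sym[OF uv]] \<kappa>'_closed[OF adj_sym[OF uv]] \<pi>_closed[OF V(2)]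
        by (simp add: K.m_assoc)
    qed
  qed
  have \<pi>_X: "\<pi> x = \<one>\<^bsub>K\<^esub>" if "x \<in> X" for x
  proof -
    have "x \<in> X \<longrightarrow> \<pi> x = \<one>\<^bsub>K\<^esub>"
    proof (rule depth_induct[of x "\<lambda>x. x \<in> X \<longrightarrow> \<pi> x = \<one>\<^bsub>K\<^esub>"])
      show "x \<in> VT" using that XV by auto
      fix v assume v: "v \<in> VT" "v \<noteq> r" "p v \<in> X \<longrightarrow> \<pi> (p v) = \<one>\<^bsub>K\<^esub>"
      show "v \<in> X \<longrightarrow> \<pi> v = \<one>\<^bsub>K\<^esub>"
      proof
        assume vX: "v \<in> X"
        then have "p v \<in> X" using conn_parent_closed[OF Xconn XV pd r _ v(2)] by blast
        then show "\<pi> v = \<one>\<^bsub>K\<^esub>" using \<pi>_p[OF v(1,2)] v \<kappa>'_X vX p by simp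
      qed
    qed (use \<pi>_r in simp)
    then show ?thesis using that by blast
  qed
  \<comment> \<open>Labels along the path from \<open>r\<close> to its translate, followed by the
    cocycle at \<open>r\<close>. The equation \<open>key\<close> expresses that any other base
    vertex gives the same value, and multiplicativity follows by taking a translate of
    \<open>r\<close> there.\<close>
  define \<phi> where "\<phi> g = \<pi> (act g r) \<otimes>\<^bsub>K\<^esub> c g r" for g
  have \<phi>_closed: "\<phi> g \<in> carrier K" if "g \<in> carrier S" for g
    using that \<pi>_closed act_closed rV by (simp add: \<phi>_def)
  have key: "\<pi> (act g v) = \<phi> g \<otimes>\<^bsub>K\<^esub> \<pi> v \<otimes>\<^bsub>K\<^esub> inv\<^bsub>K\<^esub> c g v" if g: "g \<in> carrier S" and v: "v \<in> VT" for g v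
  proof (rule depth_induct[OF v])
    show "\<pi> (act g r) = \<phi> g \<otimes>\<^bsub>K\<^esub> \<pi> r \<otimes>\<^bsub>K\<^esub> inv\<^bsub>K\<^esub> c g r"
      using g rV \<pi>_closed act_closed \<pi>_r by (simp add: \<phi>_def K.m_assoc)
  next
    fix v assume v: "v \<in> VT" "v \<noteq> r" and IH: "\<pi> (act g (p v)) = \<phi> g \<otimes>\<^bsub>K\<^esub> \<pi> (p v) \<otimes>\<^bsub>K\<^esub> inv\<^bsub>K\<^esub> c g (p v)"
    have pv: "p v \<in> VT" "adj (p v) v" using p v by auto
    note cl = \<phi>_closed[OF g] \<pi>_closed[OF v(1)] \<pi>_closed[OF pv(1)] c_closed[OF g v(1)] c_closed[OF g pv(1)] \<kappa>'_closed[OF pv(2)]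
    have "\<pi> (act g v) = \<pi> (act g (p v)) \<otimes>\<^bsub>K\<^esub> \<kappa>' (act g (p v)) (act g v)"
      using \<pi>_adj[OF adj_act[OF pv(2) g]] .
    also have "\<dots> = \<phi> g \<otimes>\<^bsub>K\<^esub> \<pi> v \<otimes>\<^bsub>K\<^esub> inv\<^bsub>K\<^esub> c g v"
      using cl by (simp add: IH \<kappa>'_act[OF g pv(2)] \<pi>_p[OF v] K.m_assoc K.mult_inv_cancel)
    finally show "\<pi> (act g v) = \<phi> g \<otimes>\<^bsub>K\<^esub> \<pi> v \<otimes>\<^bsub>K\<^esub> inv\<^bsub>K\<^esub> c g v" .
  qed
  show thesis
  proof (rule that)
    show "\<phi> \<in> hom S K"
    proof (rule homI)
      fix g h assume g: "g \<in> carrier S" and h: "h \<in> carrier S"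
      have hr: "act h r \<in> VT" using act_closed h rV by auto
      note cl = \<phi>_closed[OF g] \<phi>_closed[OF h] \<pi>_closed[OF hr] c_closed[OF g hr] c_closed[OF h rV]
      have "\<phi> (g \<otimes> h) = \<pi> (act g (act h r)) \<otimes>\<^bsub>K\<^esub> (c g (act h r) \<otimes>\<^bsub>K\<^esub> c h r)"
        using c_mult[OF g h rV] act_mult[OF g h rV] by (simp add: \<phi>_def)
      also have "\<dots> = \<phi> g \<otimes>\<^bsub>K\<^esub> \<phi> h"
        using cl by (simp add: key[OF g hr] \<phi>_def[of h] K.m_assoc K.mult_inv_cancel)
      finally show "\<phi> (g \<otimes> h) = \<phi> g \<otimes>\<^bsub>K\<^esub> \<phi> h" .
    qed (rule \<phi>_closed)
  next
    fix x s assume x: "x \<in> X" and s: "s \<in> stab x"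
    have xV: "x \<in> VT" and sc: "s \<in> carrier S" using x XV s stab_carrier by auto
    have "\<one>\<^bsub>K\<^esub> = \<phi> s \<otimes>\<^bsub>K\<^esub> inv\<^bsub>K\<^esub> f x s"
      using key[OF sc xV] \<pi>_X[OF x] s c_X[OF x s] \<phi>_closed[OF sc] by (simp add: stab_def)
    then show "\<phi> s = f x s"
      using \<phi>_closed[OF sc] f_closed[OF x s] by (metis K.inv_closed K.inv_inv K.inv_solve_right K.l_one K.one_closed)
  next
    fix u x t
    assume u: "u \<in> X" and x: "x \<in> X" and t: "t \<in> carrier S" and ut: "(u, act t x) \<in> E" and out: "\<not> inner X u (act t x)"
    let ?v = "act t x" and ?k = "eg u (act t x)" and ?w = "snd (er u (act t x))"
    have V: "u \<in> VT" "x \<in> VT" "?v \<in> VT" using u x t XV act_closed by auto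
    have er_u: "fst (er u ?v) = u" using Xinj[OF _ u] er[OF ut] eg[OF ut] by blast
    have k: "?k \<in> carrier S" "act ?k u = u" "act ?k ?w = ?v" using eg[OF ut] er_u by auto
    have uw: "(u, ?w) \<in> E" using er_E[OF ut] er_u by simp
    have wV: "?w \<in> VT" using E_verts[OF uw] by auto
    have out': "\<not> inner X u ?w" using out er_inner[OF ut] er_u by simp
    have "?w = act (inv ?k \<otimes> t) x" using act_inv_eq[OF k(1) wV k(3)] k t V by (simp add: act_mult)
    then have rw: "rep ?w = x" using rep_eq[OF x, of "inv ?k \<otimes> t" ?w] k t by simp
    \<comment> \<open>For \<open>\<gamma> ?w\<close> the cocycle at \<open>x\<close> is trivial, so
      its image is the bare label of the edge. It differs from \<open>t\<close> only by stabiliser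
      elements on the two sides.\<close>
    define g where "g = \<gamma> ?w"
    have g: "g \<in> carrier S" "act g x = ?w" using \<gamma>[OF wV] \<gamma>_rep[OF wV] rw by (auto simp: g_def)
    define s where "s = inv t \<otimes> ?k \<otimes> g"
    have s: "s \<in> stab x"
      using g k t V wV by (simp add: s_def stab_def act_mult act_closed)
    have g_eq: "inv ?k \<otimes> t \<otimes> s = g"
      using g k t by (simp add: s_def S.m_assoc S.mult_inv_cancel)
    have er_w: "er u ?w = er u ?v"
    proof -
      have "er (act ?k u) (act ?k ?w) = er u ?w" by (rule er_act[OF k(1) uw])
      then show ?thesis using k by simp
    qed
    have "eg u ?w \<in> stab u" "eg u ?w \<in> stab ?w" using eg[OF uw] er_w er_u by (auto simp: stab_def)
    then have ce: "c (eg u ?w) u = \<one>\<^bsub>K\<^esub>" "c (eg u ?w) ?w = \<one>\<^bsub>K\<^esub>"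
      using c_kill[of ?w u] c_kill[of u ?w] uw out' inner_sym by (auto simp: adj_def)
    have "\<kappa>' u ?w = lab u ?w" using ce er_w er_u uw lab_closed by (simp add: \<kappa>'_def \<kappa>_def)
    also have "\<dots> = lab u ?v" using lab_act[OF uw k(1)] k by simp
    finally have "\<pi> ?w = lab u ?v"
      using \<pi>_adj[of u ?w] \<pi>_X[OF u] uw lab_closed by (simp add: adj_def)
    moreover have "c g x = \<one>\<^bsub>K\<^esub>"
      using g f_one[OF x] rep_X[OF x] \<gamma>_X[OF x] by (simp add: c_def \<sigma>_def g_def)
    ultimately have "\<phi> g = lab u ?v"
      using key[OF g(1) V(2)] g \<pi>_X[OF x] \<phi>_closed[OF g(1)] by simp
    moreover have "inv ?k \<in> stab u" using k V act_inv_eq by (auto simp: stab_def)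
    ultimately show "\<exists>h\<in>stab u. \<exists>s\<in>stab x. \<phi> (h \<otimes> t \<otimes> s) = lab u ?v"
      using g_eq s by blast
  qed
qed

end

section \<open>The dichotomy for tubular actions\<close>

text \<open>
  All vertex stabilisers are embedded in one lattice \<open>\<int>\<^sup>2\<close> by \<open>\<tau>\<close>, and an edge stabiliser is the
  preimage of the line spanned by the primitive vector \<open>y\<close>. The last assumption and the congruence
  \<open>L g \<equiv> 1\<close> are what passing to a finite index subgroup achieves.
\<close>

locale lattice_tree = tree_action S VT act E
  for S :: "('a, 'm) monoid_scheme" (structure) and VT :: "'x set" and act E +
  fixes \<tau> :: "'a \<Rightarrow> vec" and y :: "'x \<Rightarrow> 'x \<Rightarrow> vec" and L :: "'a \<Rightarrow> vec \<Rightarrow> vec" and m :: int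
  assumes \<tau>_mult: "\<lbrakk>v \<in> VT; s \<in> stab v; t \<in> stab v\<rbrakk> \<Longrightarrow> \<tau> (s \<otimes> t) = \<tau> s + \<tau> t"
    and \<tau>_inj: "\<lbrakk>v \<in> VT; s \<in> stab v; \<tau> s = 0\<rbrakk> \<Longrightarrow> s = \<one>"
    and \<tau>_conj: "\<lbrakk>g \<in> carrier S; v \<in> VT; s \<in> stab v\<rbrakk> \<Longrightarrow> \<tau> (g \<otimes> s \<otimes> inv g) = L g (\<tau> s)"
    and y_primitive: "adj u v \<Longrightarrow> primitive (y u v)"
    and y_sym: "adj u v \<Longrightarrow> y v u = y u v"
    and y_stab: "\<lbrakk>adj u v; s \<in> stab u\<rbrakk> \<Longrightarrow> s \<in> stab v \<longleftrightarrow> det (y u v) (\<tau> s) = 0"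
    and L_scl: "g \<in> carrier S \<Longrightarrow> L g (scl k z) = scl k (L g z)"
    and L_primitive: "\<lbrakk>g \<in> carrier S; primitive z\<rbrakk> \<Longrightarrow> primitive (L g z)"
    and L_mod: "g \<in> carrier S \<Longrightarrow> mod_eq m (L g z) z"
    and m_ge: "m \<ge> 3"
    and y_mod: "\<lbrakk>adj x u; adj x v; mod_eq m (y x u) (y x v) \<or> mod_eq m (y x u) (- y x v)\<rbrakk>
      \<Longrightarrow> det (y x u) (y x v) = 0"
begin

lemma \<tau>_one: "\<tau> \<one> = 0"
proof -
  obtain v where v: "v \<in> VT" using VT_nonempty by blast
  show ?thesis using \<tau>_mult[OF v stab_one[OF v] stab_one[OF v]] by simp
qed

lemma \<tau>_eq:
  assumes "v \<in> VT" "s \<in> stab v" "t \<in> stab v" "\<tau> s = \<tau> t"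
  shows "s = t"
proof -
  have c: "s \<in> carrier S" "t \<in> carrier S" using assms stab_carrier by auto
  have i: "inv t \<in> stab v" using stab_inv assms by auto
  have "\<tau> (s \<otimes> inv t) = \<tau> (t \<otimes> inv t)"
    using \<tau>_mult[OF assms(1,2) i] \<tau>_mult[OF assms(1,3) i] assms by simp
  then have "\<tau> (s \<otimes> inv t) = 0" using c \<tau>_one by simp
  then have "s \<otimes> inv t = \<one>" using \<tau>_inj[OF assms(1) stab_mult[OF assms(1,2) i]] by simp
  then show ?thesis using c by (metis S.inv_closed S.inv_equality S.inv_inv)
qed

lemma stab_comm:
  assumes "v \<in> VT" "s \<in> stab v" "t \<in> stab v"
  shows "s \<otimes> t = t \<otimes> s"
  using assms by (intro \<tau>_eq[of v]) (auto simp: stab_mult \<tau>_mult add.commute)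

lemma stab_comm_conj:
  assumes "v \<in> VT" "s \<in> stab v" "t \<in> stab v"
  shows "inv t \<otimes> s \<otimes> t = s"
  using stab_comm[OF assms] assms stab_carrier by (simp add: S.m_assoc S.mult_inv_cancel)

section \<open>Surjections built from functionals and from loops of the quotient\<close>

lemma transversalD:
  assumes "transversal X"
  shows "X \<subseteq> VT" "conn X" "\<And>x y g. x \<in> X \<Longrightarrow> y \<in> X \<Longrightarrow> g \<in> carrier S \<Longrightarrow> act g x = y \<Longrightarrow> x = y"
    "\<And>v. v \<in> VT \<Longrightarrow> \<exists>x\<in>X. \<exists>g\<in>carrier S. act g x = v"
  using assms unfolding transversal_def partial_transversal_def by blast+

text \<open>A translate of the edge starts in \<open>X\<close>; its other end then lies in some
  translate of \<open>X\<close> by \<open>t\<close>, which plays the part of the stable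
  letter.\<close>

lemma outer_edge_rep:
  assumes X: "transversal X" and uv: "(u, v) \<in> E" "\<not> inner X u v"
  obtains g w x t where "g \<in> carrier S" "w \<in> X" "x \<in> X" "t \<in> carrier S" "act g w = u" "act g (act t x) = v"
    "(w, act t x) \<in> E" "\<not> inner X w (act t x)"
proof -
  note X' = transversalD[OF X]
  have V: "u \<in> VT" "v \<in> VT" using uv E_verts by blast+
  obtain w g where w: "w \<in> X" "g \<in> carrier S" "act g w = u" using X'(4)[OF V(1)] by blast
  have iv: "act (inv g) v \<in> VT" using V w act_closed by auto
  obtain x t where x: "x \<in> X" "t \<in> carrier S" "act t x = act (inv g) v" using X'(4)[OF iv] by blast
  have gv: "act g (act t x) = v" using x w V by simp
  have "act (inv g) u = w" using w X'(1) act_inv_eq by blast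
  then have wE: "(w, act t x) \<in> E" using E_act[OF uv(1), of "inv g"] w x by simp
  moreover have "\<not> inner X w (act t x)"
    using inner_act[of g w "act t x" X] uv(2) w x gv iv X'(1) by auto
  ultimately show thesis using that w x gv by blast
qed

text \<open>On \<open>stab x\<close> the functional \<open>h x\<close> supplies the exponent of one
  free generator, selected by \<open>lb x\<close>. Along \<open>X\<close> the selected generator may
  change only where the functionals vanish. All outer edges are labelled by
  \<open>fgen True\<close>, which explains the alternative in the last hypothesis.\<close>

lemma surjects_to_F2_functionals:
  fixes h :: "'x \<Rightarrow> vec" and lb :: "'x \<Rightarrow> bool"
  assumes X: "transversal X"
    and compat: "\<And>x z s. \<lbrakk>x \<in> X; z \<in> X; adj x z; s \<in> stab x; s \<in> stab z\<rbrakk> \<Longrightarrow>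
      det (h x) (\<tau> s) = det (h z) (\<tau> s) \<and> (lb x = lb z \<or> det (h x) (\<tau> s) = 0)"
    and kill: "\<And>x z s. \<lbrakk>x \<in> X; adj x z; \<not> inner X x z; s \<in> stab x; s \<in> stab z\<rbrakk> \<Longrightarrow> det (h x) (\<tau> s) = 0"
    and F: "\<exists>x\<in>X. \<exists>s\<in>stab x. \<not> lb x \<and> det (h x) (\<tau> s) \<noteq> 0"
    and T: "(\<exists>x\<in>X. \<exists>s\<in>stab x. lb x \<and> det (h x) (\<tau> s) \<noteq> 0) \<or>
      (\<forall>x\<in>X. \<not> lb x) \<and> (\<exists>u v. (u, v) \<in> E \<and> \<not> inner X u v)"
  shows "surjects_to_F2 S"
proof -
  interpret F: group F2 by (rule group_F2)
  note X' = transversalD[OF X]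
  define V where "V i = {det (h x) (\<tau> s) | x s. x \<in> X \<and> s \<in> stab x \<and> lb x = i}" for i
  \<comment> \<open>Division by the greatest common divisor of all values belonging to the generator
    keeps \<open>f x\<close> additive and puts the generator itself into the image. If all these
    values are 0, so is the divisor, and division by 0 yields the exponent 0.\<close>
  define f where "f x s = fgen (lb x) [^]\<^bsub>F2\<^esub> (det (h x) (\<tau> s) div Gcd (V (lb x)))" for x s
  define lab where "lab u v = (if (u, v) \<in> E \<and> \<not> inner X u v then fgen True else \<one>\<^bsub>F2\<^esub>)" for u v
  have dvd: "Gcd (V (lb x)) dvd det (h x) (\<tau> s)" if "x \<in> X" "s \<in> stab x" for x s
    using that by (intro Gcd_dvd) (auto simp: V_def)
  obtain \<phi> where \<phi>: "\<phi> \<in> hom S F2" "\<And>x s. x \<in> X \<Longrightarrow> s \<in> stab x \<Longrightarrow> \<phi> s = f x s"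
    "\<And>u x t. u \<in> X \<Longrightarrow> x \<in> X \<Longrightarrow> t \<in> carrier S \<Longrightarrow> (u, act t x) \<in> E \<Longrightarrow> \<not> inner X u (act t x) \<Longrightarrow>
      \<exists>h\<in>stab u. \<exists>s\<in>stab x. \<phi> (h \<otimes> t \<otimes> s) = lab u (act t x)"
  proof (rule hom_from_tree_action[OF F.is_group X, of f lab])
    fix x s t assume x: "x \<in> X" and s: "s \<in> stab x" and t: "t \<in> stab x"
    have "\<tau> (s \<otimes> t) = \<tau> s + \<tau> t" using \<tau>_mult x s t X'(1) by blast
    then show "f x (s \<otimes> t) = f x s \<otimes>\<^bsub>F2\<^esub> f x t"
      using dvd[OF x s] dvd[OF x t] by (simp add: f_def det_add div_plus_div_distrib_dvd_left F.int_pow_mult)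
  next
    fix x z s assume "x \<in> X" "z \<in> X" "adj x z" "s \<in> stab x" "s \<in> stab z"
    then show "f x s = f z s" using compat[of x z s] by (auto simp: f_def)
  next
    fix u v g assume uv: "(u, v) \<in> E" and g: "g \<in> carrier S"
    then show "lab (act g u) (act g v) = lab u v"
      using inner_act[of g u v X] E_act[OF uv g] E_verts[OF uv] by (simp add: lab_def)
  qed (auto simp: f_def lab_def kill)
  interpret h: group_hom S F2 \<phi>
    using \<phi>(1) F.is_group by (simp add: group_hom_def group_hom_axioms_def)
  have J: "subgroup (\<phi> ` carrier S) F2" by (rule h.img_is_subgroup)
  have nz: "fgen i \<in> \<phi> ` carrier S" if i: "\<exists>x\<in>X. \<exists>s\<in>stab x. lb x = i \<and> det (h x) (\<tau> s) \<noteq> 0" for i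
  proof -
    obtain x s where x: "x \<in> X" "s \<in> stab x" "lb x = i" "det (h x) (\<tau> s) \<noteq> 0" using i by blast
    show ?thesis
    proof (rule Gcd_exponents[OF F.is_group fgen_closed J _ x(4)])
      show "det (h x) (\<tau> s) \<in> V i" using x by (auto simp: V_def)
      fix v assume "v \<in> V i"
      then obtain x s where "x \<in> X" "s \<in> stab x" "lb x = i" "v = det (h x) (\<tau> s)" by (auto simp: V_def)
      then have "fgen i [^]\<^bsub>F2\<^esub> (v div Gcd (V i)) = \<phi> s" using \<phi>(2) by (simp add: f_def)
      then show "fgen i [^]\<^bsub>F2\<^esub> (v div Gcd (V i)) \<in> \<phi> ` carrier S"
        using stab_carrier[OF \<open>s \<in> stab x\<close>] by simp
    qed
  qed
  have "fgen True \<in> \<phi> ` carrier S"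
  proof (cases "\<exists>x\<in>X. \<exists>s\<in>stab x. lb x \<and> det (h x) (\<tau> s) \<noteq> 0")
    case False
    then obtain u v where uv: "(u, v) \<in> E" "\<not> inner X u v" using T by blast
    obtain g w x t where r: "g \<in> carrier S" "w \<in> X" "x \<in> X" "t \<in> carrier S" "act g w = u" "act g (act t x) = v"
      "(w, act t x) \<in> E" "\<not> inner X w (act t x)" by (rule outer_edge_rep[OF X uv])
    obtain a s where "a \<in> stab w" "s \<in> stab x" "\<phi> (a \<otimes> t \<otimes> s) = lab w (act t x)"
      using \<phi>(3)[OF r(2,3,4,7,8)] by blast
    moreover have "a \<otimes> t \<otimes> s \<in> carrier S" using calculation r stab_carrier by blast
    ultimately show ?thesis using r by (metis imageI lab_def)
  qed (use nz[of True] in auto)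
  then have "fgen i \<in> \<phi> ` carrier S" for i using nz[of False] F by (cases i) auto
  then show ?thesis using surjects_to_F2I[OF S.is_group \<phi>(1)] by blast
qed

text \<open>With all vertex stabilisers mapped to the identity, the labels of outer edges can be
  chosen freely on each orbit, so two different orbits reach the two generators.\<close>

lemma surjects_to_F2_two_loops:
  assumes X: "transversal X"
    and e: "(u, v) \<in> E" "\<not> inner X u v" "(u', v') \<in> E" "\<not> inner X u' v'"
    and ne: "\<And>g. g \<in> carrier S \<Longrightarrow> (act g u, act g v) \<noteq> (u', v')"
  shows "surjects_to_F2 S"
proof -
  interpret F: group F2 by (rule group_F2)
  note X' = transversalD[OF X]
  define orb where "orb a b = {(act g a, act g b) | g. g \<in> carrier S}" for a b
  have orb: "(act g a, act g b) \<in> orb u v \<longleftrightarrow> (a, b) \<in> orb u v"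
    if "g \<in> carrier S" "a \<in> VT" "b \<in> VT" "u \<in> VT" "v \<in> VT" for g a b u v
  proof
    assume "(act g a, act g b) \<in> orb u v"
    then obtain k where k: "k \<in> carrier S" "act g a = act k u" "act g b = act k v" by (auto simp: orb_def)
    have "act (inv g \<otimes> k) u = a" "act (inv g \<otimes> k) v = b" using k(2,3)[symmetric] k(1) that by (simp_all add: act_mult)
    moreover have "inv g \<otimes> k \<in> carrier S" using that k by simp
    ultimately show "(a, b) \<in> orb u v" unfolding orb_def by blast
  next
    assume "(a, b) \<in> orb u v"
    then obtain k where k: "k \<in> carrier S" "a = act k u" "b = act k v" by (auto simp: orb_def)
    have "act g a = act (g \<otimes> k) u" "act g b = act (g \<otimes> k) v" using k that by (simp_all add: act_mult)
    moreover have "g \<otimes> k \<in> carrier S" using that k by simp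
    ultimately show "(act g a, act g b) \<in> orb u v" unfolding orb_def by blast
  qed
  have V: "u \<in> VT" "v \<in> VT" "u' \<in> VT" "v' \<in> VT" using e E_verts by blast+
  define lab where "lab a b = (if inner X a b then \<one>\<^bsub>F2\<^esub> else if (a, b) \<in> orb u v then fgen True
    else if (a, b) \<in> orb u' v' then fgen False else \<one>\<^bsub>F2\<^esub>)" for a b
  obtain \<phi> where \<phi>: "\<phi> \<in> hom S F2" "\<And>x s. x \<in> X \<Longrightarrow> s \<in> stab x \<Longrightarrow> \<phi> s = \<one>\<^bsub>F2\<^esub>"
    "\<And>u x t. u \<in> X \<Longrightarrow> x \<in> X \<Longrightarrow> t \<in> carrier S \<Longrightarrow> (u, act t x) \<in> E \<Longrightarrow> \<not> inner X u (act t x) \<Longrightarrow>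
      \<exists>h\<in>stab u. \<exists>s\<in>stab x. \<phi> (h \<otimes> t \<otimes> s) = lab u (act t x)"
  proof (rule hom_from_tree_action[OF F.is_group X, of "\<lambda>_ _. \<one>\<^bsub>F2\<^esub>" lab])
    fix a b g assume ab: "(a, b) \<in> E" and g: "g \<in> carrier S"
    then show "lab (act g a) (act g b) = lab a b"
      using inner_act[of g a b X] E_verts[OF ab] orb V by (simp add: lab_def)
  qed (auto simp: lab_def)
  have img: "lab a b \<in> \<phi> ` carrier S" if ab: "(a, b) \<in> E" "\<not> inner X a b" for a b
  proof -
    obtain g w x t where r: "g \<in> carrier S" "w \<in> X" "x \<in> X" "t \<in> carrier S" "act g w = a" "act g (act t x) = b"
      "(w, act t x) \<in> E" "\<not> inner X w (act t x)" by (rule outer_edge_rep[OF X ab])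
    obtain k s where "k \<in> stab w" "s \<in> stab x" and eq: "\<phi> (k \<otimes> t \<otimes> s) = lab w (act t x)"
      using \<phi>(3)[OF r(2,3,4,7,8)] by blast
    then have "k \<otimes> t \<otimes> s \<in> carrier S" using r stab_carrier by blast
    moreover have "lab w (act t x) = lab a b"
      using inner_act[OF r(1), of w "act t x" X] orb[OF r(1), of w "act t x"] r V E_verts[OF r(7)] by (simp add: lab_def)
    ultimately show ?thesis using eq by (metis imageI)
  qed
  have self: "(a, b) \<in> orb a b" if "a \<in> VT" "b \<in> VT" for a b
  proof -
    have "(a, b) = (act \<one> a, act \<one> b)" using act_one that by simp
    then show ?thesis unfolding orb_def using S.one_closed by blast
  qed
  have "(u, v) \<in> orb u v" "(u', v') \<in> orb u' v'" using self V by blast+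
  moreover have "(u', v') \<notin> orb u v" using ne unfolding orb_def by blast
  ultimately have "lab u v = fgen True" "lab u' v' = fgen False" using e by (simp_all add: lab_def)
  then have "fgen i \<in> \<phi> ` carrier S" for i using img[OF e(1,2)] img[OF e(3,4)] by (cases i) simp_all
  then show ?thesis using surjects_to_F2I[OF S.is_group \<phi>(1)] by blast
qed

text \<open>The translates of \<open>X\<close> by \<open>M\<close> are closed under adjacency and
  therefore cover the tree. An element \<open>s\<close> then moves \<open>x0\<close> as some member
  of \<open>M\<close> does, and differs from it by an element of \<open>stab x0\<close>.\<close>

lemma generated_by_transversal:
  assumes X: "transversal X" and M: "subgroup M S" and st: "\<And>x. x \<in> X \<Longrightarrow> stab x \<subseteq> M"
    and out: "\<And>x v. \<lbrakk>x \<in> X; adj x v; \<not> inner X x v\<rbrakk> \<Longrightarrow> \<exists>g\<in>M. \<exists>z\<in>X. v = act g z"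
  shows "M = carrier S"
proof
  note X' = transversalD[OF X]
  have MS: "M \<subseteq> carrier S" using M by (rule subgroup.subset)
  then show "M \<subseteq> carrier S" .
  obtain v where v: "v \<in> VT" using VT_nonempty by blast
  obtain x0 where x0: "x0 \<in> X" using X'(4)[OF v] by blast
  let ?A = "{act g x | g x. g \<in> M \<and> x \<in> X}"
  have A: "?A = VT"
  proof (rule adj_closed_eq)
    show "?A \<subseteq> VT" using MS X'(1) act_closed by blast
    show "?A \<noteq> {}" using x0 subgroup.one_closed[OF M] by blast
    fix u v assume "u \<in> ?A" and uv: "adj u v"
    then obtain g x where g: "g \<in> M" "x \<in> X" "u = act g x" by blast
    have gc: "g \<in> carrier S" using g MS by blast
    have V: "u \<in> VT" "v \<in> VT" "x \<in> VT" using adj_verts[OF uv] g X'(1) by blast+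
    let ?v = "act (inv g) v"
    have v': "?v \<in> VT" "act g ?v = v" using gc V act_closed by auto
    have xv: "adj x ?v" using adj_act_iff[OF gc V(3) v'(1)] uv g v' by simp
    have "\<exists>k\<in>M. \<exists>z\<in>X. ?v = act k z"
    proof (cases "inner X x ?v")
      case True
      then obtain k where k: "k \<in> carrier S" "act k x \<in> X" "act k ?v \<in> X" by (auto simp: inner_def)
      then have "act k x = x" using X'(3)[OF g(2) k(2) k(1)] by simp
      then have "k \<in> M" using st g k by (auto simp: stab_def)
      then have "inv k \<in> M" using subgroup.m_inv_closed[OF M] by blast
      moreover have "?v = act (inv k) (act k ?v)" using k v' by simp
      ultimately show ?thesis using k by blast
    next
      case False
      then show ?thesis using out[OF g(2) xv] by blast
    qed
    then obtain k z where k: "k \<in> M" "z \<in> X" "?v = act k z" by blast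
    then have "v = act (g \<otimes> k) z" using v' MS gc X'(1) by (metis act_mult subsetD)
    then show "v \<in> ?A" using k g subgroup.m_closed[OF M] by blast
  qed
  show "carrier S \<subseteq> M"
  proof
    fix s assume s: "s \<in> carrier S"
    have x0V: "x0 \<in> VT" using x0 X'(1) by blast
    have "act s x0 \<in> ?A" unfolding A using act_closed s x0V by blast
    then obtain g x where g: "g \<in> M" "x \<in> X" "act s x0 = act g x" by blast
    have gc: "g \<in> carrier S" using g MS by blast
    have xV: "x \<in> VT" using g X'(1) by blast
    have "act (inv g \<otimes> s) x0 = x" using s gc x0V xV g by (simp add: act_mult)
    moreover have "x0 = x" using X'(3)[OF x0 g(2), of "inv g \<otimes> s"] calculation gc s by simp
    ultimately have "inv g \<otimes> s \<in> M" using st[OF x0] gc s by (auto simp: stab_def)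
    then have "g \<otimes> (inv g \<otimes> s) \<in> M" using subgroup.m_closed[OF M g(1)] by blast
    then show "s \<in> M" using gc s by (simp add: S.mult_inv_cancel)
  qed
qed

section \<open>Criteria for being free abelian\<close>

lemma small_free_abelian_stab:
  assumes "v \<in> VT" "stab v = carrier S"
  shows "small_free_abelian S"
proof (rule small_free_abelianI[OF S.is_group, of "\<lambda>s. fst (\<tau> s)" "\<lambda>s. snd (\<tau> s)"])
  show "(\<lambda>s. fst (\<tau> s)) \<in> hom S integer_group"
    using \<tau>_mult[OF assms(1)] assms by (auto intro!: homI)
  fix s t assume "s \<in> carrier S" "t \<in> carrier S"
  then show "s \<otimes> t = t \<otimes> s" "snd (\<tau> (s \<otimes> t)) = snd (\<tau> s) + snd (\<tau> t)"
    using stab_comm[OF assms(1)] \<tau>_mult[OF assms(1)] assms by auto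
  assume "fst (\<tau> s) = 0" "snd (\<tau> s) = 0"
  then show "s = \<one>" using \<tau>_inj[OF assms(1)] assms \<open>s \<in> carrier S\<close> by (auto simp: prod_eq_iff)
qed

lemma centralizer_subgroup:
  assumes "A \<subseteq> carrier S"
  shows "subgroup {z \<in> carrier S. \<forall>a\<in>A. z \<otimes> a = a \<otimes> z} S"
proof (rule S.subgroupI)
  fix z assume z: "z \<in> {z \<in> carrier S. \<forall>a\<in>A. z \<otimes> a = a \<otimes> z}"
  have "inv z \<otimes> a = a \<otimes> inv z" if "a \<in> A" for a
  proof -
    have "a \<in> carrier S" "z \<in> carrier S" "z \<otimes> a = a \<otimes> z" using z that assms by auto
    then have c: "a \<in> carrier S" "z \<in> carrier S" "z \<otimes> a = a \<otimes> z" by auto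
    have "inv z \<otimes> a = inv z \<otimes> (a \<otimes> z) \<otimes> inv z" using c by (simp add: S.m_assoc)
    also have "\<dots> = inv z \<otimes> (z \<otimes> a) \<otimes> inv z" using c by simp
    also have "\<dots> = a \<otimes> inv z" using c(1,2) by (simp add: S.mult_inv_cancel)
    finally show ?thesis .
  qed
  then show "inv z \<in> {z \<in> carrier S. \<forall>a\<in>A. z \<otimes> a = a \<otimes> z}" using z by auto
next
  fix x z assume xz: "x \<in> {z \<in> carrier S. \<forall>a\<in>A. z \<otimes> a = a \<otimes> z}" "z \<in> {z \<in> carrier S. \<forall>a\<in>A. z \<otimes> a = a \<otimes> z}"
  have "x \<otimes> z \<otimes> a = a \<otimes> (x \<otimes> z)" if "a \<in> A" for a
  proof -
    have "a \<in> carrier S" "z \<in> carrier S" "x \<in> carrier S" "z \<otimes> a = a \<otimes> z" "x \<otimes> a = a \<otimes> x"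
      using xz that assms by auto
    then have c: "a \<in> carrier S" "z \<in> carrier S" "x \<in> carrier S" and e: "z \<otimes> a = a \<otimes> z" "x \<otimes> a = a \<otimes> x" by auto
    have "x \<otimes> z \<otimes> a = x \<otimes> (a \<otimes> z)" using c e by (simp add: S.m_assoc)
    also have "\<dots> = (a \<otimes> x) \<otimes> z" using c e by (simp flip: S.m_assoc)
    finally show ?thesis using c by (simp add: S.m_assoc)
  qed
  then show "x \<otimes> z \<in> {z \<in> carrier S. \<forall>a\<in>A. z \<otimes> a = a \<otimes> z}" using xz by auto
next
  have "\<one> \<in> {z \<in> carrier S. \<forall>a\<in>A. z \<otimes> a = a \<otimes> z}" using assms by auto
  then show "{z \<in> carrier S. \<forall>a\<in>A. z \<otimes> a = a \<otimes> z} \<noteq> {}" by blast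
qed auto

text \<open>The products of elements of \<open>stab w\<close> with powers of \<open>t\<close> form a
  subgroup, because \<open>t\<close> centralises \<open>stab w\<close>, and it contains enough to be
  everything. Counting \<open>t\<close> is a homomorphism to the integers with kernel
  \<open>stab w\<close>, and \<open>det c\<close> embeds this kernel into the integers.\<close>

lemma small_free_abelian_loop:
  assumes X: "transversal X" and w: "w \<in> X" "z \<in> X" and t: "t \<in> carrier S"
    and e: "(w, act t z) \<in> E" "\<not> inner X w (act t z)"
    and one: "\<And>u v. (u, v) \<in> E \<Longrightarrow> \<not> inner X u v \<Longrightarrow> \<exists>g\<in>carrier S. act g w = u \<and> act g (act t z) = v"
    and st: "\<And>x. x \<in> X \<Longrightarrow> stab x \<subseteq> stab w"
    and comm: "\<And>s. s \<in> stab w \<Longrightarrow> t \<otimes> s = s \<otimes> t"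
    and c: "\<And>s. s \<in> stab w \<Longrightarrow> det c (\<tau> s) = 0 \<Longrightarrow> s = \<one>"
  shows "small_free_abelian S"
proof -
  note X' = transversalD[OF X]
  have wV: "w \<in> VT" "z \<in> VT" using w X'(1) by auto
  let ?N = "stab w"
  have Nc: "?N \<subseteq> carrier S" using stab_carrier by blast
  have powc: "t [^] (k :: int) \<otimes> s = s \<otimes> t [^] k" if "s \<in> ?N" for k s
  proof -
    have sub: "subgroup {z \<in> carrier S. \<forall>a\<in>?N. z \<otimes> a = a \<otimes> z} S" by (rule centralizer_subgroup[OF Nc])
    have "t \<in> {z \<in> carrier S. \<forall>a\<in>?N. z \<otimes> a = a \<otimes> z}" using t comm by blast
    then have "t [^] k \<in> {z \<in> carrier S. \<forall>a\<in>?N. z \<otimes> a = a \<otimes> z}" using S.subgroup_int_pow_closed[OF sub] by blast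
    then show ?thesis using that by blast
  qed
  define M where "M = {n \<otimes> t [^] k | n k. n \<in> ?N \<and> (k :: int) \<in> UNIV}"
  have prod: "(n \<otimes> t [^] k) \<otimes> (n' \<otimes> t [^] k') = (n \<otimes> n') \<otimes> t [^] (k + k')"
    if "n \<in> ?N" "n' \<in> ?N" for n n' and k k' :: int
  proof -
    have nc: "n \<in> carrier S" "n' \<in> carrier S" using that Nc by auto
    have "(n \<otimes> t [^] k) \<otimes> (n' \<otimes> t [^] k') = n \<otimes> (t [^] k \<otimes> n') \<otimes> t [^] k'"
      using nc t by (simp add: S.m_assoc)
    then show ?thesis using nc t powc[OF that(2)] by (simp add: S.m_assoc S.int_pow_mult)
  qed
  have MI: "n \<otimes> t [^] k \<in> M" if "n \<in> ?N" for n and k :: int using that unfolding M_def by blast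
  have N_M: "n \<in> M" if "n \<in> ?N" for n using MI[OF that, of 0] that Nc by auto
  have M: "subgroup M S"
  proof (rule S.subgroupI)
    show "M \<subseteq> carrier S" using Nc t by (auto simp: M_def)
    show "M \<noteq> {}" using N_M stab_one wV by blast
    fix a b assume "a \<in> M" "b \<in> M"
    then obtain n k n' k' where "n \<in> ?N" "n' \<in> ?N" "a = n \<otimes> t [^] (k::int)" "b = n' \<otimes> t [^] (k'::int)" by (auto simp: M_def)
    then show "a \<otimes> b \<in> M" using prod MI stab_mult wV by simp
  next
    fix a assume "a \<in> M"
    then obtain n k where n: "n \<in> ?N" "a = n \<otimes> t [^] (k::int)" by (auto simp: M_def)
    have i: "inv n \<in> ?N" using stab_inv n wV by blast
    have "inv a = t [^] (- k) \<otimes> inv n" using n Nc t by (simp add: S.inv_mult_group S.int_pow_neg subsetD)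
    also have "\<dots> = inv n \<otimes> t [^] (- k)" by (rule powc[OF i])
    finally show "inv a \<in> M" using MI[OF i] by simp
  qed
  have tM: "t \<in> M" "inv t \<in> M"
    using MI[OF stab_one[OF wV(1)], of 1] subgroup.m_inv_closed[OF M] t by auto
  have all: "M = carrier S"
  proof (rule generated_by_transversal[OF X M])
    show "stab x \<subseteq> M" if "x \<in> X" for x using st[OF that] N_M by blast
    fix x v assume x: "x \<in> X" and xv: "adj x v" "\<not> inner X x v"
    have xV: "x \<in> VT" "v \<in> VT" using adj_verts xv by auto
    consider "(x, v) \<in> E" | "(v, x) \<in> E" using xv by (auto simp: adj_def)
    then show "\<exists>g\<in>M. \<exists>z\<in>X. v = act g z"
    proof cases
      case 1
      then obtain g where g: "g \<in> carrier S" "act g w = x" "act g (act t z) = v" using one xv by blast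
      then have "g \<in> ?N" using X'(3)[OF w(1) x g(1,2)] by (simp add: stab_def)
      then have "g \<otimes> t \<in> M" using N_M tM subgroup.m_closed[OF M] by blast
      moreover have "v = act (g \<otimes> t) z" using g t wV by (simp add: act_mult)
      ultimately show ?thesis using w by blast
    next
      case 2
      then obtain g where g: "g \<in> carrier S" "act g w = v" "act g (act t z) = x" using one xv inner_sym by blast
      then have gt: "act (g \<otimes> t) z = x" using t wV by (simp add: act_mult)
      then have "x = z" using X'(3)[OF w(2) x, of "g \<otimes> t"] g t by simp
      then have "g \<otimes> t \<in> ?N" using gt g t st[OF x] by (auto simp: stab_def)
      then have "g \<otimes> t \<otimes> inv t \<in> M" using N_M tM subgroup.m_closed[OF M] by blast
      then have "g \<in> M" using g t by (simp add: S.m_assoc)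
      then show ?thesis using g w by blast
    qed
  qed
  \<comment> \<open>Stabilisers are sent to 0 and outer edges are labelled 1, so the homomorphism
    counts occurrences of \<open>t\<close>.\<close>
  obtain \<chi> where \<chi>: "\<chi> \<in> hom S integer_group" "\<And>x s. x \<in> X \<Longrightarrow> s \<in> stab x \<Longrightarrow> \<chi> s = 0"
    "\<And>u x t. u \<in> X \<Longrightarrow> x \<in> X \<Longrightarrow> t \<in> carrier S \<Longrightarrow> (u, act t x) \<in> E \<Longrightarrow> \<not> inner X u (act t x) \<Longrightarrow>
      \<exists>h\<in>stab u. \<exists>s\<in>stab x. \<chi> (h \<otimes> t \<otimes> s) = (if inner X u (act t x) then 0 else 1)"
  proof (rule hom_from_tree_action[OF group_integer_group X, of "\<lambda>_ _. 0" "\<lambda>u v. if inner X u v then 0 else 1"])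
    fix u v g assume "(u, v) \<in> E" "g \<in> carrier S"
    then show "(if inner X (act g u) (act g v) then 0 else 1) = (if inner X u v then 0 else 1 :: int)"
      using inner_act[of g u v X] E_verts by auto
  qed auto
  have \<chi>_mult: "\<chi> (a \<otimes> b) = \<chi> a + \<chi> b" if "a \<in> carrier S" "b \<in> carrier S" for a b
    using hom_mult[OF \<chi>(1) that] by simp
  obtain a s where as: "a \<in> stab w" "s \<in> stab z" "\<chi> (a \<otimes> t \<otimes> s) = 1" using \<chi>(3)[OF w t e] e by auto
  have "\<chi> a = 0" "\<chi> s = 0" using as \<chi>(2) w by blast+
  then have \<chi>_t: "\<chi> t = 1" using as \<chi>_mult stab_carrier t by simp
  have \<chi>_pow: "\<chi> (t [^] k) = k" for k :: int
  proof -
    have "group_hom S integer_group \<chi>"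
      by (intro group_hom.intro group_hom_axioms.intro S.is_group group_integer_group \<chi>(1))
    then have "\<chi> (t [^] k) = \<chi> t [^]\<^bsub>integer_group\<^esub> k" using t by (rule group_hom.hom_int_pow)
    then show ?thesis by (simp only: \<chi>_t group_int_pow_integer_group mult_1 mult_1_right)
  qed
  have ker: "g \<in> ?N" if "g \<in> carrier S" "\<chi> g = 0" for g
  proof -
    have "g \<in> M" using that all by simp
    then obtain n k where n: "n \<in> ?N" "g = n \<otimes> t [^] (k::int)" by (auto simp: M_def)
    have "n \<in> carrier S" "t [^] k \<in> carrier S" using n Nc t by auto
    then have "\<chi> g = k" using \<chi>_mult[of n "t [^] k"] \<chi>(2)[OF w(1) n(1)] \<chi>_pow[of k] n(2) by simp
    then have "k = 0" using that by simp
    then have "g = n" using n(2) \<open>n \<in> carrier S\<close> by simp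
    then show ?thesis using n by simp
  qed
  show ?thesis
  proof (rule small_free_abelianI[OF S.is_group _ \<chi>(1), of "\<lambda>s. det c (\<tau> s)"])
    fix a b assume "a \<in> carrier S" "b \<in> carrier S"
    then have "a \<in> M" "b \<in> M" using all by auto
    then obtain n k n' k' where n: "n \<in> ?N" "n' \<in> ?N" and ab: "a = n \<otimes> t [^] (k::int)" "b = n' \<otimes> t [^] (k'::int)"
      unfolding M_def by blast
    have "a \<otimes> b = (n \<otimes> n') \<otimes> t [^] (k + k')" "b \<otimes> a = (n' \<otimes> n) \<otimes> t [^] (k' + k)"
      unfolding ab by (rule prod[OF n] prod[OF n(2,1)])+
    then show "a \<otimes> b = b \<otimes> a" using stab_comm[OF wV(1) n] by (simp only: add.commute)
  next
    fix a b assume "a \<in> carrier S" "b \<in> carrier S" "\<chi> a = 0" "\<chi> b = 0"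
    then have "a \<in> ?N" "b \<in> ?N" using ker by blast+
    then show "det c (\<tau> (a \<otimes> b)) = det c (\<tau> a) + det c (\<tau> b)"
      using \<tau>_mult[OF wV(1)] by (simp only: det_add)
  next
    fix a assume "a \<in> carrier S" "\<chi> a = 0" "det c (\<tau> a) = 0"
    then show "a = \<one>" using c ker by blast
  qed
qed

section \<open>Actions with all edges inner; rank of a stabiliser as a lattice\<close>

definition rk :: "'x \<Rightarrow> nat" where
  "rk v = (if stab v \<subseteq> {\<one>} then 0 else if \<forall>s\<in>stab v. \<forall>t\<in>stab v. det (\<tau> s) (\<tau> t) = 0 then 1 else 2)"

lemma \<tau>_nonzero: "v \<in> VT \<Longrightarrow> s \<in> stab v \<Longrightarrow> s \<noteq> \<one> \<Longrightarrow> \<tau> s \<noteq> 0"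
  using \<tau>_inj by blast

lemma edge_scl:
  assumes "adj u v" "s \<in> stab u" "s \<in> stab v"
  obtains k where "\<tau> s = scl k (y u v)"
  using y_stab[OF assms(1,2)] assms(3) det_eq_0_iff[OF y_primitive[OF assms(1)]] by (auto simp: line_def)

text \<open>The edge from \<open>w\<close> to its parent separates \<open>w\<close> from
  \<open>r\<close>, so unrelated functionals and generators may be used on its two sides if both
  functionals vanish on its stabiliser: its own direction on the side of \<open>w\<close>, some
  \<open>c\<close> not vanishing on \<open>stab r\<close> on the other. Maximal rank of
  \<open>r\<close> guarantees \<open>c\<close>. If no such edge exists, the stabilisers shrink away
  from \<open>r\<close>, and \<open>r\<close> is fixed by everything.\<close>

lemma dichotomy_tree:
  assumes max: "\<And>v. v \<in> VT \<Longrightarrow> rk v \<le> rk r" and r: "r \<in> X" and X: "transversal X"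
    and inn: "\<And>u v. adj u v \<Longrightarrow> inner X u v"
  shows "surjects_to_F2 S \<or> small_free_abelian S"
proof -
  note X' = transversalD[OF X]
  have rV: "r \<in> VT" using r X'(1) by auto
  obtain p d where pd: "rooted r p d" using rooted_ex[OF rV] .
  note p = pd[unfolded rooted_def, THEN conjunct1, rule_format]
  have pX: "p x \<in> X" if "x \<in> X" "x \<noteq> r" for x using conn_parent_closed[OF X'(2,1) pd r that] .
  show ?thesis
  proof (cases "\<exists>w\<in>X. w \<noteq> r \<and> \<not> stab w \<subseteq> stab (p w)")
    case True
    then obtain w s where w: "w \<in> X" "w \<noteq> r" "s \<in> stab w" "s \<notin> stab (p w)" by blast
    have wV: "w \<in> VT" using w X'(1) by auto
    have pw: "adj w (p w)" "p w \<in> VT" using p[of w] wV w adj_sym by auto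
    let ?y = "y w (p w)"
    have s: "det ?y (\<tau> s) \<noteq> 0" using y_stab[OF pw(1) w(3)] w by simp
    have sne: "s \<noteq> \<one>" using s \<tau>_one by auto
    \<comment> \<open>If \<open>?y\<close> vanishes on \<open>stab r\<close>, this stabiliser has
      rank at most one. A nontrivial edge group together with \<open>s\<close> would make the rank
      of \<open>w\<close> two, against the choice of \<open>r\<close>. So the edge group is trivial,
      and any functional that does not vanish on \<open>stab r\<close> will do.\<close>
    have "\<exists>c. (\<forall>e\<in>stab w \<inter> stab (p w). det c (\<tau> e) = 0) \<and> (\<exists>s\<in>stab r. det c (\<tau> s) \<noteq> 0)"
    proof (cases "\<exists>s\<in>stab r. det ?y (\<tau> s) \<noteq> 0")
      case True
      then show ?thesis using y_stab[OF pw(1)] by (intro exI[of _ ?y]) auto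
    next
      case False
      show ?thesis
      proof (cases "stab w \<inter> stab (p w) \<subseteq> {\<one>}")
        case True
        have "rk w \<noteq> 0" using sne w by (auto simp: rk_def)
        then have "rk r \<noteq> 0" using max[OF wV] by simp
        then obtain a where a: "a \<in> stab r" "a \<noteq> \<one>" by (auto simp: rk_def split: if_splits)
        then obtain c where "det c (\<tau> a) \<noteq> 0" using nonzero_functional \<tau>_nonzero[OF rV] by blast
        then show ?thesis using True a \<tau>_one by (intro exI[of _ c]) auto
      next
        case nt: False
        then obtain e where e: "e \<in> stab w" "e \<in> stab (p w)" "e \<noteq> \<one>" by blast
        obtain k where k: "\<tau> e = scl k ?y" using edge_scl[OF pw(1) e(1,2)] .
        have "k \<noteq> 0" using k \<tau>_nonzero[OF wV e(1,3)] by (auto simp: scl_def zero_prod_def)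
        moreover have "det (\<tau> e) (\<tau> s) = k * det ?y (\<tau> s)" by (simp add: k det_def scl_def algebra_simps)
        ultimately have "det (\<tau> e) (\<tau> s) \<noteq> 0" using s by simp
        then have "rk w = 2" using e w by (auto simp: rk_def)
        moreover have "rk r \<le> 1" using False parallel_det[OF y_primitive[OF pw(1)]] by (auto simp: rk_def)
        ultimately show ?thesis using max[OF wV] by simp
      qed
    qed
    then obtain c where c: "\<And>e. e \<in> stab w \<Longrightarrow> e \<in> stab (p w) \<Longrightarrow> det c (\<tau> e) = 0" "\<exists>s\<in>stab r. det c (\<tau> s) \<noteq> 0"
      by blast
    obtain D where D: "w \<in> D" "r \<notin> D" "\<And>u v. adj u v \<Longrightarrow> u \<in> D \<Longrightarrow> v \<notin> D \<Longrightarrow> u = w \<and> v = p w"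
      using descendants[OF pd rV wV w(2)] by metis
    have "surjects_to_F2 S"
    proof (rule surjects_to_F2_functionals[OF X, of "\<lambda>x. if x \<in> D then ?y else c" "\<lambda>x. x \<in> D"])
      fix x z s assume a: "adj x z" "s \<in> stab x" "s \<in> stab z"
      show "det (if x \<in> D then ?y else c) (\<tau> s) = det (if z \<in> D then ?y else c) (\<tau> s) \<and>
        ((x \<in> D) = (z \<in> D) \<or> det (if x \<in> D then ?y else c) (\<tau> s) = 0)"
      proof (cases "x \<in> D \<longleftrightarrow> z \<in> D")
        case False
        then have "(x = w \<and> z = p w) \<or> (z = w \<and> x = p w)" using D(3) a(1) adj_sym by blast
        then have "s \<in> stab w" "s \<in> stab (p w)" using a by auto
        then have "det ?y (\<tau> s) = 0" "det c (\<tau> s) = 0" using y_stab[OF pw(1)] c by auto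
        then show ?thesis by simp
      qed simp
    next
      fix x z assume "adj x z" "\<not> inner X x z"
      then show "det (if x \<in> D then ?y else c) (\<tau> s) = 0" for s using inn by blast
    next
      show "\<exists>x\<in>X. \<exists>s\<in>stab x. x \<notin> D \<and> det (if x \<in> D then ?y else c) (\<tau> s) \<noteq> 0"
        using c(2) D(2) r by auto
      show "(\<exists>x\<in>X. \<exists>s\<in>stab x. x \<in> D \<and> det (if x \<in> D then ?y else c) (\<tau> s) \<noteq> 0) \<or>
        (\<forall>x\<in>X. x \<notin> D) \<and> (\<exists>u v. (u, v) \<in> E \<and> \<not> inner X u v)"
        using s w D(1) by auto
    qed
    then show ?thesis ..
  next
    case False
    have st: "stab x \<subseteq> stab r" if "x \<in> X" for x
      using that
    proof (induction "d x" arbitrary: x rule: less_induct)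
      case less
      show ?case
      proof (cases "x = r")
        case f: False
        then have "d (p x) < d x" using p[of x] less.prems X'(1) by auto
        then show ?thesis using less.hyps[of "p x"] pX[OF less.prems f] False less.prems f by blast
      qed simp
    qed
    have sub: "subgroup (stab r) S"
    proof (rule S.subgroupI)
      show "stab r \<subseteq> carrier S" using stab_carrier by blast
      show "stab r \<noteq> {}" using stab_one[OF rV] by blast
    qed (use rV stab_inv stab_mult in auto)
    have "stab r = carrier S"
      by (rule generated_by_transversal[OF X sub st]) (use inn in blast)+
    then show ?thesis using small_free_abelian_stab rV by blast
  qed
qed

section \<open>Actions with one orbit of outer edges\<close>

lemma outer_edge_cases:
  assumes X: "transversal X" and w: "w \<in> X" "x \<in> X" and t: "t \<in> carrier S"
    and one: "\<And>u v. (u, v) \<in> E \<Longrightarrow> \<not> inner X u v \<Longrightarrow> \<exists>g\<in>carrier S. act g w = u \<and> act g (act t x) = v"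
    and z: "z \<in> X" "adj z v" "\<not> inner X z v" and s: "s \<in> stab z" "s \<in> stab v"
  shows "(z = w \<and> s \<in> stab (act t x)) \<or> (z = x \<and> s \<in> stab (act (inv t) w))"
proof -
  note X' = transversalD[OF X]
  have V: "w \<in> VT" "x \<in> VT" "z \<in> VT" "v \<in> VT" "act t x \<in> VT" "act (inv t) w \<in> VT"
    using w z X'(1) t act_closed adj_verts[OF z(2)] by auto
  consider "(z, v) \<in> E" | "(v, z) \<in> E" using z by (auto simp: adj_def)
  then show ?thesis
  proof cases
    case 1
    then obtain g where g: "g \<in> carrier S" "act g w = z" "act g (act t x) = v" using one z by blast
    then have "w = z" using X'(3)[OF w(1) z(1)] by blast
    then have gs: "g \<in> stab z" using g by (simp add: stab_def)
    have "inv g \<otimes> s \<otimes> g \<in> stab (act t x)" using stab_conj'[OF V(5) g(1)] s(2) g(3) by simp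
    \<comment> \<open>\<open>g\<close> and \<open>s\<close> both fix \<open>z\<close>, and vertex
      stabilisers are abelian, so conjugation by \<open>g\<close> leaves \<open>s\<close>
      unchanged.\<close>
    then have "s \<in> stab (act t x)" using stab_comm_conj[OF V(3) s(1) gs] by simp
    then show ?thesis using \<open>w = z\<close> by blast
  next
    case 2
    then obtain g where g: "g \<in> carrier S" "act g w = v" "act g (act t x) = z" using one z inner_sym by blast
    then have gt: "act (g \<otimes> t) x = z" using t V by (simp add: act_mult)
    then have "x = z" using X'(3)[OF w(2) z(1), of "g \<otimes> t"] g t by simp
    then have gs: "g \<otimes> t \<in> stab z" using gt g t by (simp add: stab_def)
    have "act (g \<otimes> t) (act (inv t) w) = v" using g t V by (simp add: act_mult)
    then have "inv (g \<otimes> t) \<otimes> s \<otimes> (g \<otimes> t) \<in> stab (act (inv t) w)"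
      using stab_conj'[OF V(6), of "g \<otimes> t" s] s(2) g t by simp
    then have "s \<in> stab (act (inv t) w)" using stab_comm_conj[OF V(3) s(1) gs] by simp
    then show ?thesis using \<open>x = z\<close> by blast
  qed
qed

text \<open>A trivial outer edge group imposes no vanishing condition, so one functional used at all
  vertices gives the second generator as soon as some stabiliser is nontrivial. Otherwise the powers
  of the stable letter exhaust \<open>S\<close>.\<close>

lemma dichotomy_trivial_edge:
  assumes X: "transversal X" and uv: "(u, v) \<in> E" "\<not> inner X u v" and triv: "stab u \<inter> stab v = {\<one>}"
  shows "surjects_to_F2 S \<or> small_free_abelian S"
proof -
  note X' = transversalD[OF X]
  obtain g w x t where r: "g \<in> carrier S" "w \<in> X" "x \<in> X" "t \<in> carrier S" "act g w = u" "act g (act t x) = v"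
    "(w, act t x) \<in> E" "\<not> inner X w (act t x)" by (rule outer_edge_rep[OF X uv])
  have V: "w \<in> VT" "x \<in> VT" "act t x \<in> VT" "act (inv t) w \<in> VT" using r X'(1) act_closed by auto
  have triv1: "s = \<one>" if "s \<in> stab w" "s \<in> stab (act t x)" for s
  proof -
    have "g \<otimes> s \<otimes> inv g \<in> stab u \<inter> stab v"
      using stab_conj[OF V(1) r(1) that(1)] stab_conj[OF V(3) r(1) that(2)] r by simp
    then have "g \<otimes> s \<otimes> inv g = \<one>" using triv by simp
    then have "inv g \<otimes> (g \<otimes> s \<otimes> inv g) \<otimes> g = \<one>" using r by simp
    then show ?thesis using r stab_carrier[OF that(1)] by (simp add: S.m_assoc S.mult_inv_cancel)
  qed
  have triv2: "s = \<one>" if "s \<in> stab x" "s \<in> stab (act (inv t) w)" for s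
  proof -
    have sc: "s \<in> carrier S" using that stab_carrier by auto
    have "t \<otimes> s \<otimes> inv t \<in> stab (act t x)" "t \<otimes> s \<otimes> inv t \<in> stab (act t (act (inv t) w))"
      using stab_conj[OF V(2) r(4) that(1)] stab_conj[OF V(4) r(4) that(2)] by simp_all
    then have "t \<otimes> s \<otimes> inv t = \<one>" using triv1 r V by simp
    then have "inv t \<otimes> (t \<otimes> s \<otimes> inv t) \<otimes> t = \<one>" using r by simp
    then show ?thesis using r sc by (simp add: S.m_assoc S.mult_inv_cancel)
  qed
  show ?thesis
  proof (cases "\<forall>a b. (a, b) \<in> E \<longrightarrow> \<not> inner X a b \<longrightarrow> (\<exists>g\<in>carrier S. act g w = a \<and> act g (act t x) = b)")
    case False
    then show ?thesis using surjects_to_F2_two_loops[OF X r(7,8)] by blast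
  next
    case True
    then have one: "\<And>a b. (a, b) \<in> E \<Longrightarrow> \<not> inner X a b \<Longrightarrow> \<exists>g\<in>carrier S. act g w = a \<and> act g (act t x) = b"
      by blast
    show ?thesis
    proof (cases "\<exists>z\<in>X. \<exists>s\<in>stab z. s \<noteq> \<one>")
      case True
      then obtain z s where z: "z \<in> X" "s \<in> stab z" "s \<noteq> \<one>" by blast
      then obtain c where c: "det c (\<tau> s) \<noteq> 0" using nonzero_functional \<tau>_nonzero X'(1) by blast
      have "surjects_to_F2 S"
      proof (rule surjects_to_F2_functionals[OF X, of "\<lambda>_. c" "\<lambda>_. False"])
        fix z v s assume "z \<in> X" "adj z v" "\<not> inner X z v" "s \<in> stab z" "s \<in> stab v"
        then have "s = \<one>"
          using outer_edge_cases[OF X r(2,3,4) one, of z v s] triv1 triv2 by blast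
        then show "det c (\<tau> s) = 0" using \<tau>_one by simp
      qed (use z c uv in auto)
      then show ?thesis ..
    next
      case False
      have "small_free_abelian S"
      proof (rule small_free_abelian_loop[OF X r(2,3,4,7,8) one])
        show "stab z \<subseteq> stab w" if "z \<in> X" for z
        proof
          fix s assume "s \<in> stab z"
          then have "s = \<one>" using False that by blast
          then show "s \<in> stab w" using stab_one[OF V(1)] by simp
        qed
        show "t \<otimes> s = s \<otimes> t" if "s \<in> stab w" for s
        proof -
          have "s = \<one>" using False that r(2) by blast
          then show ?thesis using r(4) by simp
        qed
        show "s = \<one>" if "s \<in> stab w" for s using False that r by blast
      qed
      then show ?thesis ..
    qed
  qed
qed

text \<open>In the quotient graph the outer edge closes a cycle with the path from \<open>w\<close>
  to \<open>z\<close>, and any edge of this cycle can be left out of the spanning tree instead. Here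
  \<open>X\<close> is cut between \<open>a\<close> and \<open>p a\<close>, and the far piece, moved
  by \<open>t\<close>, is attached to \<open>w\<close> along the former outer edge.\<close>

lemma switch_transversal:
  assumes X: "transversal X" and w: "w \<in> X" "z \<in> X" and t: "t \<in> carrier S"
    and wz: "adj w (act t z)" "\<not> inner X w (act t z)"
    and pd: "rooted w p d" and a: "a \<in> X" "a \<noteq> w"
    and D: "a \<in> D" "w \<notin> D" "p a \<notin> D" "z \<in> D" "\<And>v. v \<in> VT \<Longrightarrow> v \<noteq> w \<Longrightarrow> v \<noteq> a \<Longrightarrow> v \<in> D \<longleftrightarrow> p v \<in> D"
  shows "\<exists>X'. transversal X' \<and> \<not> inner X' a (p a)"
proof -
  note X' = transversalD[OF X]
  note p = pd[unfolded rooted_def, THEN conjunct1, rule_format]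
  have wV: "w \<in> VT" "z \<in> VT" "a \<in> VT" using w a X'(1) by auto
  have pX: "p x \<in> X" if "x \<in> X" "x \<noteq> w" for x using conn_parent_closed[OF X'(2,1) pd w(1) that] .
  have p_adj: "adj (p x) x" "d (p x) < d x" if "x \<in> X" "x \<noteq> w" for x using p[of x] that X'(1) by auto
  define X2 where "X2 = act t ` (X \<inter> D)"
  define Y where "Y = (X - D) \<union> X2"
  let ?R = "\<lambda>X. {(u, v). u \<in> X \<and> v \<in> X \<and> adj u v}"
  have symR: "(u, v) \<in> (?R A)\<^sup>*" if "(v, u) \<in> (?R A)\<^sup>*" for u v A
  proof -
    have "Relation.sym (?R A)" using adj_sym by (auto intro: symI)
    then show ?thesis using that sym_rtrancl symD by metis
  qed
  have link1: "x \<in> X - D \<Longrightarrow> (x, w) \<in> (?R Y)\<^sup>*" for x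
  proof (induction "d x" arbitrary: x rule: less_induct)
    case less
    show ?case
    proof (cases "x = w")
      case False
      have x: "x \<in> X" "x \<notin> D" "x \<noteq> a" using less.prems D by auto
      then have px: "p x \<in> X - D" using pX False D(5) X'(1) by blast
      then have "(x, p x) \<in> ?R Y" using p_adj(1)[OF x(1) False] adj_sym less.prems by (auto simp: Y_def)
      moreover have "(p x, w) \<in> (?R Y)\<^sup>*" using less.hyps px p_adj(2)[OF x(1) False] by blast
      ultimately show ?thesis by (rule converse_rtrancl_into_rtrancl)
    qed simp
  qed
  have link2: "x \<in> X \<inter> D \<Longrightarrow> (act t x, act t a) \<in> (?R X2)\<^sup>*" for x
  proof (induction "d x" arbitrary: x rule: less_induct)
    case less
    show ?case
    proof (cases "x = a")
      case False
      have x: "x \<in> X" "x \<in> D" "x \<noteq> w" using less.prems D by auto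
      then have px: "p x \<in> X \<inter> D" using pX False D(5) X'(1) by blast
      then have "(act t x, act t (p x)) \<in> ?R X2"
        using adj_act[OF adj_sym[OF p_adj(1)[OF x(1,3)]] t] less.prems by (auto simp: X2_def)
      moreover have "(act t (p x), act t a) \<in> (?R X2)\<^sup>*" using less.hyps px p_adj(2)[OF x(1,3)] by blast
      ultimately show ?thesis by (rule converse_rtrancl_into_rtrancl)
    qed simp
  qed
  have link3: "(act t x, act t z) \<in> (?R X2)\<^sup>*" if "x \<in> X \<inter> D" for x
    using link2[OF that] symR[OF link2[of z]] w D(4) by (meson IntI rtrancl_trans)
  have to_w: "(x, w) \<in> (?R Y)\<^sup>*" if "x \<in> Y" for x
  proof (cases "x \<in> X - D")
    case False
    then obtain x' where x': "x' \<in> X \<inter> D" "x = act t x'" using \<open>x \<in> Y\<close> by (auto simp: Y_def X2_def)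
    have "(?R X2)\<^sup>* \<subseteq> (?R Y)\<^sup>*" by (rule rtrancl_mono) (auto simp: Y_def)
    then have "(x, act t z) \<in> (?R Y)\<^sup>*" using link3[OF x'(1)] x'(2) by blast
    moreover have "(act t z, w) \<in> ?R Y" using wz(1) adj_sym w D by (auto simp: Y_def X2_def)
    ultimately show ?thesis by (rule rtrancl_into_rtrancl)
  qed (rule link1)
  have "conn Y"
    unfolding conn_def
  proof (intro ballI)
    fix u v assume uv: "u \<in> Y" "v \<in> Y"
    show "(u, v) \<in> (?R Y)\<^sup>*"
      by (rule rtrancl_trans[OF to_w[OF uv(1)] symR[OF to_w[OF uv(2)]]])
  qed
  moreover have "Y \<subseteq> VT" using X'(1) act_closed t by (auto simp: Y_def X2_def)
  moreover have Yrep: "\<exists>x k. x \<in> X \<and> k \<in> carrier S \<and> v = act k x \<and> k = (if x \<in> D then t else \<one>)" if v: "v \<in> Y" for v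
  proof (cases "v \<in> X - D")
    case True
    then have "v = act \<one> v" using act_one X'(1) by auto
    then show ?thesis using True by (intro exI[of _ v] exI[of _ \<one>]) auto
  next
    case False
    then obtain x where "x \<in> X \<inter> D" "v = act t x" using v by (auto simp: Y_def X2_def)
    then show ?thesis using t by (intro exI[of _ x] exI[of _ t]) auto
  qed
  \<comment> \<open>\<open>Y\<close> contains exactly one translate of each \<open>x\<close> of
    \<open>X\<close>, by \<open>t\<close> or trivially according to \<open>D\<close>.\<close>
  have same: "v = act (if x \<in> D then t else \<one>) x" if v: "v \<in> Y" and g: "x \<in> X" "g \<in> carrier S" "act g x = v" for v x g
  proof -
    obtain x' k where k: "x' \<in> X" "k \<in> carrier S" "v = act k x'" "k = (if x' \<in> D then t else \<one>)"
      using Yrep[OF v] by blast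
    have V: "x \<in> VT" "x' \<in> VT" using g(1) k(1) X'(1) by auto
    have "act (inv k \<otimes> g) x = x'" using act_mult[of "inv k" g x] act_inv(1)[OF k(2) V(2)] g k(2,3) V by simp
    then have "x = x'" using X'(3)[OF g(1) k(1), of "inv k \<otimes> g"] g(2) k(2) by simp
    then show ?thesis using k(3,4) by simp
  qed
  have inj: "u = v" if uv: "u \<in> Y" "v \<in> Y" "g \<in> carrier S" "act g u = v" for u v g
  proof -
    obtain x k where k: "x \<in> X" "k \<in> carrier S" "u = act k x" using Yrep[OF uv(1)] by blast
    have "x \<in> VT" using k(1) X'(1) by auto
    then have "act (g \<otimes> k) x = v" using act_mult[OF uv(3) k(2)] uv(4) k(3) by simp
    then have "v = act (if x \<in> D then t else \<one>) x" using same[OF uv(2) k(1), of "g \<otimes> k"] uv(3) k(2) by simp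
    moreover have "u = act (if x \<in> D then t else \<one>) x" using same[OF uv(1) k(1,2)] k(3) by simp
    ultimately show ?thesis by simp
  qed
  have cov: "\<exists>x\<in>Y. \<exists>g\<in>carrier S. act g x = v" if v: "v \<in> VT" for v
  proof -
    obtain x g where x: "x \<in> X" "g \<in> carrier S" "act g x = v" using X'(4)[OF v] by blast
    show ?thesis
    proof (cases "x \<in> D")
      case True
      then have "act t x \<in> Y" using x by (auto simp: Y_def X2_def)
      moreover have "x \<in> VT" using x(1) X'(1) by auto
      then have "act (g \<otimes> inv t) (act t x) = v" using x t by (simp add: act_mult act_closed)
      moreover have "g \<otimes> inv t \<in> carrier S" using x t by simp
      ultimately show ?thesis by blast
    next
      case False
      then have "x \<in> Y" using x by (simp add: Y_def)
      then show ?thesis using x by blast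
    qed
  qed
  have tr: "transversal Y"
    unfolding transversal_def partial_transversal_def
    using \<open>conn Y\<close> \<open>Y \<subseteq> VT\<close> inj cov by blast
  \<comment> \<open>Otherwise one element takes \<open>a\<close> to its translate by
    \<open>t\<close> and fixes \<open>p a\<close>, making these two adjacent. The only edge between
    the moved piece and \<open>X\<close> is the former outer edge, so its inverse would carry that
    edge to the edge from \<open>w\<close> to \<open>a\<close> inside \<open>X\<close>.\<close>
  have "\<not> inner Y a (p a)"
  proof
    assume "inner Y a (p a)"
    then obtain g where g: "g \<in> carrier S" "act g a \<in> Y" "act g (p a) \<in> Y" by (auto simp: inner_def)
    have paX: "p a \<in> X" using pX a by blast
    have ga: "act g a = act t a" using same[OF g(2) a(1) g(1) HOL.refl] D(1) by simp
    have "p a \<in> VT" using paX X'(1) by auto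
    then have gp: "act g (p a) = p a" using same[OF g(3) paX g(1) HOL.refl] D(3) act_one by simp
    define b where "b = act t z"
    have bV: "b \<in> VT" using act_closed t wV by (simp add: b_def)
    have "(b \<noteq> w \<and> w = p b) \<or> (w \<noteq> w \<and> b = p w)"
      using pd[unfolded rooted_def, THEN conjunct2, rule_format, OF wz(1)] unfolding b_def .
    then have b: "b \<noteq> w" "p b = w" by auto
    have bX: "b \<notin> X" using wz(2) inner_I[OF X'(1) w(1)] by (auto simp: b_def)
    \<comment> \<open>The branch beyond the end \<open>b\<close> of the outer edge misses
      \<open>X\<close> and contains the moved piece, so every edge between the two runs from
      \<open>b\<close> to \<open>w\<close>.\<close>
    obtain D' where "D' \<subseteq> VT" and D': "b \<in> D'" "w \<notin> D'" and "p b \<notin> D'" and D'_iff: "\<And>v. v \<in> VT \<Longrightarrow> v \<noteq> w \<Longrightarrow> v \<noteq> b \<Longrightarrow> v \<in> D' \<longleftrightarrow> p v \<in> D'"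
      and D'_cross: "\<And>u v. adj u v \<Longrightarrow> u \<in> D' \<Longrightarrow> v \<notin> D' \<Longrightarrow> u = b \<and> v = p b"
      by (rule descendants[OF pd wV(1) bV b(1)]) (rule that)
    have XD': "x \<in> X \<Longrightarrow> x \<notin> D'" for x
    proof (induction "d x" arbitrary: x rule: less_induct)
      case less
      show ?case
      proof (cases "x = w")
        case False
        then have "p x \<notin> D'" using less pX p_adj by blast
        then show ?thesis using D'_iff[of x] less.prems bX False X'(1) by blast
      qed (use D' in simp)
    qed
    have wX2: "w \<notin> X2"
    proof
      assume "w \<in> X2"
      then obtain x where "x \<in> X \<inter> D" "act t x = w" by (auto simp: X2_def)
      then show False using X'(3)[of x w t] w t D(2) by auto
    qed
    have "v \<in> D'" if "(b, v) \<in> (?R X2)\<^sup>*" for v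
      using that
    proof (induction rule: rtrancl_induct)
      case (step u v)
      then have "adj u v" "v \<in> X2" by auto
      then show ?case using D'_cross[of u v] step.IH b wX2 by blast
    qed (use D' in simp)
    then have taD: "act t a \<in> D'" using symR[OF link3[of a]] a D(1) by (simp add: b_def)
    have "adj (act t a) (p a)" using adj_act[OF adj_sym[OF p_adj(1)[OF a]] g(1)] ga gp by simp
    then have *: "act t a = b" "p a = w" using D'_cross taD XD'[OF paX] b by blast+
    have "act (inv g) w = w" "act (inv g) b = a"
      using act_inv_eq[OF g(1), of "p a"] act_inv_eq[OF g(1), of a] * gp ga wV by auto
    then have "inner X w b" unfolding inner_def using g(1) w(1) a(1) by (intro bexI[of _ "inv g"]) simp_all
    then show False using wz(2) by (simp add: b_def)
  qed
  then show ?thesis using tr by blast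
qed

text \<open>If both alternatives fail, there is one orbit of outer edges, and its stabilisers are
  nontrivial. Its directions \<open>y0\<close> at \<open>w\<close> and \<open>y1\<close> at
  \<open>x\<close> are matched by \<open>L t\<close> up to sign. A compatible family of functionals
  that vanishes on both edge groups would give a surjection unless it vanishes on all stabilisers.
  Suitable families force each edge on the path from \<open>w\<close> to \<open>x\<close> to be
  parallel to \<open>y0\<close> or \<open>y1\<close>. The congruence then makes \<open>y0\<close>
  and \<open>y1\<close> parallel, and the constant family \<open>y0\<close> confines all stabilisers
  of \<open>X\<close> to one line.\<close>

lemma dichotomy_loop:
  assumes X: "transversal X" and uv: "(u, v) \<in> E" "\<not> inner X u v"
  shows "surjects_to_F2 S \<or> small_free_abelian S"
proof (rule ccontr)
  assume neg: "\<not> (surjects_to_F2 S \<or> small_free_abelian S)"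
  note X' = transversalD[OF X]
  obtain g0 w x t where r: "g0 \<in> carrier S" "w \<in> X" "x \<in> X" "t \<in> carrier S" "act g0 w = u" "act g0 (act t x) = v"
    "(w, act t x) \<in> E" "\<not> inner X w (act t x)" by (rule outer_edge_rep[OF X uv])
  have one: "\<exists>g\<in>carrier S. act g w = a \<and> act g (act t x) = b" if "(a, b) \<in> E" "\<not> inner X a b" for a b
    using surjects_to_F2_two_loops[OF X r(7,8) that] neg by blast
  have V: "w \<in> VT" "x \<in> VT" "act t x \<in> VT" "act (inv t) w \<in> VT" using r X'(1) act_closed by auto
  have adj0: "adj w (act t x)" using r(7) by (simp add: adj_def)
  have adj1: "adj x (act (inv t) w)" using adj_act[OF adj_sym[OF adj0], of "inv t"] r V by simp
  define y0 where "y0 = y w (act t x)"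
  define y1 where "y1 = y x (act (inv t) w)"
  have prim: "primitive y0" "primitive y1" using y_primitive adj0 adj1 by (simp_all add: y0_def y1_def)
  \<comment> \<open>All transversals are considered, since after a switch the same statement applies
    to edges of \<open>X\<close> on the path from \<open>w\<close> to \<open>x\<close>.\<close>
  have nontriv: "\<exists>s. s \<in> stab a \<and> s \<in> stab b \<and> s \<noteq> \<one>" if ab: "adj a b" "\<not> inner Z a b" "transversal Z" for a b Z
  proof (rule ccontr)
    assume n: "\<not> ?thesis"
    have "a \<in> VT" "b \<in> VT" using ab adj_verts by auto
    then have "stab a \<inter> stab b = {\<one>}" "stab b \<inter> stab a = {\<one>}" using n stab_one by blast+
    then show False
      using dichotomy_trivial_edge[OF ab(3)] ab neg inner_sym unfolding adj_def by blast
  qed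
  obtain e0 where e0: "e0 \<in> stab w" "e0 \<in> stab (act t x)" "e0 \<noteq> \<one>" using nontriv[OF adj0 r(8) X] by blast
  \<comment> \<open>A nontrivial element of the edge group, conjugated by \<open>t\<close>, lies on
    both lines, and primitive vectors on one line agree up to sign.\<close>
  have L01: "L t y1 = y0 \<or> L t y1 = - y0"
  proof -
    define e1 where "e1 = inv t \<otimes> e0 \<otimes> t"
    have e0c: "e0 \<in> carrier S" using e0 stab_carrier by auto
    have e0_eq: "e0 = t \<otimes> e1 \<otimes> inv t" using e0c r(4) by (simp add: e1_def S.m_assoc S.mult_inv_cancel)
    have e1: "e1 \<in> stab x" using stab_conj'[OF V(2) r(4) e0(2)] by (simp add: e1_def)
    have e1': "e1 \<in> stab (act (inv t) w)"
      using stab_conj[OF V(1), of "inv t" e0] r(4) e0(1) by (simp add: e1_def)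
    obtain k where k: "\<tau> e1 = scl k y1" using edge_scl[OF adj1 e1 e1'] y1_def by blast
    have \<tau>0: "\<tau> e0 = scl k (L t y1)" using \<tau>_conj[OF r(4) V(2) e1] e0_eq k L_scl[OF r(4)] by simp
    have "\<tau> e0 \<noteq> 0" using \<tau>_nonzero[OF V(1) e0(1,3)] .
    then have "k \<noteq> 0" using \<tau>0 by (auto simp: scl_def zero_prod_def)
    moreover have "det y0 (\<tau> e0) = 0" using y_stab[OF adj0 e0(1)] e0(2) by (simp add: y0_def)
    ultimately have "det y0 (L t y1) = 0" using \<tau>0 by (simp add: det_scl)
    then show ?thesis using primitive_parallel[OF prim(1) L_primitive[OF r(4) prim(2)]] by blast
  qed
  have L1: "mod_eq m (L t y1) y1" using L_mod[OF r(4)] .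
  \<comment> \<open>The outer edges already supply one free generator; a family that vanishes on
    both edge groups but not on all stabilisers would supply the other.\<close>
  have crit: False
    if compat: "\<And>a b s. a \<in> X \<Longrightarrow> b \<in> X \<Longrightarrow> adj a b \<Longrightarrow> s \<in> stab a \<Longrightarrow> s \<in> stab b \<Longrightarrow> det (h a) (\<tau> s) = det (h b) (\<tau> s)"
      and h0: "\<And>z. det y0 z = 0 \<Longrightarrow> det (h w) z = 0" and h1: "\<And>z. det y1 z = 0 \<Longrightarrow> det (h x) z = 0"
      and nz: "a \<in> X" "s \<in> stab a" "det (h a) (\<tau> s) \<noteq> 0" for h a s
  proof -
    have "surjects_to_F2 S"
    proof (rule surjects_to_F2_functionals[OF X, of h "\<lambda>_. False"])
      fix z v s assume z: "z \<in> X" "adj z v" "\<not> inner X z v" "s \<in> stab z" "s \<in> stab v"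
      have "(z = w \<and> s \<in> stab (act t x)) \<or> (z = x \<and> s \<in> stab (act (inv t) w))"
        by (rule outer_edge_cases[OF X r(2,3,4) one z])
      then show "det (h z) (\<tau> s) = 0"
      proof (elim disjE conjE)
        assume *: "z = w" "s \<in> stab (act t x)"
        then have "det y0 (\<tau> s) = 0" using y_stab[OF adj0] z(4) by (simp add: y0_def)
        then show ?thesis using h0 *(1) by blast
      next
        assume *: "z = x" "s \<in> stab (act (inv t) w)"
        then have "det y1 (\<tau> s) = 0" using y_stab[OF adj1] z(4) by (simp add: y1_def)
        then show ?thesis using h1 *(1) by blast
      qed
    qed (use compat nz uv in auto)
    then show False using neg by blast
  qed

  obtain p d where pd: "rooted w p d" using rooted_ex[OF V(1)] .
  note p = pd[unfolded rooted_def, THEN conjunct1, rule_format]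
  have pX: "p a \<in> X" if "a \<in> X" "a \<noteq> w" for a using conn_parent_closed[OF X'(2,1) pd r(2) that] .
  have p_adj: "adj a (p a)" "d a = Suc (d (p a))" if "a \<in> X" "a \<noteq> w" for a using p[of a] that X'(1) adj_sym by auto
  define isD where "isD a D \<longleftrightarrow> D \<subseteq> VT \<and> a \<in> D \<and> w \<notin> D \<and> p a \<notin> D \<and>
    (\<forall>v\<in>VT. v \<noteq> w \<longrightarrow> v \<noteq> a \<longrightarrow> (v \<in> D \<longleftrightarrow> p v \<in> D)) \<and>
    (\<forall>u v. adj u v \<longrightarrow> u \<in> D \<longrightarrow> v \<notin> D \<longrightarrow> u = a \<and> v = p a)" for a D
  have "\<exists>D. isD a D" if "a \<in> VT" "a \<noteq> w" for a
    by (rule descendants[OF pd V(1) that]) (unfold isD_def, blast)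
  then have "\<forall>a\<in>VT - {w}. \<exists>D. isD a D" by blast
  then obtain Dn where Dn: "\<forall>a\<in>VT - {w}. isD a (Dn a)" using bchoice[of "VT - {w}" isD] by blast
  have D_refl: "a \<in> Dn a" and D_w: "w \<notin> Dn a" and D_p: "p a \<notin> Dn a" and D_VT: "Dn a \<subseteq> VT"
    and D_iff: "\<And>v. v \<in> VT \<Longrightarrow> v \<noteq> w \<Longrightarrow> v \<noteq> a \<Longrightarrow> v \<in> Dn a \<longleftrightarrow> p v \<in> Dn a"
    and D_cross: "\<And>u v. adj u v \<Longrightarrow> u \<in> Dn a \<Longrightarrow> v \<notin> Dn a \<Longrightarrow> u = a \<and> v = p a"
    if "a \<in> X" "a \<noteq> w" for a
  proof -
    have "isD a (Dn a)" using Dn that X'(1) by blast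
    note D = this[unfolded isD_def]
    show "a \<in> Dn a" "w \<notin> Dn a" "p a \<notin> Dn a" "Dn a \<subseteq> VT" using D by simp_all
    show "v \<in> Dn a \<longleftrightarrow> p v \<in> Dn a" if "v \<in> VT" "v \<noteq> w" "v \<noteq> a" for v using D that by blast
    show "u = a \<and> v = p a" if "adj u v" "u \<in> Dn a" "v \<notin> Dn a" for u v using D that by blast
  qed
  have split_compat: "det (if a \<in> Dn c then h else h') (\<tau> s) = det (if b \<in> Dn c then h else h') (\<tau> s)"
    if c: "c \<in> X" "c \<noteq> w" and hh: "\<And>s. s \<in> stab c \<Longrightarrow> s \<in> stab (p c) \<Longrightarrow> det h (\<tau> s) = det h' (\<tau> s)"
      and ab: "adj a b" "s \<in> stab a" "s \<in> stab b" for a b c s and h h' :: vec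
  proof (cases "a \<in> Dn c \<longleftrightarrow> b \<in> Dn c")
    case False
    then have "(a = c \<and> b = p c) \<or> (b = c \<and> a = p c)" using D_cross[OF c] ab(1) adj_sym by blast
    then show ?thesis using hh ab(2,3) False by auto
  qed simp
  \<comment> \<open>The edge above \<open>a\<close> is off the path from \<open>w\<close> to
    \<open>x\<close>. Its direction beyond it, and 0 elsewhere, form a compatible family, and both
    \<open>w\<close> and \<open>x\<close> lie where it is 0.\<close>
  have dead_off: "stab a \<subseteq> stab (p a)" if a: "a \<in> X" "a \<noteq> w" "x \<notin> Dn a" for a
  proof (rule ccontr)
    assume "\<not> ?thesis"
    then obtain s where s: "s \<in> stab a" "s \<notin> stab (p a)" by blast
    let ?h = "\<lambda>v. if v \<in> Dn a then y a (p a) else 0"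
    note ya = y_stab[OF p_adj(1)[OF a(1,2)]]
    show False
    proof (rule crit[of ?h a s])
      fix b c s assume "adj b c" "s \<in> stab b" "s \<in> stab c"
      then show "det (?h b) (\<tau> s) = det (?h c) (\<tau> s)"
        by (intro split_compat[OF a(1,2)]) (use ya in auto)
    qed (use a s ya D_refl[OF a(1,2)] D_w[OF a(1,2)] in auto)
  qed
  \<comment> \<open>An edge on the path becomes outer for a switched transversal, hence has
    nontrivial stabiliser.\<close>
  have path_edge: "\<exists>e k. e \<in> stab a \<and> e \<in> stab (p a) \<and> e \<noteq> \<one> \<and> \<tau> e = scl k (y a (p a)) \<and> k \<noteq> 0"
    if a: "a \<in> X" "a \<noteq> w" "x \<in> Dn a" for a
  proof -
    obtain Z where "transversal Z" "\<not> inner Z a (p a)"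
      using switch_transversal[OF X r(2,3,4) adj0 r(8) pd a(1,2) D_refl[OF a(1,2)] D_w[OF a(1,2)] D_p[OF a(1,2)] a(3) D_iff[OF a(1,2)]]
      by blast
    then obtain e where e: "e \<in> stab a" "e \<in> stab (p a)" "e \<noteq> \<one>" using nontriv[OF p_adj(1)[OF a(1,2)]] by blast
    obtain k where k: "\<tau> e = scl k (y a (p a))" using edge_scl[OF p_adj(1)[OF a(1,2)] e(1,2)] .
    have "a \<in> VT" using a X'(1) by auto
    then have "k \<noteq> 0" using k \<tau>_nonzero[OF _ e(1,3)] by (auto simp: scl_def zero_prod_def)
    then show ?thesis using e k by blast
  qed

  show False
  proof (cases "det y0 y1 = 0")
    case False
    have path_par: "det y0 (y a (p a)) = 0 \<or> det y1 (y a (p a)) = 0" if a: "a \<in> X" "a \<noteq> w" "x \<in> Dn a" for a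
    proof (rule ccontr)
      let ?y = "y a (p a)"
      assume n: "\<not> ?thesis"
      obtain e k where e: "e \<in> stab a" "\<tau> e = scl k ?y" "k \<noteq> 0" using path_edge[OF a] by blast
      \<comment> \<open>Both functionals take the value \<open>det y0 ?y * det y1 ?y\<close> on
        \<open>?y\<close>, so they fit together across the edge. \<open>?hin\<close> vanishes on
        \<open>y1\<close>, as required at \<open>x\<close>, and \<open>?hout\<close> on
        \<open>y0\<close>, as required at \<open>w\<close>.\<close>
      let ?hin = "scl (det y0 ?y) y1" and ?hout = "scl (det y1 ?y) y0"
      let ?h = "\<lambda>v. if v \<in> Dn a then ?hin else ?hout"
      show False
      proof (rule crit[of ?h a e])
        fix b c s assume bc: "adj b c" "s \<in> stab b" "s \<in> stab c"
        show "det (?h b) (\<tau> s) = det (?h c) (\<tau> s)"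
        proof (rule split_compat[OF a(1,2) _ bc])
          fix s assume "s \<in> stab a" "s \<in> stab (p a)"
          then obtain j where "\<tau> s = scl j ?y" using edge_scl[OF p_adj(1)[OF a(1,2)]] by blast
          then show "det ?hin (\<tau> s) = det ?hout (\<tau> s)" by (simp add: det_scl det_scl_left)
        qed
      qed (use a e n D_refl[OF a(1,2)] D_w[OF a(1,2)] in \<open>auto simp: det_scl det_scl_left\<close>)
    qed
    \<comment> \<open>The direction \<open>y0\<close> occurs at \<open>w\<close> and
      \<open>y1\<close> at \<open>x\<close>, and all edges on the path between them are parallel to
      one of the two, so both occur at some vertex. Unless all are parallel to \<open>y0\<close>,
      this is the end closer to \<open>w\<close> of the first edge that is not.\<close>
    have "\<exists>z b c. adj z b \<and> adj z c \<and> det y0 (y z b) = 0 \<and> det y1 (y z c) = 0"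
    proof (cases "\<forall>a\<in>X. a \<noteq> w \<longrightarrow> x \<in> Dn a \<longrightarrow> det y0 (y a (p a)) = 0")
      case True
      show ?thesis
      proof (cases "x = w")
        case True
        then show ?thesis using adj0 adj1 y0_def y1_def det_self(1) by metis
      next
        case f: False
        then have "det y0 (y x (p x)) = 0" using True D_refl r(3) by blast
        then show ?thesis using p_adj(1)[OF r(3) f] adj1 y1_def det_self(1) by metis
      qed
    next
      case False
      let ?P = "\<lambda>a. a \<in> X \<and> a \<noteq> w \<and> x \<in> Dn a \<and> det y0 (y a (p a)) \<noteq> 0"
      obtain a where a: "?P a" and min: "\<And>b. ?P b \<Longrightarrow> d a \<le> d b"
        using False ex_has_least_nat[of ?P _ d] by blast
      have aX: "a \<in> X" "a \<noteq> w" using a by auto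
      have "det y1 (y a (p a)) = 0" using path_par a by blast
      then have c: "adj (p a) a" "det y1 (y (p a) a) = 0"
        using adj_sym p_adj(1)[OF aX] y_sym[OF p_adj(1)[OF aX]] by auto
      show ?thesis
      proof (cases "p a = w")
        case True
        then show ?thesis using c adj0 y0_def det_self(1) by metis
      next
        case f: False
        have paX: "p a \<in> X" using pX[OF aX] .
        have aV: "a \<in> VT" using aX X'(1) by auto
        have "p a \<noteq> a" using p_adj(2)[OF aX] by auto
        then have aD: "a \<in> Dn (p a)" using D_iff[OF paX f aV aX(2)] D_refl[OF paX f] by simp
        \<comment> \<open>The branch beyond \<open>a\<close> lies in the branch beyond
          \<open>p a\<close>, so the edge above \<open>p a\<close> is also on the path and
          minimality applies to it.\<close>
        have "v \<in> Dn a \<longrightarrow> v \<in> Dn (p a)" if "v \<in> VT" for v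
          using that
        proof (induction "d v" arbitrary: v rule: less_induct)
          case less
          show ?case
          proof (cases "v = a \<or> v = w \<or> v = p a")
            case True
            then show ?thesis using aD D_w[OF aX] D_refl[OF paX f] by blast
          next
            case nv: False
            then have pv: "p v \<in> VT" "d (p v) < d v" using p[of v] less.prems by auto
            show ?thesis
              using D_iff[OF aX less.prems] D_iff[OF paX f less.prems] less.hyps[OF pv(2,1)] nv by blast
          qed
        qed
        then have "x \<in> Dn (p a)" using a V by blast
        moreover have "\<not> d a \<le> d (p a)" using p_adj(2)[OF aX] by simp
        ultimately have "det y0 (y (p a) (p (p a))) = 0" using min[of "p a"] paX f by blast
        then show ?thesis using c p_adj(1)[OF paX f] by blast
      qed
    qed
    then obtain z b c where zbc: "adj z b" "adj z c" "det y0 (y z b) = 0" "det y1 (y z c) = 0" by blast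
    note pz = y_primitive[OF zbc(1)] y_primitive[OF zbc(2)]
    have s0: "y z b = y0 \<or> y z b = - y0" using primitive_parallel[OF prim(1) pz(1) zbc(3)] .
    have s1: "y z c = y1 \<or> y z c = - y1" using primitive_parallel[OF prim(2) pz(2) zbc(4)] .
    \<comment> \<open>Up to sign \<open>y z b\<close> is \<open>L t y1\<close>, which is congruent
      to \<open>y1\<close>, and \<open>y1\<close> is \<open>y z c\<close> up to sign. Congruent
      directions at one vertex are parallel by \<open>y_mod\<close>.\<close>
    have "y z b = L t y1 \<or> y z b = - L t y1" using s0 L01 by auto
    then have "det (y z b) (y z c) = 0"
      using mod_eq_up_to_sign[OF L1 _ s1] y_mod[OF zbc(1,2)] by blast
    then have "det y0 y1 = 0" using s0 s1 by (auto simp: det_def)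
    then show False using False by blast
  next
    case True
    have par: "y1 = y0 \<or> y1 = - y0" using primitive_parallel[OF prim True] .
    have d01: "det y1 z = 0 \<longleftrightarrow> det y0 z = 0" for z using par by (auto simp: det_def)
    \<comment> \<open>With \<open>y0\<close> and \<open>y1\<close> parallel, the functional
      \<open>y0\<close> at every vertex kills both edge groups.\<close>
    have all: "det y0 (\<tau> s) = 0" if "a \<in> X" "s \<in> stab a" for a s
      using crit[of "\<lambda>_. y0" a s] that d01 by blast
    have dead: "stab a \<subseteq> stab (p a)" if a: "a \<in> X" "a \<noteq> w" for a
    proof (cases "x \<in> Dn a")
      case True
      obtain e k where e: "e \<in> stab a" "\<tau> e = scl k (y a (p a))" "k \<noteq> 0" using path_edge[OF a True] by blast
      have "k * det y0 (y a (p a)) = 0" using all[OF a(1) e(1)] e(2) by (simp add: det_scl)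
      then have "det y0 (y a (p a)) = 0" using e by simp
      then have "det (y a (p a)) z = 0 \<longleftrightarrow> det y0 z = 0" for z
        using det_parallel[OF prim(1) y_primitive[OF p_adj(1)[OF a]]] by blast
      then show ?thesis using all[OF a(1)] y_stab[OF p_adj(1)[OF a]] by blast
    qed (use dead_off a in blast)
    have st: "a \<in> X \<Longrightarrow> stab a \<subseteq> stab w" for a
    proof (induction "d a" arbitrary: a rule: less_induct)
      case less
      show ?case
      proof (cases "a = w")
        case f: False
        have "d (p a) < d a" using p_adj(2)[OF less.prems f] by simp
        then show ?thesis using less.hyps[of "p a"] pX[OF less.prems f] dead[OF less.prems f] by blast
      qed simp
    qed
    have neg_L: "L t (- z) = - L t z" for z using L_scl[OF r(4), of "- 1" z] by (simp add: scl_minus_one)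
    have "L t y0 = y0 \<or> L t y0 = - y0"
      using par
    proof
      assume "y1 = y0"
      then show ?thesis using L01 by simp
    next
      assume "y1 = - y0"
      then have "L t y1 = - L t y0" using neg_L by simp
      then show ?thesis using L01 by (metis minus_equation_iff)
    qed
    moreover have "L t y0 \<noteq> - y0"
      using primitive_not_mod_eq_minus[OF prim(1) m_ge] L_mod[OF r(4), of y0] by auto
    ultimately have Ly0: "L t y0 = y0" by blast
    \<comment> \<open>\<open>s\<close> and its conjugate by \<open>t\<close> lie in
      \<open>stab w\<close> on the line of \<open>y0\<close>, which \<open>L t\<close> fixes
      pointwise; equal vectors then give equal elements.\<close>
    have comm: "t \<otimes> s = s \<otimes> t" if s: "s \<in> stab w" for s
    proof -
      have sc: "s \<in> carrier S" using s stab_carrier by auto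
      have "s \<in> stab (act t x)" using y_stab[OF adj0 s] all[OF r(2) s] by (simp add: y0_def)
      then have s'x: "inv t \<otimes> s \<otimes> t \<in> stab x" using stab_conj'[OF V(2) r(4)] by blast
      define s' where "s' = inv t \<otimes> s \<otimes> t"
      have s': "s' \<in> stab x" "s' \<in> stab w" using s'x st[OF r(3)] by (auto simp: s'_def)
      have s_eq: "s = t \<otimes> s' \<otimes> inv t" using sc r(4) by (simp add: s'_def S.m_assoc S.mult_inv_cancel)
      obtain k where k: "\<tau> s' = scl k y0"
        using all[OF r(2) s'(2)] det_eq_0_iff[OF prim(1)] by (auto simp: line_def)
      have "\<tau> s = L t (\<tau> s')" using \<tau>_conj[OF r(4) V(2) s'(1)] s_eq by simp
      then have "\<tau> s = \<tau> s'" using k L_scl[OF r(4)] Ly0 by simp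
      then have "s = s'" using \<tau>_eq[OF V(1) s s'(2)] by blast
      then have "t \<otimes> s = t \<otimes> (inv t \<otimes> (s \<otimes> t))" using sc r(4) by (simp add: s'_def S.m_assoc)
      then show ?thesis using sc r(4) by (simp add: S.mult_inv_cancel)
    qed
    have y0nz: "y0 \<noteq> 0"
    proof
      assume "y0 = 0"
      then have "y0 = scl 0 0" by (simp add: scl_def zero_prod_def)
      then have "\<bar>0 :: int\<bar> = 1" using prim(1) unfolding primitive_def by blast
      then show False by simp
    qed
    then obtain c where c: "det c y0 \<noteq> 0" using nonzero_functional by blast
    have "small_free_abelian S"
    proof (rule small_free_abelian_loop[OF X r(2,3,4,7,8) one st comm])
      fix s assume s: "s \<in> stab w" "det c (\<tau> s) = 0"
      obtain k where k: "\<tau> s = scl k y0"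
        using all[OF r(2) s(1)] det_eq_0_iff[OF prim(1)] by (auto simp: line_def)
      then have "k = 0" using s(2) c by (simp add: det_scl)
      then have "\<tau> s = 0" using k by (simp add: scl_def zero_prod_def)
      then show "s = \<one>" using \<tau>_inj[OF V(1) s(1)] by blast
    qed
    then show False using neg by blast
  qed
qed

text \<open>Ranks are at most two, so a vertex of maximal rank exists although the tree may be
  infinite; it serves as the root when all edges are inner.\<close>

theorem dichotomy: "surjects_to_F2 S \<or> small_free_abelian S"
proof -
  have fin: "finite (rk ` VT)" by (rule finite_subset[of _ "{..2}"]) (auto simp: rk_def)
  obtain r where r: "r \<in> VT" "\<And>v. v \<in> VT \<Longrightarrow> rk v \<le> rk r"
  proof -
    have "Max (rk ` VT) \<in> rk ` VT" using fin VT_nonempty by (intro Max_in) auto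
    then obtain r where "r \<in> VT" "Max (rk ` VT) = rk r" by blast
    then show thesis using that[of r] Max_ge[OF fin] by (metis imageI)
  qed
  obtain X where X: "transversal X" "r \<in> X" using transversal_ex[OF r(1)] .
  show ?thesis
  proof (cases "\<forall>u v. adj u v \<longrightarrow> inner X u v")
    case True
    then show ?thesis using dichotomy_tree[OF r(2) X(2,1)] by blast
  next
    case False
    then show ?thesis using dichotomy_loop[OF X(1)] inner_sym unfolding adj_def by blast
  qed
qed

end

section \<open>Potentials on trees\<close>

lemma wf_both_directions: "wf_digraph T \<Longrightarrow> wf_digraph (both_directions T)"
  by (auto simp: wf_digraph_def both_directions_def)

text \<open>Using an edge again, in either direction, would revisit the vertex from which it was
  first traversed.\<close>

lemma apath_both_directions_distinct:
  assumes "wf_digraph T" "pre_digraph.apath (both_directions T) u p v"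
  shows "distinct (map fst p)"
  using assms(2)
proof (induction p arbitrary: u)
  case (Cons f q)
  interpret wf_digraph "both_directions T" using assms(1) by (rule wf_both_directions)
  have f: "apath (head (both_directions T) f) q v"
    "tail (both_directions T) f \<notin> set (awalk_verts (head (both_directions T) f) q)"
    using Cons.prems unfolding apath_Cons_iff by blast+
  have "fst f \<notin> fst ` set q"
  proof
    assume "fst f \<in> fst ` set q"
    then obtain f' where f': "f' \<in> set q" "fst f' = fst f" by force
    have "tail (both_directions T) f' \<in> set (awalk_verts (head (both_directions T) f) q)"
      "head (both_directions T) f' \<in> set (awalk_verts (head (both_directions T) f) q)"
      using awalk_verts_arc1[OF f'(1)] awalk_verts_arc2[OF awalkI_apath[OF f(1)] f'(1)] by auto
    moreover have "tail (both_directions T) f = tail (both_directions T) f' \<or> tail (both_directions T) f = head (both_directions T) f'"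
      using f'(2) by (cases f; cases f') (auto simp: both_directions_def)
    ultimately show False using f(2) by auto
  qed
  then show ?case using Cons.IH[OF f(1)] by simp
qed simp

text \<open>Edges are added one by one. Without circuits the new edge joins different components,
  and left multiplication on the component of its head repairs the relation there. The other
  relations survive, since their factors stand on the right. The lemma is applied to changes of
  coordinates and to sets of edges.\<close>

lemma tree_potential:
  assumes wf: "wf_digraph T" and fin: "finite (arcs T)" and acyc: "\<nexists>p. circuit T p"
    and K: "group K" and k: "\<And>e. e \<in> arcs T \<Longrightarrow> k e \<in> carrier K"
  shows "\<exists>B. (\<forall>v. B v \<in> carrier K) \<and> (\<forall>e\<in>arcs T. B (head T e) = B (tail T e) \<otimes>\<^bsub>K\<^esub> k e)"
proof -
  interpret K: group K by fact
  let ?B = "both_directions T"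
  interpret B: wf_digraph ?B using wf by (rule wf_both_directions)
  have "A \<subseteq> arcs T \<longrightarrow> (\<exists>B. (\<forall>v. B v \<in> carrier K) \<and> (\<forall>e\<in>A. B (head T e) = B (tail T e) \<otimes>\<^bsub>K\<^esub> k e))"
    if "finite A" for A
    using that
  proof (induction A rule: finite_induct)
    case empty
    show ?case by (auto intro: exI[of _ "\<lambda>_. \<one>\<^bsub>K\<^esub>"])
  next
    case (insert e A)
    show ?case
    proof
      assume sub: "insert e A \<subseteq> arcs T"
      then obtain B where B: "\<And>v. B v \<in> carrier K" "\<And>e. e \<in> A \<Longrightarrow> B (head T e) = B (tail T e) \<otimes>\<^bsub>K\<^esub> k e"
        using insert.IH by blast
      let ?R = "\<lambda>u v. \<exists>p. B.awalk u p v \<and> fst ` set p \<subseteq> A"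
      have e: "e \<in> arcs T" "tail T e \<in> verts T" "head T e \<in> verts T" using sub wf by (auto simp: wf_digraph_def)
      \<comment> \<open>A walk back from head to tail can be shortened to a path; closed up by
        \<open>e\<close>, which is not in \<open>A\<close>, it would be a circuit.\<close>
      have notR: "\<not> ?R (head T e) (tail T e)"
      proof
        assume "?R (head T e) (tail T e)"
        then obtain p where p: "B.awalk (head T e) p (tail T e)" "fst ` set p \<subseteq> A" by blast
        let ?q = "B.awalk_to_apath p"
        have q: "B.apath (head T e) ?q (tail T e)" using B.apath_awalk_to_apath p(1) by blast
        have qA: "fst ` set ?q \<subseteq> A" using B.awalk_to_apath_subset[OF p(1)] p(2) by blast
        let ?c = "(e, True) # ?q"
        have te: "tail ?B (e, True) = tail T e" "head ?B (e, True) = head T e" "(e, True) \<in> arcs ?B"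
          using e by (auto simp: both_directions_def)
        have "B.awalk (tail T e) ?c (tail T e)"
          using q te by (simp add: B.awalk_Cons_iff B.apath_def)
        moreover have "distinct (tl (B.awalk_verts (tail T e) ?c))"
          using q te by (simp add: B.apath_def)
        moreover have "distinct (map fst ?c)"
          using apath_both_directions_distinct[OF wf q] qA insert.hyps by auto
        ultimately have "circuit T ?c" unfolding circuit_def B.cycle_def by blast
        then show False using acyc by blast
      qed
      define g where "g = B (tail T e) \<otimes>\<^bsub>K\<^esub> k e \<otimes>\<^bsub>K\<^esub> inv\<^bsub>K\<^esub> B (head T e)"
      define B' where "B' v = (if ?R (head T e) v then g \<otimes>\<^bsub>K\<^esub> B v else B v)" for v
      have ke: "k e \<in> carrier K" using k e by blast
      have gK: "g \<in> carrier K" using ke B by (simp add: g_def)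
      have refl: "?R (head T e) (head T e)"
      proof (intro exI[of _ "[]"] conjI)
        have "head T e \<in> verts ?B" using e by (simp add: both_directions_def)
        then show "B.awalk (head T e) [] (head T e)" unfolding B.awalk_Nil_iff by blast
      qed simp
      have step: "?R (head T e) (tail T a) \<longleftrightarrow> ?R (head T e) (head T a)" if a: "a \<in> A" for a
      proof -
        have aT: "a \<in> arcs T" using a sub by blast
        have arc: "B.awalk (tail T a) [(a, True)] (head T a)" "B.awalk (head T a) [(a, False)] (tail T a)"
          using aT B.arc_implies_awalk[of "(a, True)"] B.arc_implies_awalk[of "(a, False)"]
          by (auto simp: both_directions_def)
        show ?thesis
        proof
          assume "?R (head T e) (tail T a)"
          then obtain p where "B.awalk (head T e) p (tail T a)" "fst ` set p \<subseteq> A" by blast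
          then have "B.awalk (head T e) (p @ [(a, True)]) (head T a)" "fst ` set (p @ [(a, True)]) \<subseteq> A"
            using B.awalk_appendI arc a by auto
          then show "?R (head T e) (head T a)" by blast
        next
          assume "?R (head T e) (head T a)"
          then obtain p where "B.awalk (head T e) p (head T a)" "fst ` set p \<subseteq> A" by blast
          then have "B.awalk (head T e) (p @ [(a, False)]) (tail T a)" "fst ` set (p @ [(a, False)]) \<subseteq> A"
            using B.awalk_appendI arc a by auto
          then show "?R (head T e) (tail T a)" by blast
        qed
      qed
      have "B' (head T a) = B' (tail T a) \<otimes>\<^bsub>K\<^esub> k a" if a: "a \<in> insert e A" for a
      proof (cases "a = e")
        case True
        have "B' (head T e) = g \<otimes>\<^bsub>K\<^esub> B (head T e)" using refl unfolding B'_def by simp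
        moreover have "B' (tail T e) = B (tail T e)" unfolding B'_def by (rule if_not_P[OF notR])
        ultimately show ?thesis using True B(1) ke by (simp add: g_def K.m_assoc)
      next
        case False
        then have aA: "a \<in> A" using a by simp
        then have ka: "k a \<in> carrier K" using k sub by blast
        have b: "B (head T a) = B (tail T a) \<otimes>\<^bsub>K\<^esub> k a" using B(2)[OF aA] .
        show ?thesis
        proof (cases "?R (head T e) (tail T a)")
          case True
          have "B' (head T a) = g \<otimes>\<^bsub>K\<^esub> B (head T a)" "B' (tail T a) = g \<otimes>\<^bsub>K\<^esub> B (tail T a)"
            unfolding B'_def by (rule if_P[OF step[OF aA, THEN iffD1, OF True]] if_P[OF True])+
          then show ?thesis using b B(1) gK ka by (simp add: K.m_assoc)
        next
          case False
          then have "\<not> ?R (head T e) (head T a)" using step[OF aA] by blast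
          then have "B' (head T a) = B (head T a)" unfolding B'_def by (rule if_not_P)
          moreover have "B' (tail T a) = B (tail T a)" unfolding B'_def by (rule if_not_P[OF False])
          ultimately show ?thesis using b by simp
        qed
      qed
      moreover have "B' v \<in> carrier K" for v using gK B by (simp add: B'_def)
      ultimately show "\<exists>B. (\<forall>v. B v \<in> carrier K) \<and> (\<forall>e\<in>insert e A. B (head T e) = B (tail T e) \<otimes>\<^bsub>K\<^esub> k e)"
        by blast
    qed
  qed
  then show ?thesis using fin by blast
qed

text \<open>
  Along a path of parents an edge that is not on the path is not crossed, so its bipartition would
  not separate its two ends.
\<close>

lemma tree_if_walls:
  assumes conn: "\<And>v. v \<in> VT \<Longrightarrow> (r, v) \<in> {(u, v). (u, v) \<in> E \<or> (v, u) \<in> E}\<^sup>*"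
    and E: "\<And>u v. (u, v) \<in> E \<Longrightarrow> u \<in> VT \<and> v \<in> VT"
    and walls: "\<And>u v. (u, v) \<in> E \<Longrightarrow> \<exists>f :: 'x \<Rightarrow> bool. \<forall>a b. (a, b) \<in> E \<longrightarrow> (f a \<noteq> f b \<longleftrightarrow> a = u \<and> b = v)"
    and r: "r \<in> VT"
  shows "\<exists>p (d :: 'x \<Rightarrow> nat).
      (\<forall>v\<in>VT - {r}. p v \<in> VT \<and> d v = Suc (d (p v)) \<and> ((p v, v) \<in> E \<or> (v, p v) \<in> E)) \<and>
      (\<forall>(u, v)\<in>E. (v \<noteq> r \<and> u = p v) \<or> (u \<noteq> r \<and> v = p u))"
proof -
  define A where "A = {(u, v). (u, v) \<in> E \<or> (v, u) \<in> E}"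
  have A_iff: "(u, v) \<in> A \<longleftrightarrow> (u, v) \<in> E \<or> (v, u) \<in> E" for u v by (simp add: A_def)
  define d where "d v = (LEAST n. (r, v) \<in> A ^^ n)" for v
  have dA: "(r, v) \<in> A ^^ d v" if "v \<in> VT" for v
  proof -
    have "\<exists>n. (r, v) \<in> A ^^ n" using rtrancl_imp_relpow[OF conn[OF that, folded A_def]] .
    then show ?thesis unfolding d_def by (rule LeastI_ex)
  qed
  have "\<exists>u. u \<in> VT \<and> d v = Suc (d u) \<and> (u, v) \<in> A" if True: "v \<in> VT - {r}" for v
  proof -
    have v: "(r, v) \<in> A ^^ d v" "v \<noteq> r" using True dA by auto
    have "d v \<noteq> 0"
    proof
      assume "d v = 0"
      then have "(r, v) \<in> A ^^ 0" using v(1) by simp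
      then show False using v(2) by simp
    qed
    then obtain n where n: "d v = Suc n" by (cases "d v") simp_all
    obtain u where u: "(r, u) \<in> A ^^ n" "(u, v) \<in> A"
      using v(1) unfolding n by (rule relpow_Suc_E)
    have uV: "u \<in> VT" using u(2) E A_iff by blast
    have "d u \<le> n" unfolding d_def using u(1) by (rule Least_le)
    moreover have "(r, v) \<in> A ^^ Suc (d u)" using dA[OF uV] u(2) by (rule relpow_Suc_I)
    then have "d v \<le> Suc (d u)" unfolding d_def by (rule Least_le)
    ultimately have "d v = Suc (d u)" using n by simp
    then show ?thesis using u(2) uV by blast
  qed
  then have "\<forall>v\<in>VT - {r}. \<exists>u. u \<in> VT \<and> d v = Suc (d u) \<and> (u, v) \<in> A" by blast
  from bchoice[OF this] obtain p
    where p: "\<And>v. v \<in> VT - {r} \<Longrightarrow> p v \<in> VT \<and> d v = Suc (d (p v)) \<and> (p v, v) \<in> A" by blast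
  have "(v \<noteq> r \<and> u = p v) \<or> (u \<noteq> r \<and> v = p u)" if uv: "(u, v) \<in> E" for u v
  proof (rule ccontr)
    assume n: "\<not> ?thesis"
    from walls[OF uv] obtain f :: "'x \<Rightarrow> bool"
      where f: "\<forall>a b. (a, b) \<in> E \<longrightarrow> (f a \<noteq> f b \<longleftrightarrow> a = u \<and> b = v)" ..
    have const: "x \<in> VT \<Longrightarrow> f x = f r" for x
    proof (induction "d x" arbitrary: x rule: less_induct)
      case less
      show ?case
      proof (cases "x = r")
        case False
        then have px: "p x \<in> VT" "d (p x) < d x" "(p x, x) \<in> A" using p[of x] less.prems by simp_all
        have "f (p x) = f x"
        proof (rule ccontr)
          assume ne: "f (p x) \<noteq> f x"
          consider "(p x, x) \<in> E" | "(x, p x) \<in> E" using px(3) A_iff by blast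
          then show False
          proof cases
            case 1
            then have "p x = u \<and> x = v" using f ne by blast
            then show False using n False by blast
          next
            case 2
            then have "x = u \<and> p x = v" using f ne by metis
            then show False using n False by blast
          qed
        qed
        then show ?thesis using less.hyps px by blast
      qed simp
    qed
    have "f u \<noteq> f v" using f uv by blast
    then show False using const E[OF uv] by blast
  qed
  then show ?thesis using p A_iff by (intro exI[of _ p] exI[of _ d]) blast
qed

section \<open>Affine maps of the lattice\<close>

definition lin :: "(vec \<Rightarrow> vec) \<Rightarrow> bool" where
  "lin f \<longleftrightarrow> bij f \<and> (\<forall>a b. f (a + b) = f a + f b)"

lemma additive_scl:
  assumes "\<And>a b. f (a + b) = f a + (f b :: vec)"
  shows "f (scl k z) = scl k (f z)"
proof -
  have 0: "f 0 = 0" using assms[of 0 0] by simp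
  have neg: "f (- z) = - f z" for z
    using assms[of z "- z"] 0 by (simp add: eq_neg_iff_add_eq_0 add.commute)
  have nat: "f (scl (int n) z) = scl (int n) (f z)" for n
  proof (induction n)
    case (Suc n)
    have "scl (int (Suc n)) w = w + scl (int n) w" for w
      by (simp add: scl_def prod_eq_iff algebra_simps)
    then show ?case using Suc assms by simp
  qed (simp add: scl_def 0 flip: zero_prod_def)
  show ?thesis
  proof (cases "k \<ge> 0")
    case True
    then show ?thesis using nat[of "nat k"] by simp
  next
    case False
    have "scl k w = - scl (int (nat (- k))) w" for w using False by (simp add: scl_def prod_eq_iff)
    then show ?thesis by (simp only: nat neg)
  qed
qed

lemma int_additive_scl:
  assumes "\<And>a b. f (a + b) = f a + (f b :: vec)"
  shows "f (k :: int) = scl k (f 1)"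
proof -
  \<comment> \<open>Integers are read as first coordinates of vectors, so that
    \<open>additive_scl\<close> applies.\<close>
  have "f (fst (a + b)) = f (fst a) + f (fst b)" for a b :: vec using assms by simp
  then have "f (fst (scl k (1, 0))) = scl k (f (fst (1, 0 :: int)))"
    by (rule additive_scl)
  then show ?thesis by (simp add: scl_def)
qed

lemma lin_add: "lin f \<Longrightarrow> f (a + b) = f a + f b"
  unfolding lin_def by blast

lemma lin_scl: "lin f \<Longrightarrow> f (scl k z) = scl k (f z)"
  by (rule additive_scl) (rule lin_add)

lemma lin_zero: "lin f \<Longrightarrow> f 0 = 0"
  using lin_add[of f 0 0] by simp

lemma lin_minus: "lin f \<Longrightarrow> f (- z) = - f z"
  using lin_scl[of f "- 1" z] by (simp add: scl_minus_one)

lemma lin_diff: "lin f \<Longrightarrow> f (a - b) = f a - f b"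
  using lin_add[of f a "- b"] lin_minus[of f b] by simp

lemma lin_inv_f: "lin f \<Longrightarrow> inv_into UNIV f (f z) = z" "lin f \<Longrightarrow> f (inv_into UNIV f z) = z"
  by (simp_all add: lin_def bij_is_inj bij_is_surj surj_f_inv_f)

lemma lin_inv: "lin f \<Longrightarrow> lin (inv_into UNIV f)"
proof -
  assume f: "lin f"
  have "inv_into UNIV f (a + b) = inv_into UNIV f a + inv_into UNIV f b" for a b
  proof -
    have "f (inv_into UNIV f a + inv_into UNIV f b) = a + b" using f by (simp add: lin_add lin_inv_f)
    then show ?thesis using lin_inv_f(1)[OF f] by metis
  qed
  then show ?thesis using f bij_imp_bij_inv unfolding lin_def by blast
qed

lemma lin_comp: "lin f \<Longrightarrow> lin g \<Longrightarrow> lin (f \<circ> g)"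
  unfolding lin_def by (metis bij_comp comp_apply)

lemma lin_id: "lin id"
  by (simp add: lin_def)

lemma lin_primitive:
  assumes "lin f" "primitive z"
  shows "primitive (f z)"
  unfolding primitive_def
proof (intro allI impI)
  fix k w assume "f z = scl k w"
  then have "inv_into UNIV f (f z) = scl k (inv_into UNIV f w)" using lin_scl[OF lin_inv[OF assms(1)]] by metis
  then have "z = scl k (inv_into UNIV f w)" using lin_inv_f(1)[OF assms(1)] by simp
  then show "\<bar>k\<bar> = 1" using assms(2) by (auto simp only: primitive_def)
qed

lemma lin_line:
  assumes "lin f"
  shows "f z \<in> line (f y) \<longleftrightarrow> z \<in> line y"
proof
  assume "f z \<in> line (f y)"
  then obtain k where "f z = scl k (f y)" by (auto simp: line_def)
  then have "f z = f (scl k y)" using lin_scl[OF assms] by simp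
  then show "z \<in> line y" using assms lin_inv_f(1)[OF assms] unfolding line_def by (metis rangeI)
next
  assume "z \<in> line y"
  then obtain k where "z = scl k y" by (auto simp: line_def)
  then have "f z = scl k (f y)" using lin_scl[OF assms] by blast
  then show "f z \<in> line (f y)" unfolding line_def by blast
qed

lemma lin_det: "lin f \<Longrightarrow> primitive y \<Longrightarrow> det (f y) (f z) = 0 \<longleftrightarrow> z \<in> line y"
  by (simp add: det_eq_0_iff[OF lin_primitive] lin_line)

lemma mod_eq_scl_iff: "mod_eq m a b \<longleftrightarrow> (\<exists>c. a - b = scl m c)"
proof
  assume "mod_eq m a b"
  then obtain p q where "fst (a - b) = m * p" "snd (a - b) = m * q" by (auto simp: mod_eq_def elim!: dvdE)
  then have "a - b = scl m (p, q)" by (simp add: scl_def prod_eq_iff)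
  then show "\<exists>c. a - b = scl m c" by blast
next
  assume "\<exists>c. a - b = scl m c"
  then show "mod_eq m a b" unfolding mod_eq_def by (auto simp only: scl_def fst_conv snd_conv dvd_triv_left)
qed

lemma lin_mod_eq:
  assumes "lin f" "mod_eq m a b"
  shows "mod_eq m (f a) (f b)"
proof -
  obtain c where "a - b = scl m c" using assms(2) mod_eq_scl_iff by blast
  then have "f a - f b = scl m (f c)" using lin_diff[OF assms(1)] lin_scl[OF assms(1)] by metis
  then show ?thesis using mod_eq_scl_iff by blast
qed

text \<open>Bezout coefficients \<open>p\<close>, \<open>q\<close> complete \<open>y\<close> by
  \<open>(- q, p)\<close> to a basis of determinant 1, so every primitive vector is the image of the
  first unit vector.\<close>

lemma primitive_transport:
  assumes "primitive y" "primitive z"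
  obtains f where "lin f" "f y = z"
proof -
  have ex: "\<exists>f. lin f \<and> f (1, 0) = y" if "primitive y" for y
  proof -
    have "coprime (fst y) (snd y)" using that primitive_iff_coprime by blast
    then obtain p q where pq: "p * fst y + q * snd y = 1"
      using bezout_int[of "fst y" "snd y"] by auto
    define f where "f a = (fst a * fst y - snd a * q, fst a * snd y + snd a * p)" for a :: vec
    define g where "g a = (p * fst a + q * snd a, fst y * snd a - snd y * fst a)" for a :: vec
    have gf: "g (f a) = a" for a
    proof (rule prod_eqI)
      show "fst (g (f a)) = fst a" unfolding f_def g_def fst_conv snd_conv using pq by algebra
      show "snd (g (f a)) = snd a" unfolding f_def g_def fst_conv snd_conv using pq by algebra
    qed
    have fg: "f (g a) = a" for a
    proof (rule prod_eqI)
      show "fst (f (g a)) = fst a" unfolding f_def g_def fst_conv snd_conv using pq by algebra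
      show "snd (f (g a)) = snd a" unfolding f_def g_def fst_conv snd_conv using pq by algebra
    qed
    have "bij f" by (rule o_bij[of g]) (use gf fg in auto)
    moreover have "f (a + b) = f a + f b" for a b by (simp add: f_def algebra_simps)
    moreover have "f (1, 0) = y" by (simp add: f_def)
    ultimately show ?thesis unfolding lin_def by blast
  qed
  obtain f g where fg: "lin f" "f (1, 0) = y" "lin g" "g (1, 0) = z" using ex assms by blast
  have "(g \<circ> inv_into UNIV f) y = z" using lin_inv_f(1)[OF fg(1), of "(1, 0)"] fg by simp
  then show thesis using that lin_comp[OF fg(3) lin_inv[OF fg(1)]] by blast
qed

definition lin_group :: "(vec \<Rightarrow> vec) monoid" where
  "lin_group = \<lparr>carrier = {f. lin f}, monoid.mult = (\<circ>), one = id\<rparr>"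

lemma group_lin_group: "group lin_group"
proof (rule groupI)
  fix f assume "f \<in> carrier lin_group"
  then have "inv_into UNIV f \<in> carrier lin_group" "inv_into UNIV f \<circ> f = id"
    using lin_inv lin_inv_f(1) by (auto simp: lin_group_def)
  then show "\<exists>g\<in>carrier lin_group. g \<otimes>\<^bsub>lin_group\<^esub> f = \<one>\<^bsub>lin_group\<^esub>" by (auto simp: lin_group_def)
qed (auto simp: lin_group_def lin_comp lin_id comp_assoc)

section \<open>Tubular groups\<close>

text \<open>A generator of the image equals the image of \<open>c 1\<close> up to sign, and
  maximality forbids that it is a proper multiple. The last conclusion makes \<open>c\<close>
  independent of the inclusion, so that both ends of an edge are measured with the same generator of
  the edge group.\<close>

lemma maximal_inclusion_primitive:
  assumes V: "group V" and \<alpha>: "\<alpha> \<in> iso V (integer_group \<times>\<times> integer_group)"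
    and F: "group F" and \<beta>: "\<beta> \<in> iso F integer_group"
    and \<phi>: "\<phi> \<in> mon F V" and max: "maximal_inclusion F V \<phi>"
  obtains c where "\<And>k :: int. c k \<in> carrier F" "\<And>x. x \<in> carrier F \<Longrightarrow> \<exists>k. x = c k" "primitive (\<alpha> (\<phi> (c 1)))"
    "\<And>k. \<alpha> (\<phi> (c k)) = scl k (\<alpha> (\<phi> (c 1)))" "c = inv_into (carrier F) \<beta>"
proof -
  interpret V: group V by fact
  interpret F: group F by fact
  define c where "c = inv_into (carrier F) \<beta>"
  have \<beta>b: "bij_betw \<beta> (carrier F) UNIV" and \<beta>m: "\<And>x y. x \<in> carrier F \<Longrightarrow> y \<in> carrier F \<Longrightarrow> \<beta> (x \<otimes>\<^bsub>F\<^esub> y) = \<beta> x + \<beta> y"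
    using \<beta> by (auto simp: iso_def hom_def)
  have cF: "c k \<in> carrier F" and \<beta>c: "\<beta> (c k) = k" for k
    using \<beta>b unfolding c_def bij_betw_def by (simp_all add: inv_into_into f_inv_into_f)
  have c\<beta>: "c (\<beta> x) = x" if "x \<in> carrier F" for x
    using \<beta>b that unfolding c_def bij_betw_def by simp
  have c_add: "c (j + k) = c j \<otimes>\<^bsub>F\<^esub> c k" for j k
    using c\<beta>[of "c j \<otimes>\<^bsub>F\<^esub> c k"] \<beta>m cF \<beta>c by simp
  have \<alpha>b: "inj_on \<alpha> (carrier V)" "\<alpha> ` carrier V = UNIV"
    and \<alpha>m: "\<And>x y. x \<in> carrier V \<Longrightarrow> y \<in> carrier V \<Longrightarrow> \<alpha> (x \<otimes>\<^bsub>V\<^esub> y) = \<alpha> x + \<alpha> y"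
    using \<alpha> by (auto simp: iso_def hom_def bij_betw_def mult_DirProd' plus_prod_def)
  have \<phi>c: "\<And>x. x \<in> carrier F \<Longrightarrow> \<phi> x \<in> carrier V" and \<phi>i: "inj_on \<phi> (carrier F)"
    and \<phi>m: "\<And>x y. x \<in> carrier F \<Longrightarrow> y \<in> carrier F \<Longrightarrow> \<phi> (x \<otimes>\<^bsub>F\<^esub> y) = \<phi> x \<otimes>\<^bsub>V\<^esub> \<phi> y"
    using \<phi> by (auto simp: mon_def hom_def)
  let ?y = "\<alpha> (\<phi> (c 1))"
  have y: "\<alpha> (\<phi> (c k)) = scl k ?y" for k
    by (rule int_additive_scl) (simp add: c_add \<phi>m cF \<alpha>m \<phi>c)
  have \<alpha>1: "\<alpha> \<one>\<^bsub>V\<^esub> = 0" using \<alpha>m[of "\<one>\<^bsub>V\<^esub>" "\<one>\<^bsub>V\<^esub>"] by simp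
  have \<alpha>_inv: "\<alpha> (inv\<^bsub>V\<^esub> g) = - \<alpha> g" if "g \<in> carrier V" for g
    using \<alpha>m[OF that V.inv_closed[OF that]] that \<alpha>1 by (simp add: eq_neg_iff_add_eq_0 add.commute)
  have \<alpha>_pow: "\<alpha> (g [^]\<^bsub>V\<^esub> (n::nat)) = scl (int n) (\<alpha> g)" if "g \<in> carrier V" for g n
  proof (induction n)
    case (Suc n)
    then show ?case using that \<alpha>m by (simp add: scl_def prod_eq_iff algebra_simps)
  qed (simp add: \<alpha>1 scl_def zero_prod_def)
  obtain x where x: "x \<in> carrier V" "\<phi> ` carrier F = generate V {x}"
    and nx: "\<And>g n. g \<in> carrier V \<Longrightarrow> g \<noteq> \<one>\<^bsub>V\<^esub> \<Longrightarrow> (n::nat) > 1 \<Longrightarrow> x \<noteq> g [^]\<^bsub>V\<^esub> n"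
    using max unfolding maximal_inclusion_def by blast
  have gen: "\<alpha> g \<in> line (\<alpha> x)" if "g \<in> generate V {x}" for g
    using that
  proof (induction rule: generate.induct)
    case one
    have "\<alpha> \<one>\<^bsub>V\<^esub> = scl 0 (\<alpha> x)" by (simp add: \<alpha>1 scl_def zero_prod_def)
    then show ?case unfolding line_def by blast
  next
    case (incl h)
    then have "\<alpha> h = scl 1 (\<alpha> x)" by (simp add: scl_def)
    then show ?case unfolding line_def by blast
  next
    case (inv h)
    then have "\<alpha> (inv\<^bsub>V\<^esub> h) = scl (- 1) (\<alpha> x)" using \<alpha>_inv x(1) by (simp add: scl_minus_one)
    then show ?case unfolding line_def by blast
  next
    case (eng g h)
    have sub: "generate V {x} \<subseteq> carrier V" using V.generate_incl[of "{x}"] x(1) by simp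
    obtain j k where "\<alpha> g = scl j (\<alpha> x)" "\<alpha> h = scl k (\<alpha> x)" using eng.IH by (auto simp: line_def)
    moreover have "\<alpha> (g \<otimes>\<^bsub>V\<^esub> h) = \<alpha> g + \<alpha> h" using eng.hyps sub \<alpha>m by blast
    ultimately have "\<alpha> (g \<otimes>\<^bsub>V\<^esub> h) = scl (j + k) (\<alpha> x)"
      by (simp add: scl_def prod_eq_iff algebra_simps)
    then show ?case unfolding line_def by blast
  qed
  have "\<phi> (c 1) \<in> generate V {x}" using x(2) cF by blast
  then obtain k where k: "?y = scl k (\<alpha> x)" using gen by (auto simp: line_def)
  have "x \<in> \<phi> ` carrier F" using x(2) by (simp add: generate.incl)
  then obtain j where j: "\<alpha> x = scl j ?y" using c\<beta> y by (metis imageE)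
  have y0: "?y \<noteq> 0"
  proof
    assume "?y = 0"
    then have "\<phi> (c 1) = \<phi> (c 0)"
      using y[of 0] \<alpha>b(1) \<phi>c[OF cF] by (metis inj_onD scl_def mult_zero_left zero_prod_def)
    then have "c 1 = c 0" using \<phi>i cF by (meson inj_onD)
    then show False using \<beta>c[of 1] \<beta>c[of 0] by simp
  qed
  have "?y = scl k (scl j ?y)" using j k by metis
  then have "fst ?y = (k * j) * fst ?y" "snd ?y = (k * j) * snd ?y"
    unfolding scl_def by (metis fst_conv snd_conv mult.assoc)+
  \<comment> \<open>\<open>?y\<close> and the vector of \<open>x\<close> are multiples of each
    other, and \<open>?y\<close> is not zero.\<close>
  then have kj: "k * j = 1" using y0 unfolding zero_prod_def prod_eq_iff by (metis fst_conv snd_conv mult_cancel_right1)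
  have xy: "\<alpha> x = ?y \<or> \<alpha> x = - ?y"
    using kj j by (auto simp: zmult_eq_1_iff scl_def prod_eq_iff)
  have x1: "x \<noteq> \<one>\<^bsub>V\<^esub>" using xy y0 \<alpha>1 by auto
  have prim: "primitive (\<alpha> x)"
    unfolding primitive_def
  proof (intro allI impI)
    fix n z assume n: "\<alpha> x = scl n z"
    show "\<bar>n\<bar> = 1"
    proof (rule ccontr)
      assume n1: "\<bar>n\<bar> \<noteq> 1"
      \<comment> \<open>Maximality speaks of natural exponents, so the sign of the factor is moved
        into the vector.\<close>
      define z' where "z' = scl (sgn n) z"
      define N where "N = nat \<bar>n\<bar>"
      have N: "int N = \<bar>n\<bar>" by (simp add: N_def)
      have xz: "\<alpha> x = scl (int N) z'" using n unfolding N by (simp add: z'_def scl_def mult_sgn_abs mult.assoc[symmetric] abs_mult_sgn)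
      have "z' \<in> \<alpha> ` carrier V" using \<alpha>b by simp
      then obtain g where g: "g \<in> carrier V" "\<alpha> g = z'" by blast
      have "\<alpha> (g [^]\<^bsub>V\<^esub> N) = \<alpha> x" using \<alpha>_pow[OF g(1)] g xz by simp
      then have xg: "x = g [^]\<^bsub>V\<^esub> N" using \<alpha>b(1) x(1) g(1) by (metis V.nat_pow_closed inj_onD)
      have "N \<noteq> 0" using xg x1 by (metis V.nat_pow_0)
      then have "N > 1" using n1 N by linarith
      moreover have "g \<noteq> \<one>\<^bsub>V\<^esub>" using xg x1 by auto
      ultimately show False using nx g(1) xg by blast
    qed
  qed
  then have "primitive ?y"
    using xy primitive_iff_coprime by auto
  then show thesis using that[of c] cF c\<beta> y c_def by metis
qed

locale tubular =
  fixes \<G> :: "('v, 'e, 'g, 'h) pre_graph_of_groups" and T :: "('v, 'e) pre_digraph"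
  assumes gog: "graph_of_groups \<G>"
    and fin: "fin_digraph (base_graph \<G>)"
    and iso_v: "v \<in> verts (base_graph \<G>) \<Longrightarrow> vgroup \<G> v \<cong> integer_group \<times>\<times> integer_group"
    and iso_e: "e \<in> arcs (base_graph \<G>) \<Longrightarrow> egroup \<G> e \<cong> integer_group"
    and max_t: "e \<in> arcs (base_graph \<G>) \<Longrightarrow>
      maximal_inclusion (egroup \<G> e) (vgroup \<G> (tail (base_graph \<G>) e)) (tail_incl \<G> e)"
    and max_h: "e \<in> arcs (base_graph \<G>) \<Longrightarrow>
      maximal_inclusion (egroup \<G> e) (vgroup \<G> (head (base_graph \<G>) e)) (head_incl \<G> e)"
    and tree: "undirected_spanning_tree T (base_graph \<G>)"
begin

abbreviation "W \<equiv> verts (base_graph \<G>)"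
abbreviation "A \<equiv> arcs (base_graph \<G>)"
abbreviation "tl' \<equiv> tail (base_graph \<G>)"
abbreviation "hd' \<equiv> head (base_graph \<G>)"
abbreviation "ti \<equiv> tail_incl \<G>"
abbreviation "hi \<equiv> head_incl \<G>"
abbreviation "V \<equiv> vgroup \<G>"
abbreviation "F \<equiv> egroup \<G>"
abbreviation "FG \<equiv> fundamental_group \<G> T"
abbreviation "gens \<equiv> fg_generators \<G>"
abbreviation "rels \<equiv> fg_relations \<G> T"

lemma ends: "e \<in> A \<Longrightarrow> tl' e \<in> W" "e \<in> A \<Longrightarrow> hd' e \<in> W"
  using gog wf_digraph.tail_in_verts wf_digraph.head_in_verts by (auto simp: graph_of_groups_def)

lemma group_V: "v \<in> W \<Longrightarrow> group (V v)"
  using gog by (simp add: graph_of_groups_def)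

lemma group_F: "e \<in> A \<Longrightarrow> group (F e)"
  using gog by (simp add: graph_of_groups_def)

lemma ti_mon: "e \<in> A \<Longrightarrow> ti e \<in> mon (F e) (V (tl' e))"
  using gog by (simp add: graph_of_groups_def)

lemma hi_mon: "e \<in> A \<Longrightarrow> hi e \<in> mon (F e) (V (hd' e))"
  using gog by (simp add: graph_of_groups_def)

lemma ti_closed: "e \<in> A \<Longrightarrow> c \<in> carrier (F e) \<Longrightarrow> ti e c \<in> carrier (V (tl' e))"
  using ti_mon by (auto simp: mon_def hom_def)

lemma hi_closed: "e \<in> A \<Longrightarrow> c \<in> carrier (F e) \<Longrightarrow> hi e c \<in> carrier (V (hd' e))"
  using hi_mon by (auto simp: mon_def hom_def)

lemma T_props: "wf_digraph T" "verts T = W" "arcs T \<subseteq> A" "tail T = tl'" "head T = hd'"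
  "connected T" "\<nexists>p. circuit T p" "finite (arcs T)" "finite A"
proof -
  have "spanning T (base_graph \<G>)" "connected T" "\<nexists>p. circuit T p"
    using tree by (auto simp: undirected_spanning_tree_def)
  then show "wf_digraph T" "verts T = W" "arcs T \<subseteq> A" "tail T = tl'" "head T = hd'" "connected T" "\<nexists>p. circuit T p"
    by (auto simp: spanning_def subgraph_def compatible_def)
  show "finite A" using fin fin_digraph.finite_arcs by blast
  then show "finite (arcs T)" using \<open>arcs T \<subseteq> A\<close> finite_subset by blast
qed

sublocale FG: group FG
  by (simp add: fundamental_group_def group_presented_group)

definition vt :: "'v \<Rightarrow> 'g \<Rightarrow> ('v, 'e, 'g) generator word set" where
  "vt v g = word_cong gens rels `` {[(Vertex v g, True)]}"

definition st :: "'e \<Rightarrow> ('v, 'e, 'g) generator word set" where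
  "st e = word_cong gens rels `` {[(Stable e, True)]}"

lemma gens_I: "v \<in> W \<Longrightarrow> g \<in> carrier (V v) \<Longrightarrow> Vertex v g \<in> gens" "e \<in> A \<Longrightarrow> Stable e \<in> gens"
  by (auto simp: fg_generators_def)

lemma vt_closed: "v \<in> W \<Longrightarrow> g \<in> carrier (V v) \<Longrightarrow> vt v g \<in> carrier FG"
  unfolding vt_def fundamental_group_def using gens_I by (intro presented_group_carrierI) simp

lemma st_closed: "e \<in> A \<Longrightarrow> st e \<in> carrier FG"
  unfolding st_def fundamental_group_def using gens_I by (intro presented_group_carrierI) simp

lemma vt_mult:
  assumes v: "v \<in> W" and g: "g \<in> carrier (V v)" "h \<in> carrier (V v)"
  shows "vt v (g \<otimes>\<^bsub>V v\<^esub> h) = vt v g \<otimes>\<^bsub>FG\<^esub> vt v h"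
proof -
  interpret group "V v" using group_V v .
  let ?l = "[(Vertex v g, True), (Vertex v h, True)]" and ?r = "[(Vertex v (g \<otimes>\<^bsub>V v\<^esub> h), True)]"
  have "([] @ ?l @ [], [] @ ?r @ []) \<in> word_cong gens rels"
    using assms gens_I by (intro word_cong.rel) (auto simp: fg_relations_def)
  then have "word_cong gens rels `` {?l} = vt v (g \<otimes>\<^bsub>V v\<^esub> h)"
    unfolding vt_def by (intro equiv_class_eq[OF equiv_word_cong]) simp
  moreover have "vt v g \<otimes>\<^bsub>FG\<^esub> vt v h = word_cong gens rels `` {[(Vertex v g, True)] @ [(Vertex v h, True)]}"
    unfolding vt_def fundamental_group_def using assms gens_I by (intro presented_group_mult) auto
  ultimately show ?thesis by simp
qed

lemma st_vt:
  assumes e: "e \<in> A" and c: "c \<in> carrier (F e)"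
  shows "st e \<otimes>\<^bsub>FG\<^esub> vt (hd' e) (hi e c) = vt (tl' e) (ti e c) \<otimes>\<^bsub>FG\<^esub> st e"
proof -
  let ?s = "(Stable e :: ('v, 'e, 'g) generator, True)" and ?s' = "(Stable e :: ('v, 'e, 'g) generator, False)"
  let ?v = "(Vertex (hd' e) (hi e c) :: ('v, 'e, 'g) generator, True)" and ?u = "(Vertex (tl' e) (ti e c) :: ('v, 'e, 'g) generator, True)"
  note g = gens_I(1)[OF ends(1)[OF e] ti_closed[OF e c]] gens_I(1)[OF ends(2)[OF e] hi_closed[OF e c]] gens_I(2)[OF e]
  have "([] @ [?s, ?v, ?s'] @ [?s], [] @ [?u] @ [?s]) \<in> word_cong gens rels"
    using e c g by (intro word_cong.rel) (auto simp: fg_relations_def)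
  moreover have "([?s, ?v] @ [(Stable e, False), (Stable e, \<not> False)] @ [], [?s, ?v] @ []) \<in> word_cong gens rels"
    using g by (intro word_cong.cancel) auto
  ultimately have "([?s, ?v], [?u, ?s]) \<in> word_cong gens rels"
    using word_cong.trans word_cong.sym by fastforce
  then have "word_cong gens rels `` {[?s] @ [?v]} = word_cong gens rels `` {[?u] @ [?s]}"
    by (intro equiv_class_eq[OF equiv_word_cong]) simp
  then show ?thesis
    unfolding vt_def st_def fundamental_group_def using g by (simp add: presented_group_mult del: append.simps)
qed

lemma st_T: "e \<in> arcs T \<Longrightarrow> st e = \<one>\<^bsub>FG\<^esub>"
proof -
  assume e: "e \<in> arcs T"
  then have "e \<in> A" using T_props by blast
  then have "([] @ [(Stable e, True)] @ [], [] @ [] @ []) \<in> word_cong gens rels"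
    using e gens_I by (intro word_cong.rel) (auto simp: fg_relations_def)
  then show ?thesis
    unfolding st_def fundamental_group_def presented_group_one
    by (intro equiv_class_eq[OF equiv_word_cong]) simp
qed

lemma FG_generated:
  assumes J: "subgroup J FG" and v: "\<And>v g. v \<in> W \<Longrightarrow> g \<in> carrier (V v) \<Longrightarrow> vt v g \<in> J"
    and e: "\<And>e. e \<in> A \<Longrightarrow> st e \<in> J"
  shows "J = carrier FG"
  unfolding fundamental_group_def
proof (rule presented_group_generated[OF J[unfolded fundamental_group_def]])
  fix x assume "x \<in> gens"
  then show "word_cong gens rels `` {[(x, True)]} \<in> J"
    using v e unfolding fg_generators_def vt_def st_def by blast
qed

text \<open>The universal property, with the relation of a stable letter in a form free of inverses,
  which is easier to check for maps.\<close>

lemma FG_hom: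
  assumes K: "group K" and FV: "\<And>v g. v \<in> W \<Longrightarrow> g \<in> carrier (V v) \<Longrightarrow> FV v g \<in> carrier K"
    and FV_mult: "\<And>v g h. v \<in> W \<Longrightarrow> g \<in> carrier (V v) \<Longrightarrow> h \<in> carrier (V v) \<Longrightarrow> FV v (g \<otimes>\<^bsub>V v\<^esub> h) = FV v g \<otimes>\<^bsub>K\<^esub> FV v h"
    and FS: "\<And>e. e \<in> A \<Longrightarrow> FS e \<in> carrier K"
    and FS_FV: "\<And>e c. e \<in> A \<Longrightarrow> c \<in> carrier (F e) \<Longrightarrow>
      FS e \<otimes>\<^bsub>K\<^esub> FV (hd' e) (hi e c) = FV (tl' e) (ti e c) \<otimes>\<^bsub>K\<^esub> FS e"
    and FS_T: "\<And>e. e \<in> arcs T \<Longrightarrow> FS e = \<one>\<^bsub>K\<^esub>"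
  obtains h where "h \<in> hom FG K" "\<And>v g. v \<in> W \<Longrightarrow> g \<in> carrier (V v) \<Longrightarrow> h (vt v g) = FV v g"
    "\<And>e. e \<in> A \<Longrightarrow> h (st e) = FS e"
proof -
  interpret K: group K by fact
  let ?f = "\<lambda>x. case x of Vertex v g \<Rightarrow> FV v g | Stable e \<Rightarrow> FS e"
  have f: "?f \<in> gens \<rightarrow> carrier K" using FV FS by (auto simp: fg_generators_def)
  obtain h where h: "h \<in> hom FG K" "\<And>w. w \<in> words gens \<Longrightarrow> h (word_cong gens rels `` {w}) = eval_word K ?f w"
    unfolding fundamental_group_def
  proof (rule presented_group_hom[OF K f, of rels])
    fix l r assume "(l, r) \<in> rels"
    then consider (V) v g h where "v \<in> W" "g \<in> carrier (V v)" "h \<in> carrier (V v)"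
        "l = [(Vertex v g, True), (Vertex v h, True)]" "r = [(Vertex v (g \<otimes>\<^bsub>V v\<^esub> h), True)]"
      | (E) e c where "e \<in> A" "c \<in> carrier (F e)"
        "l = [(Stable e, True), (Vertex (hd' e) (hi e c), True), (Stable e, False)]" "r = [(Vertex (tl' e) (ti e c), True)]"
      | (T) e where "e \<in> arcs T" "l = [(Stable e, True)]" "r = []"
      unfolding fg_relations_def by blast
    then show "eval_word K ?f l = eval_word K ?f r"
    proof cases
      case V
      then show ?thesis using FV FV_mult group_V[OF V(1)] by (simp add: eval_word_def)
    next
      case E
      note cl = FS[OF E(1)] FV[OF ends(2)[OF E(1)] hi_closed[OF E(1,2)]] FV[OF ends(1)[OF E(1)] ti_closed[OF E(1,2)]]
      have "FS e \<otimes>\<^bsub>K\<^esub> (FV (hd' e) (hi e c) \<otimes>\<^bsub>K\<^esub> inv\<^bsub>K\<^esub> FS e) = FV (tl' e) (ti e c) \<otimes>\<^bsub>K\<^esub> FS e \<otimes>\<^bsub>K\<^esub> inv\<^bsub>K\<^esub> FS e"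
        using cl FS_FV[OF E(1,2)] by (simp flip: K.m_assoc)
      then show ?thesis using cl E(3,4) by (simp add: eval_word_def K.m_assoc)
    next
      case T
      then show ?thesis using FS_T by (simp add: eval_word_def)
    qed
  qed blast
  show thesis
  proof (rule that[OF h(1)])
    fix v g assume v: "v \<in> W" "g \<in> carrier (V v)"
    then show "h (vt v g) = FV v g"
      using h(2)[of "[(Vertex v g, True)]"] gens_I FV[OF v] by (simp add: vt_def eval_word_def)
  next
    fix e assume e: "e \<in> A"
    then show "h (st e) = FS e"
      using h(2)[of "[(Stable e, True)]"] gens_I FS[OF e] by (simp add: st_def eval_word_def)
  qed
qed

end

subsection \<open>The affine representation\<close>

context tubular
begin

text \<open>
  Each edge group is generated by a primitive vector on either side, so a linear automorphism of
  \<open>\<int>\<^sup>2\<close> matches the two inclusions. This represents the group by affine maps of \<open>\<int>\<^sup>2\<close>, in which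
  the vertex groups act faithfully by translations.
\<close>

definition \<alpha> :: "'v \<Rightarrow> 'g \<Rightarrow> vec" where
  "\<alpha> v = (SOME f. f \<in> iso (V v) (integer_group \<times>\<times> integer_group))"

definition cc :: "'e \<Rightarrow> int \<Rightarrow> 'h" where
  "cc e = inv_into (carrier (F e)) (SOME f. f \<in> iso (F e) integer_group)"

definition yt :: "'e \<Rightarrow> vec" where "yt e = \<alpha> (tl' e) (ti e (cc e 1))"
definition yh :: "'e \<Rightarrow> vec" where "yh e = \<alpha> (hd' e) (hi e (cc e 1))"

lemma \<alpha>_iso: "v \<in> W \<Longrightarrow> \<alpha> v \<in> iso (V v) (integer_group \<times>\<times> integer_group)"
  unfolding \<alpha>_def using iso_v[of v] by (simp add: is_iso_def some_in_eq)

lemma \<alpha>_mult: "v \<in> W \<Longrightarrow> x \<in> carrier (V v) \<Longrightarrow> z \<in> carrier (V v) \<Longrightarrow> \<alpha> v (x \<otimes>\<^bsub>V v\<^esub> z) = \<alpha> v x + \<alpha> v z"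
  using \<alpha>_iso[of v] by (auto simp: iso_def hom_def mult_DirProd' plus_prod_def)

lemma \<alpha>_inj: "v \<in> W \<Longrightarrow> x \<in> carrier (V v) \<Longrightarrow> z \<in> carrier (V v) \<Longrightarrow> \<alpha> v x = \<alpha> v z \<Longrightarrow> x = z"
  using \<alpha>_iso[of v] by (auto simp: iso_def bij_betw_def dest: inj_onD)

lemma \<alpha>_one: "v \<in> W \<Longrightarrow> \<alpha> v \<one>\<^bsub>V v\<^esub> = 0"
proof -
  assume v: "v \<in> W"
  interpret group "V v" using group_V v .
  show ?thesis using \<alpha>_mult[OF v, of "\<one>\<^bsub>V v\<^esub>" "\<one>\<^bsub>V v\<^esub>"] by simp
qed

lemma edge_facts:
  assumes e: "e \<in> A"
  shows cc_closed: "cc e k \<in> carrier (F e)" and cc_surj: "c \<in> carrier (F e) \<Longrightarrow> \<exists>k. c = cc e k"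
    and yt_primitive: "primitive (yt e)" and yh_primitive: "primitive (yh e)"
    and \<alpha>_ti: "\<alpha> (tl' e) (ti e (cc e k)) = scl k (yt e)" and \<alpha>_hi: "\<alpha> (hd' e) (hi e (cc e k)) = scl k (yh e)"
proof -
  let ?\<beta> = "SOME f. f \<in> iso (F e) integer_group"
  have \<beta>: "?\<beta> \<in> iso (F e) integer_group" using iso_e[OF e] by (simp add: is_iso_def some_in_eq)
  have t: "(\<forall>k. cc e k \<in> carrier (F e)) \<and> (\<forall>x\<in>carrier (F e). \<exists>k. x = cc e k) \<and> primitive (yt e) \<and>
    (\<forall>k. \<alpha> (tl' e) (ti e (cc e k)) = scl k (yt e))"
  proof (rule maximal_inclusion_primitive[OF group_V[OF ends(1)[OF e]] \<alpha>_iso[OF ends(1)[OF e]] group_F[OF e] \<beta> ti_mon[OF e] max_t[OF e]])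
    fix c assume a: "\<And>k. c k \<in> carrier (F e)" "\<And>x. x \<in> carrier (F e) \<Longrightarrow> \<exists>k. x = c k"
      "primitive (\<alpha> (tl' e) (ti e (c 1)))" "\<And>k. \<alpha> (tl' e) (ti e (c k)) = scl k (\<alpha> (tl' e) (ti e (c 1)))"
      "c = inv_into (carrier (F e)) ?\<beta>"
    have "c = cc e" using a(5) unfolding cc_def .
    then show ?thesis using a(1-4) unfolding yt_def by blast
  qed
  have h: "primitive (yh e) \<and> (\<forall>k. \<alpha> (hd' e) (hi e (cc e k)) = scl k (yh e))"
  proof (rule maximal_inclusion_primitive[OF group_V[OF ends(2)[OF e]] \<alpha>_iso[OF ends(2)[OF e]] group_F[OF e] \<beta> hi_mon[OF e] max_h[OF e]])
    fix c assume a: "primitive (\<alpha> (hd' e) (hi e (c 1)))" "\<And>k. \<alpha> (hd' e) (hi e (c k)) = scl k (\<alpha> (hd' e) (hi e (c 1)))"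
      "c = inv_into (carrier (F e)) ?\<beta>"
    have "c = cc e" using a(3) unfolding cc_def .
    then show ?thesis using a(1,2) unfolding yh_def by blast
  qed
  show "cc e k \<in> carrier (F e)" "c \<in> carrier (F e) \<Longrightarrow> \<exists>k. c = cc e k" "primitive (yt e)"
    "\<alpha> (tl' e) (ti e (cc e k)) = scl k (yt e)"
    using t by blast+
  show "primitive (yh e)" "\<alpha> (hd' e) (hi e (cc e k)) = scl k (yh e)" using h by blast+
qed

definition P :: "'e \<Rightarrow> vec \<Rightarrow> vec" where
  "P e = (SOME f. lin f \<and> f (yh e) = yt e)"

lemma P: "e \<in> A \<Longrightarrow> lin (P e)" "e \<in> A \<Longrightarrow> P e (yh e) = yt e"
proof -
  have "lin (P e) \<and> P e (yh e) = yt e" if e: "e \<in> A"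
  proof -
    obtain f where "lin f" "f (yh e) = yt e"
      by (rule primitive_transport[OF yh_primitive[OF e] yt_primitive[OF e]])
    then have "\<exists>f. lin f \<and> f (yh e) = yt e" by (intro exI[of _ f] conjI)
    then show ?thesis unfolding P_def by (rule someI_ex)
  qed
  then show "e \<in> A \<Longrightarrow> lin (P e)" "e \<in> A \<Longrightarrow> P e (yh e) = yt e" by simp_all
qed

text \<open>Coordinate changes at the vertices, chosen along \<open>T\<close> so that the matching
  maps \<open>P e\<close> become the identity for edges of \<open>T\<close>, as the relations of
  their stable letters demand.\<close>

definition B :: "'v \<Rightarrow> vec \<Rightarrow> vec" where
  "B = (SOME B. (\<forall>v. lin (B v)) \<and> (\<forall>e\<in>arcs T. B (hd' e) = B (tl' e) \<circ> P e))"

lemma B: "lin (B v)" "e \<in> arcs T \<Longrightarrow> B (hd' e) = B (tl' e) \<circ> P e"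
proof -
  have "\<exists>B. (\<forall>v. B v \<in> carrier lin_group) \<and> (\<forall>e\<in>arcs T. B (head T e) = B (tail T e) \<otimes>\<^bsub>lin_group\<^esub> P e)"
  proof (rule tree_potential[OF T_props(1,8,7) group_lin_group])
    fix e assume "e \<in> arcs T"
    then have "e \<in> A" using T_props(3) by blast
    then show "P e \<in> carrier lin_group" using P(1) by (simp add: lin_group_def)
  qed
  then have "\<exists>B. (\<forall>v. lin (B v)) \<and> (\<forall>e\<in>arcs T. B (hd' e) = B (tl' e) \<circ> P e)"
    unfolding T_props(4,5) lin_group_def by simp
  then have "(\<forall>v. lin (B v)) \<and> (\<forall>e\<in>arcs T. B (hd' e) = B (tl' e) \<circ> P e)"
    unfolding B_def by (rule someI_ex)
  note B = this
  show "lin (B v)" using B[THEN conjunct1] by (rule spec)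
  show "e \<in> arcs T \<Longrightarrow> B (hd' e) = B (tl' e) \<circ> P e" using B[THEN conjunct2] by (rule bspec)
qed

text \<open>The matching map \<open>P e\<close> expressed in the coordinates \<open>B\<close>; it is
  how the stable letter acts.\<close>

definition Q :: "'e \<Rightarrow> vec \<Rightarrow> vec" where
  "Q e = B (tl' e) \<circ> P e \<circ> inv_into UNIV (B (hd' e))"

lemma Q_lin: "e \<in> A \<Longrightarrow> lin (Q e)"
  unfolding Q_def by (intro lin_comp lin_inv P(1) B(1))

lemma Q_B: "Q e (B (hd' e) z) = B (tl' e) (P e z)"
  unfolding Q_def comp_apply lin_inv_f(1)[OF B(1)] ..

definition affine_rep :: "(('v, 'e, 'g) generator word set \<Rightarrow> vec \<Rightarrow> vec) \<Rightarrow> bool" where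
  "affine_rep \<rho> \<longleftrightarrow> \<rho> \<in> hom FG perms \<and> (\<forall>v\<in>W. \<forall>g\<in>carrier (V v). \<rho> (vt v g) = (\<lambda>z. z + B v (\<alpha> v g))) \<and>
    (\<forall>e\<in>A. \<rho> (st e) = Q e)"

definition "\<rho> = (SOME \<rho>. affine_rep \<rho>)"

lemma affine_rep: "affine_rep \<rho>"
proof -
  have bij: "bij (\<lambda>z. z + w)" for w :: vec
    by (rule bijI') (simp_all only: add_right_cancel, metis diff_add_cancel)
  obtain h where h: "h \<in> hom FG perms" "\<And>v g. v \<in> W \<Longrightarrow> g \<in> carrier (V v) \<Longrightarrow> h (vt v g) = (\<lambda>z. z + B v (\<alpha> v g))"
    "\<And>e. e \<in> A \<Longrightarrow> h (st e) = Q e"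
  proof (rule FG_hom[OF group_perms, of "\<lambda>v g z. z + B v (\<alpha> v g)" Q])
    fix v g assume "v \<in> W" "g \<in> carrier (V v)"
    show "(\<lambda>z. z + B v (\<alpha> v g)) \<in> carrier perms" unfolding perms_simps using bij by blast
  next
    fix v g h assume "v \<in> W" "g \<in> carrier (V v)" "h \<in> carrier (V v)"
    then show "(\<lambda>z. z + B v (\<alpha> v (g \<otimes>\<^bsub>V v\<^esub> h))) = (\<lambda>z. z + B v (\<alpha> v g)) \<otimes>\<^bsub>perms\<^esub> (\<lambda>z. z + B v (\<alpha> v h))"
      using \<alpha>_mult lin_add[OF B(1)] unfolding perms_simps comp_def by (intro ext) (simp only: add_ac)
  next
    fix e assume "e \<in> A"
    then show "Q e \<in> carrier perms" using Q_lin unfolding lin_def perms_simps by blast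
  next
    fix e c assume e: "e \<in> A" and c: "c \<in> carrier (F e)"
    obtain k where k: "c = cc e k" using cc_surj[OF e c] by blast
    have "Q e (z + B (hd' e) (\<alpha> (hd' e) (hi e c))) = Q e z + B (tl' e) (\<alpha> (tl' e) (ti e c))" for z
      unfolding lin_add[OF Q_lin[OF e]] Q_B k \<alpha>_hi[OF e] \<alpha>_ti[OF e] lin_scl[OF P(1)[OF e]] P(2)[OF e] ..
    then show "Q e \<otimes>\<^bsub>perms\<^esub> (\<lambda>z. z + B (hd' e) (\<alpha> (hd' e) (hi e c))) =
      (\<lambda>z. z + B (tl' e) (\<alpha> (tl' e) (ti e c))) \<otimes>\<^bsub>perms\<^esub> Q e"
      unfolding perms_simps comp_def by (rule ext)
  next
    fix e assume "e \<in> arcs T"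
    then have Q: "Q e = B (hd' e) \<circ> inv_into UNIV (B (hd' e))" using B(2) unfolding Q_def by (simp only:)
    show "Q e = \<one>\<^bsub>perms\<^esub>" unfolding Q perms_simps id_def comp_def by (rule ext) (rule lin_inv_f(2)[OF B(1)])
  qed blast
  then have "affine_rep h" unfolding affine_rep_def by blast
  then show ?thesis unfolding \<rho>_def by (rule someI[where P = affine_rep])
qed

text \<open>Translation part; with the linear part \<open>L\<close> defined next,
  \<open>\<rho> g z\<close> is \<open>L g z + \<tau> g\<close>.\<close>

definition \<tau> :: "('v, 'e, 'g) generator word set \<Rightarrow> vec" where "\<tau> g = \<rho> g 0"
definition L :: "('v, 'e, 'g) generator word set \<Rightarrow> vec \<Rightarrow> vec" where "L g z = \<rho> g z - \<rho> g 0"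

lemma \<rho>_mult: "g \<in> carrier FG \<Longrightarrow> h \<in> carrier FG \<Longrightarrow> \<rho> (g \<otimes>\<^bsub>FG\<^esub> h) z = \<rho> g (\<rho> h z)"
  using affine_rep unfolding affine_rep_def hom_def by simp

lemma \<rho>_hom: "group_hom FG perms \<rho>"
  using affine_rep unfolding affine_rep_def
  by (simp add: group_hom_def group_hom_axioms_def group_perms FG.is_group)

lemma \<rho>_one: "\<rho> \<one>\<^bsub>FG\<^esub> z = z"
  using group_hom.hom_one[OF \<rho>_hom] by simp

lemma \<rho>_inv: "g \<in> carrier FG \<Longrightarrow> \<rho> (inv\<^bsub>FG\<^esub> g) (\<rho> g z) = z" "g \<in> carrier FG \<Longrightarrow> \<rho> g (\<rho> (inv\<^bsub>FG\<^esub> g) z) = z"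
  using \<rho>_mult[of "inv\<^bsub>FG\<^esub> g" g z] \<rho>_mult[of g "inv\<^bsub>FG\<^esub> g" z] \<rho>_one by simp_all

lemma \<rho>_vt: "v \<in> W \<Longrightarrow> g \<in> carrier (V v) \<Longrightarrow> \<rho> (vt v g) z = z + B v (\<alpha> v g)"
  using affine_rep unfolding affine_rep_def by simp

lemma \<rho>_st: "e \<in> A \<Longrightarrow> \<rho> (st e) z = Q e z"
  using affine_rep unfolding affine_rep_def by simp

lemma \<tau>_vt: "v \<in> W \<Longrightarrow> g \<in> carrier (V v) \<Longrightarrow> \<tau> (vt v g) = B v (\<alpha> v g)"
  by (simp add: \<tau>_def \<rho>_vt)

lemma L_vt: "v \<in> W \<Longrightarrow> g \<in> carrier (V v) \<Longrightarrow> L (vt v g) z = z"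
  by (simp add: L_def \<rho>_vt)

lemma L_st: "e \<in> A \<Longrightarrow> L (st e) z = Q e z"
  using lin_zero[OF Q_lin] by (simp add: L_def \<rho>_st)

lemma \<rho>_eq: "\<rho> g z = L g z + \<tau> g"
  by (simp add: L_def \<tau>_def)

lemma L_lin: "g \<in> carrier FG \<Longrightarrow> lin (L g)"
proof -
  let ?J = "{g \<in> carrier FG. lin (L g)}"
  have "?J = carrier FG"
  proof (rule FG_generated)
    show "subgroup ?J FG"
    proof (rule FG.subgroupI)
      have "L \<one>\<^bsub>FG\<^esub> = id" unfolding id_def by (rule ext) (simp add: L_def \<rho>_one)
      then have "\<one>\<^bsub>FG\<^esub> \<in> ?J" using lin_id by simp
      then show "?J \<noteq> {}" by blast
    next
      fix g assume "g \<in> ?J"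
      then have g: "g \<in> carrier FG" "lin (L g)" by auto
      have "L (inv\<^bsub>FG\<^esub> g) z = inv_into UNIV (L g) z" for z
      proof -
        have "L g (\<rho> (inv\<^bsub>FG\<^esub> g) z) + \<tau> g - (L g (\<rho> (inv\<^bsub>FG\<^esub> g) 0) + \<tau> g) = z - 0"
          using \<rho>_inv(2)[OF g(1), of z] \<rho>_inv(2)[OF g(1), of 0] unfolding \<rho>_eq[of g] by (simp only:)
        then have "z = L g (\<rho> (inv\<^bsub>FG\<^esub> g) z) - L g (\<rho> (inv\<^bsub>FG\<^esub> g) 0)" by simp
        then have "z = L g (L (inv\<^bsub>FG\<^esub> g) z)" using lin_diff[OF g(2)] unfolding L_def[of "inv\<^bsub>FG\<^esub> g"] by simp
        then show ?thesis using lin_inv_f(1)[OF g(2), of "L (inv\<^bsub>FG\<^esub> g) z"] by simp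
      qed
      then have "L (inv\<^bsub>FG\<^esub> g) = inv_into UNIV (L g)" by (rule ext)
      then show "inv\<^bsub>FG\<^esub> g \<in> ?J" using lin_inv[OF g(2)] g(1) by simp
    next
      fix g h assume "g \<in> ?J" "h \<in> ?J"
      then have g: "g \<in> carrier FG" "h \<in> carrier FG" "lin (L g)" "lin (L h)" by auto
      have "L (g \<otimes>\<^bsub>FG\<^esub> h) z = L g (L h z)" for z
        unfolding L_def[of "g \<otimes>\<^bsub>FG\<^esub> h"] \<rho>_mult[OF g(1,2)] unfolding \<rho>_eq[of g]
        using lin_diff[OF g(3)] unfolding L_def[of h] by simp
      then have "L (g \<otimes>\<^bsub>FG\<^esub> h) = L g \<circ> L h" unfolding comp_def by (rule ext)
      then show "g \<otimes>\<^bsub>FG\<^esub> h \<in> ?J" using lin_comp[OF g(3,4)] g by simp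
    qed blast
  next
    fix v g assume v: "v \<in> W" "g \<in> carrier (V v)"
    then have "L (vt v g) = id" unfolding id_def by (intro ext L_vt)
    then show "vt v g \<in> ?J" using lin_id vt_closed v by simp
  next
    fix e assume e: "e \<in> A"
    then have "L (st e) = Q e" by (intro ext L_st)
    then show "st e \<in> ?J" using Q_lin st_closed e by simp
  qed
  then show "g \<in> carrier FG \<Longrightarrow> lin (L g)" by blast
qed

lemma L_mult: "g \<in> carrier FG \<Longrightarrow> h \<in> carrier FG \<Longrightarrow> L (g \<otimes>\<^bsub>FG\<^esub> h) z = L g (L h z)"
proof -
  assume g: "g \<in> carrier FG" "h \<in> carrier FG"
  show ?thesis
    unfolding L_def[of "g \<otimes>\<^bsub>FG\<^esub> h"] \<rho>_mult[OF g] unfolding \<rho>_eq[of g]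
    using lin_diff[OF L_lin[OF g(1)]] unfolding L_def[of h] by simp
qed

lemma L_one: "L \<one>\<^bsub>FG\<^esub> z = z"
  by (simp add: L_def \<rho>_one)

lemma L_inv: "g \<in> carrier FG \<Longrightarrow> L (inv\<^bsub>FG\<^esub> g) (L g z) = z" "g \<in> carrier FG \<Longrightarrow> L g (L (inv\<^bsub>FG\<^esub> g) z) = z"
  using L_mult[of "inv\<^bsub>FG\<^esub> g" g z] L_mult[of g "inv\<^bsub>FG\<^esub> g" z] L_one by simp_all

lemma \<tau>_mult: "g \<in> carrier FG \<Longrightarrow> h \<in> carrier FG \<Longrightarrow> \<tau> (g \<otimes>\<^bsub>FG\<^esub> h) = L g (\<tau> h) + \<tau> g"
  unfolding \<tau>_def[of "g \<otimes>\<^bsub>FG\<^esub> h"] \<tau>_def[of h] using \<rho>_mult[of g h 0] unfolding \<rho>_eq[of g] by (simp only:)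

text \<open>\<open>s\<close> acts as a translation, and conjugating a translation by an affine map
  gives the translation by the image of its vector under the linear part.\<close>

lemma \<tau>_conj:
  assumes g: "g \<in> carrier FG" and s: "s \<in> carrier FG" "\<And>z. L s z = z"
  shows "\<tau> (g \<otimes>\<^bsub>FG\<^esub> s \<otimes>\<^bsub>FG\<^esub> inv\<^bsub>FG\<^esub> g) = L g (\<tau> s)" "L (g \<otimes>\<^bsub>FG\<^esub> s \<otimes>\<^bsub>FG\<^esub> inv\<^bsub>FG\<^esub> g) z = z"
proof -
  have i: "inv\<^bsub>FG\<^esub> g \<in> carrier FG" using g by simp
  have 0: "L g (\<tau> (inv\<^bsub>FG\<^esub> g)) + \<tau> g = 0"
    using \<tau>_mult[OF g i] g \<rho>_one[of 0] by (simp add: \<tau>_def)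
  have "\<tau> (g \<otimes>\<^bsub>FG\<^esub> s \<otimes>\<^bsub>FG\<^esub> inv\<^bsub>FG\<^esub> g) = L (g \<otimes>\<^bsub>FG\<^esub> s) (\<tau> (inv\<^bsub>FG\<^esub> g)) + \<tau> (g \<otimes>\<^bsub>FG\<^esub> s)"
    using g s(1) i by (intro \<tau>_mult) simp_all
  also have "\<dots> = L g (\<tau> (inv\<^bsub>FG\<^esub> g)) + (L g (\<tau> s) + \<tau> g)"
    unfolding L_mult[OF g s(1)] s(2) \<tau>_mult[OF g s(1)] ..
  also have "\<dots> = L g (\<tau> s) + (L g (\<tau> (inv\<^bsub>FG\<^esub> g)) + \<tau> g)" by (simp only: add_ac)
  finally show "\<tau> (g \<otimes>\<^bsub>FG\<^esub> s \<otimes>\<^bsub>FG\<^esub> inv\<^bsub>FG\<^esub> g) = L g (\<tau> s)" using 0 by simp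
  show "L (g \<otimes>\<^bsub>FG\<^esub> s \<otimes>\<^bsub>FG\<^esub> inv\<^bsub>FG\<^esub> g) z = z"
  proof -
    have "L (g \<otimes>\<^bsub>FG\<^esub> s \<otimes>\<^bsub>FG\<^esub> inv\<^bsub>FG\<^esub> g) z = L (g \<otimes>\<^bsub>FG\<^esub> s) (L (inv\<^bsub>FG\<^esub> g) z)"
      using g s i by (intro L_mult) simp_all
    also have "\<dots> = L g (L s (L (inv\<^bsub>FG\<^esub> g) z))" by (rule L_mult[OF g s(1)])
    also have "\<dots> = z" unfolding s(2) by (rule L_inv(2)[OF g])
    finally show ?thesis .
  qed
qed

end

subsection \<open>The Bass--Serre tree\<close>

text \<open>Symmetric difference of sets given by characteristic functions, that is, addition over
  the field with two elements.\<close>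

definition xr :: "('b \<Rightarrow> bool) \<Rightarrow> ('b \<Rightarrow> bool) \<Rightarrow> 'b \<Rightarrow> bool" where
  "xr f f' = (\<lambda>b. f b \<noteq> f' b)"

lemma xr_assoc: "xr (xr a b) c = xr a (xr b c)"
  and xr_self: "xr a a = (\<lambda>_. False)"
  and xr_False: "xr a (\<lambda>_. False) = a" "xr (\<lambda>_. False) a = a"
  and xr_cancel: "xr a (xr a b) = b"
  unfolding xr_def by blast+

lemma xr_shuffle:
  "xr (xr (xr (xr a d') b) d') d = xr (xr a d) b"
  "xr (xr (xr m (xr d b)) d) b = m"
  "xr (xr (xr a b) c) d = xr (xr (xr a c) d) b"
  "xr (xr (xr (xr a b) c) d) e = xr (xr (xr (xr a c) d) e) b"
  unfolding xr_def by blast+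

lemma bij_xr: "bij (\<lambda>m. xr m c)"
  by (rule o_bij[of "\<lambda>m. xr m c"]) (simp_all only: fun_eq_iff comp_apply id_apply xr_assoc xr_self xr_False simp_thms)

definition xor_group :: "('b \<Rightarrow> bool) monoid" where
  "xor_group = \<lparr>carrier = UNIV, monoid.mult = xr, one = (\<lambda>_. False)\<rparr>"

lemma group_xor_group: "group xor_group"
proof (rule groupI)
  fix x :: "'b \<Rightarrow> bool" assume "x \<in> carrier xor_group"
  have "x \<otimes>\<^bsub>xor_group\<^esub> x = \<one>\<^bsub>xor_group\<^esub>" by (simp add: xor_group_def xr_self)
  then show "\<exists>y\<in>carrier xor_group. y \<otimes>\<^bsub>xor_group\<^esub> x = \<one>\<^bsub>xor_group\<^esub>" by (auto simp: xor_group_def)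
qed (simp_all add: xor_group_def xr_assoc xr_False)

context tubular
begin

section \<open>Cosets of vertex and edge groups\<close>

definition Vb :: "'v \<Rightarrow> ('v, 'e, 'g) generator word set set" where
  "Vb v = vt v ` carrier (V v)"

definition Eb :: "'e \<Rightarrow> ('v, 'e, 'g) generator word set set" where
  "Eb e = (\<lambda>c. vt (tl' e) (ti e c)) ` carrier (F e)"

lemma Vb_subgroup: "v \<in> W \<Longrightarrow> subgroup (Vb v) FG"
  unfolding Vb_def
  by (intro group_hom.img_is_subgroup group_hom.intro group_V FG.is_group group_hom_axioms.intro homI vt_closed vt_mult)

lemma Eb_subgroup: "e \<in> A \<Longrightarrow> subgroup (Eb e) FG"
proof -
  assume e: "e \<in> A"
  have "(\<lambda>c. vt (tl' e) (ti e c)) \<in> hom (F e) FG"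
  proof (rule homI)
    fix c d assume c: "c \<in> carrier (F e)" "d \<in> carrier (F e)"
    have "ti e (c \<otimes>\<^bsub>F e\<^esub> d) = ti e c \<otimes>\<^bsub>V (tl' e)\<^esub> ti e d"
      using ti_mon[OF e] c by (simp add: mon_def hom_def)
    then show "vt (tl' e) (ti e (c \<otimes>\<^bsub>F e\<^esub> d)) = vt (tl' e) (ti e c) \<otimes>\<^bsub>FG\<^esub> vt (tl' e) (ti e d)"
      using vt_mult[OF ends(1)[OF e] ti_closed[OF e c(1)] ti_closed[OF e c(2)]] by simp
  qed (intro vt_closed ends(1) ti_closed e)
  then show ?thesis
    unfolding Eb_def
    by (intro group_hom.img_is_subgroup group_hom.intro group_F e FG.is_group group_hom_axioms.intro)
qed

lemma Eb_Vb: "e \<in> A \<Longrightarrow> u \<in> Eb e \<Longrightarrow> u \<in> Vb (tl' e)"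
  unfolding Eb_def Vb_def using ti_closed by blast

definition lc :: "'v \<Rightarrow> ('v, 'e, 'g) generator word set \<Rightarrow> ('v, 'e, 'g) generator word set set" where
  "lc v g = FG.lcs (Vb v) g"

definition act :: "('v, 'e, 'g) generator word set \<Rightarrow> 'v \<times> ('v, 'e, 'g) generator word set set \<Rightarrow>
    'v \<times> ('v, 'e, 'g) generator word set set" where
  "act g x = (fst x, {z \<in> carrier FG. inv\<^bsub>FG\<^esub> g \<otimes>\<^bsub>FG\<^esub> z \<in> snd x})"

definition "VT = {(v, lc v g) | v g. v \<in> W \<and> g \<in> carrier FG}"

text \<open>The edge group is taken on the tail side: an edge of the tree is a left coset of
  \<open>Eb e\<close>, given by a representative \<open>g\<close>, and its head is reached through
  the stable letter.\<close>

definition edge :: "'e \<Rightarrow> ('v, 'e, 'g) generator word set \<Rightarrow>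
    ('v \<times> ('v, 'e, 'g) generator word set set) \<times> ('v \<times> ('v, 'e, 'g) generator word set set)" where
  "edge e g = ((tl' e, lc (tl' e) g), (hd' e, lc (hd' e) (g \<otimes>\<^bsub>FG\<^esub> st e)))"

definition "ET = {edge e g | e g. e \<in> A \<and> g \<in> carrier FG}"

lemma act_lc: "g \<in> carrier FG \<Longrightarrow> k \<in> carrier FG \<Longrightarrow> act g (v, lc v k) = (v, lc v (g \<otimes>\<^bsub>FG\<^esub> k))"
  unfolding act_def lc_def fst_conv snd_conv FG.lcs_translate ..

lemma lc_eq_iff: "v \<in> W \<Longrightarrow> g \<in> carrier FG \<Longrightarrow> k \<in> carrier FG \<Longrightarrow> lc v g = lc v k \<longleftrightarrow> inv\<^bsub>FG\<^esub> g \<otimes>\<^bsub>FG\<^esub> k \<in> Vb v"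
  unfolding lc_def by (rule FG.lcs_eq_iff[OF Vb_subgroup])

lemma act_edge: "e \<in> A \<Longrightarrow> g \<in> carrier FG \<Longrightarrow> k \<in> carrier FG \<Longrightarrow>
    (act g (fst (edge e k)), act g (snd (edge e k))) = edge e (g \<otimes>\<^bsub>FG\<^esub> k)"
  by (simp add: edge_def act_lc st_closed FG.m_assoc)

lemma act_fix: "v \<in> W \<Longrightarrow> s \<in> carrier FG \<Longrightarrow> g \<in> carrier FG \<Longrightarrow>
    act s (v, lc v g) = (v, lc v g) \<longleftrightarrow> inv\<^bsub>FG\<^esub> g \<otimes>\<^bsub>FG\<^esub> (s \<otimes>\<^bsub>FG\<^esub> g) \<in> Vb v"
  using lc_eq_iff[of v g "s \<otimes>\<^bsub>FG\<^esub> g"] by (auto simp: act_lc)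

lemma VT_E: assumes "x \<in> VT" obtains v k where "v \<in> W" "k \<in> carrier FG" "x = (v, lc v k)"
  using assms unfolding VT_def by blast

lemma VT_I: "v \<in> W \<Longrightarrow> k \<in> carrier FG \<Longrightarrow> (v, lc v k) \<in> VT"
  unfolding VT_def by blast

lemma edge_VT: "e \<in> A \<Longrightarrow> g \<in> carrier FG \<Longrightarrow> fst (edge e g) \<in> VT \<and> snd (edge e g) \<in> VT"
  unfolding edge_def using VT_I ends st_closed by simp

section \<open>Sets of edges and the walls they define\<close>

definition tr :: "('v, 'e, 'g) generator word set \<Rightarrow> ('e \<times> ('v, 'e, 'g) generator word set \<Rightarrow> bool) \<Rightarrow>
    'e \<times> ('v, 'e, 'g) generator word set \<Rightarrow> bool" where
  "tr g f = (\<lambda>(e, h). if h \<in> carrier FG then f (e, inv\<^bsub>FG\<^esub> g \<otimes>\<^bsub>FG\<^esub> h) else f (e, h))"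

text \<open>The singleton consisting of the edge \<open>edge e g\<close>, written as the set of all
  representatives of that edge.\<close>

definition blk :: "'e \<Rightarrow> ('v, 'e, 'g) generator word set \<Rightarrow> 'e \<times> ('v, 'e, 'g) generator word set \<Rightarrow> bool" where
  "blk e g = (\<lambda>(e', h). e' = e \<and> h \<in> FG.lcs (Eb e) g)"

lemma tr_xr: "tr g (xr f f') = xr (tr g f) (tr g f')"
  by (rule ext) (auto simp: tr_def xr_def split: prod.split)

lemma tr_False: "tr g (\<lambda>_. False) = (\<lambda>_. False)"
  by (rule ext) (simp add: tr_def split: prod.split)

lemma tr_mult:
  assumes "g \<in> carrier FG" "h \<in> carrier FG"
  shows "tr (g \<otimes>\<^bsub>FG\<^esub> h) f = tr g (tr h f)"
proof (rule ext)
  fix b :: "'e \<times> ('v, 'e, 'g) generator word set"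
  obtain e k where b: "b = (e, k)" by force
  show "tr (g \<otimes>\<^bsub>FG\<^esub> h) f b = tr g (tr h f) b"
    using assms by (cases "k \<in> carrier FG") (simp_all add: b tr_def FG.inv_mult_group FG.m_assoc)
qed

lemma tr_one: "tr \<one>\<^bsub>FG\<^esub> f = f"
  by (rule ext) (simp add: tr_def split: prod.split)

lemma tr_inv: "g \<in> carrier FG \<Longrightarrow> tr g (tr (inv\<^bsub>FG\<^esub> g) f) = f" "g \<in> carrier FG \<Longrightarrow> tr (inv\<^bsub>FG\<^esub> g) (tr g f) = f"
  using tr_mult[of g "inv\<^bsub>FG\<^esub> g" f] tr_mult[of "inv\<^bsub>FG\<^esub> g" g f] tr_one by simp_all

text \<open>Pairs whose second component lies outside the group are left in place by
  \<open>tr\<close>, which keeps it invertible on all predicates.\<close>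

lemma bij_tr: "g \<in> carrier FG \<Longrightarrow> bij (tr g)"
  by (rule o_bij[of "tr (inv\<^bsub>FG\<^esub> g)"]) (rule ext, simp add: tr_inv)+

lemma tr_blk:
  assumes "k \<in> carrier FG" "g \<in> carrier FG"
  shows "tr k (blk e g) = blk e (k \<otimes>\<^bsub>FG\<^esub> g)"
proof (rule ext)
  fix b :: "'e \<times> ('v, 'e, 'g) generator word set"
  obtain e' h where b: "b = (e', h)" by force
  show "tr k (blk e g) b = blk e (k \<otimes>\<^bsub>FG\<^esub> g) b"
  proof -
    have r: "h \<in> FG.lcs (Eb e) (k \<otimes>\<^bsub>FG\<^esub> g) \<longleftrightarrow> h \<in> carrier FG \<and> inv\<^bsub>FG\<^esub> k \<otimes>\<^bsub>FG\<^esub> h \<in> FG.lcs (Eb e) g"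
      unfolding FG.lcs_translate[OF assms, of "Eb e", symmetric] by blast
    have n: "h \<in> FG.lcs (Eb e) g \<Longrightarrow> h \<in> carrier FG" by (simp add: FG.lcs_def)
    show ?thesis unfolding b tr_def blk_def prod.case r using n by (auto split: if_splits)
  qed
qed

lemma blk_eq: "e \<in> A \<Longrightarrow> g \<in> carrier FG \<Longrightarrow> k \<in> carrier FG \<Longrightarrow> inv\<^bsub>FG\<^esub> g \<otimes>\<^bsub>FG\<^esub> k \<in> Eb e \<Longrightarrow> blk e g = blk e k"
  unfolding blk_def using FG.lcs_eq_iff[OF Eb_subgroup, of e g k] by simp

text \<open>Only differences matter: across an edge of \<open>T\<close> the sets differ in that
  edge, as would the sets of edges between a vertex and a fixed one.\<close>

definition potential :: "'v \<Rightarrow> 'e \<times> ('v, 'e, 'g) generator word set \<Rightarrow> bool" where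
  "potential = (SOME d. \<forall>e\<in>arcs T. d (hd' e) = xr (d (tl' e)) (blk e \<one>\<^bsub>FG\<^esub>))"

lemma potential: "e \<in> arcs T \<Longrightarrow> potential (hd' e) = xr (potential (tl' e)) (blk e \<one>\<^bsub>FG\<^esub>)"
proof -
  have "\<exists>d. (\<forall>v. d v \<in> carrier xor_group) \<and> (\<forall>e\<in>arcs T. d (head T e) = d (tail T e) \<otimes>\<^bsub>xor_group\<^esub> blk e \<one>\<^bsub>FG\<^esub>)"
    by (rule tree_potential[OF T_props(1,8,7) group_xor_group]) (simp add: xor_group_def)
  then obtain d where "\<forall>e\<in>arcs T. d (head T e) = d (tail T e) \<otimes>\<^bsub>xor_group\<^esub> blk e \<one>\<^bsub>FG\<^esub>" by blast
  then have "\<forall>e\<in>arcs T. d (hd' e) = xr (d (tl' e)) (blk e \<one>\<^bsub>FG\<^esub>)"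
    unfolding T_props(4,5) xor_group_def by simp
  then have "\<exists>d. \<forall>e\<in>arcs T. d (hd' e) = xr (d (tl' e)) (blk e \<one>\<^bsub>FG\<^esub>)" by (rule exI[of _ d])
  then have "\<forall>e\<in>arcs T. potential (hd' e) = xr (potential (tl' e)) (blk e \<one>\<^bsub>FG\<^esub>)"
    unfolding potential_def by (rule someI_ex)
  then show "e \<in> arcs T \<Longrightarrow> potential (hd' e) = xr (potential (tl' e)) (blk e \<one>\<^bsub>FG\<^esub>)" by (rule bspec)
qed

text \<open>
  For the coset graph to be a tree every edge must separate it. The group acts affinely on the sets
  of edges (by symmetric difference); transporting \<open>potential\<close> by this action assigns to each
  vertex a set of edges, and the sets of adjacent vertices differ exactly in the edge between them.
\<close>

definition wall_rep :: "(('v, 'e, 'g) generator word set \<Rightarrow> ('e \<times> ('v, 'e, 'g) generator word set \<Rightarrow> bool) \<Rightarrow>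
    ('e \<times> ('v, 'e, 'g) generator word set \<Rightarrow> bool)) \<Rightarrow> bool" where
  "wall_rep \<pi> \<longleftrightarrow> \<pi> \<in> hom FG perms \<and>
    (\<forall>v\<in>W. \<forall>g\<in>carrier (V v). \<pi> (vt v g) = (\<lambda>m. xr (tr (vt v g) (xr m (potential v))) (potential v))) \<and>
    (\<forall>e\<in>A. \<pi> (st e) = (\<lambda>m. xr (xr (tr (st e) (xr m (potential (hd' e)))) (potential (tl' e))) (blk e \<one>\<^bsub>FG\<^esub>)))"

definition "\<pi> = (SOME \<pi>. wall_rep \<pi>)"

lemma wall_rep: "wall_rep \<pi>"
proof -
  let ?FV = "\<lambda>v g m. xr (tr (vt v g) (xr m (potential v))) (potential v)"
  let ?FS = "\<lambda>e m. xr (xr (tr (st e) (xr m (potential (hd' e)))) (potential (tl' e))) (blk e \<one>\<^bsub>FG\<^esub>)"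
  obtain h where h: "h \<in> hom FG perms" "\<And>v g. v \<in> W \<Longrightarrow> g \<in> carrier (V v) \<Longrightarrow> h (vt v g) = ?FV v g"
    "\<And>e. e \<in> A \<Longrightarrow> h (st e) = ?FS e"
  proof (rule FG_hom[OF group_perms, of ?FV ?FS])
    fix v g assume v: "v \<in> W" "g \<in> carrier (V v)"
    have "bij ((\<lambda>m. xr m (potential v)) \<circ> (tr (vt v g) \<circ> (\<lambda>m. xr m (potential v))))"
      by (intro bij_comp bij_xr bij_tr vt_closed v)
    then show "?FV v g \<in> carrier perms" unfolding perms_simps comp_def by blast
  next
    fix v g h assume v: "v \<in> W" "g \<in> carrier (V v)" "h \<in> carrier (V v)"
    show "?FV v (g \<otimes>\<^bsub>V v\<^esub> h) = ?FV v g \<otimes>\<^bsub>perms\<^esub> ?FV v h"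
      unfolding perms_simps comp_def vt_mult[OF v] tr_mult[OF vt_closed[OF v(1,2)] vt_closed[OF v(1,3)]]
      unfolding xr_assoc xr_self xr_False ..
  next
    fix e assume e: "e \<in> A"
    have "bij ((\<lambda>m. xr m (blk e \<one>\<^bsub>FG\<^esub>)) \<circ> ((\<lambda>m. xr m (potential (tl' e))) \<circ> (tr (st e) \<circ> (\<lambda>m. xr m (potential (hd' e))))))"
      by (intro bij_comp bij_xr bij_tr st_closed e)
    then show "?FS e \<in> carrier perms" unfolding perms_simps comp_def by blast
  next
    fix e c assume e: "e \<in> A" and c: "c \<in> carrier (F e)"
    let ?u = "vt (tl' e) (ti e c)" and ?w = "vt (hd' e) (hi e c)"
    have u: "?u \<in> carrier FG" "?w \<in> carrier FG" using vt_closed ends ti_closed hi_closed e c by blast+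
    have "?u \<in> Eb e" using c unfolding Eb_def by blast
    then have bl: "blk e \<one>\<^bsub>FG\<^esub> = blk e ?u" using blk_eq[OF e FG.one_closed u(1)] u by simp
    \<comment> \<open>The edge group fixes the base edge of \<open>e\<close>, so translation by its
      elements preserves the singleton; this makes the formulas respect the edge relation.\<close>
    have b: "tr ?u (blk e \<one>\<^bsub>FG\<^esub>) = blk e \<one>\<^bsub>FG\<^esub>"
      unfolding tr_blk[OF u(1) FG.one_closed] FG.r_one[OF u(1)] by (rule bl[symmetric])
    have "tr (st e) (tr ?w m) = tr ?u (tr (st e) m)" for m
      using tr_mult[OF st_closed[OF e] u(2)] tr_mult[OF u(1) st_closed[OF e]] st_vt[OF e c] by metis
    note swap = this
    have "?FS e (?FV (hd' e) (hi e c) m) = ?FV (tl' e) (ti e c) (?FS e m)" for m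
    proof -
      let ?m = "xr m (potential (hd' e))"
      have "xr (?FV (hd' e) (hi e c) m) (potential (hd' e)) = tr ?w ?m" by (simp only: xr_assoc xr_self xr_False)
      then have "?FS e (?FV (hd' e) (hi e c) m) = xr (xr (tr ?u (tr (st e) ?m)) (potential (tl' e))) (blk e \<one>\<^bsub>FG\<^esub>)"
        using swap[of ?m] by (simp only:)
      also have "\<dots> = ?FV (tl' e) (ti e c) (?FS e m)"
        unfolding tr_xr[of ?u] b by (rule xr_shuffle(1)[symmetric])
      finally show ?thesis .
    qed
    then show "?FS e \<otimes>\<^bsub>perms\<^esub> ?FV (hd' e) (hi e c) = ?FV (tl' e) (ti e c) \<otimes>\<^bsub>perms\<^esub> ?FS e"
      unfolding perms_simps comp_def by (rule ext)
  next
    fix e assume e: "e \<in> arcs T"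
    show "?FS e = \<one>\<^bsub>perms\<^esub>"
      unfolding perms_simps id_def st_T[OF e] tr_one potential[OF e]
      by (rule ext) (rule xr_shuffle(2))
  qed blast
  then have "wall_rep h" unfolding wall_rep_def by blast
  then show ?thesis unfolding \<pi>_def by (rule someI[where P = wall_rep])
qed

lemma \<pi>_mult: "g \<in> carrier FG \<Longrightarrow> h \<in> carrier FG \<Longrightarrow> \<pi> (g \<otimes>\<^bsub>FG\<^esub> h) m = \<pi> g (\<pi> h m)"
  using wall_rep unfolding wall_rep_def hom_def by simp

lemma \<pi>_one: "\<pi> \<one>\<^bsub>FG\<^esub> m = m"
proof -
  have "group_hom FG perms \<pi>"
    using wall_rep unfolding wall_rep_def by (intro group_hom.intro group_hom_axioms.intro group_perms FG.is_group) blast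
  from group_hom.hom_one[OF this] show ?thesis by simp
qed

lemma \<pi>_vt: "v \<in> W \<Longrightarrow> g \<in> carrier (V v) \<Longrightarrow> \<pi> (vt v g) m = xr (tr (vt v g) (xr m (potential v))) (potential v)"
  using wall_rep unfolding wall_rep_def by simp

lemma \<pi>_st: "e \<in> A \<Longrightarrow> \<pi> (st e) m = xr (xr (tr (st e) (xr m (potential (hd' e)))) (potential (tl' e))) (blk e \<one>\<^bsub>FG\<^esub>)"
  using wall_rep unfolding wall_rep_def by simp

text \<open>The formulas on generators are affine over the symmetric difference with linear part
  \<open>tr g\<close>, and this passes to products and inverses. It lets the difference across a
  base edge be translated to every edge.\<close>

lemma \<pi>_xr: "g \<in> carrier FG \<Longrightarrow> \<pi> g (xr m m') = xr (\<pi> g m) (tr g m')"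
proof -
  let ?J = "{g \<in> carrier FG. \<forall>m m'. \<pi> g (xr m m') = xr (\<pi> g m) (tr g m')}"
  have "?J = carrier FG"
  proof (rule FG_generated)
    show "subgroup ?J FG"
    proof (rule FG.subgroupI)
      have "\<one>\<^bsub>FG\<^esub> \<in> ?J" using \<pi>_one tr_one by simp
      then show "?J \<noteq> {}" by blast
    next
      fix g assume "g \<in> ?J"
      then have g: "g \<in> carrier FG" "\<And>m m'. \<pi> g (xr m m') = xr (\<pi> g m) (tr g m')" by auto
      have i: "inv\<^bsub>FG\<^esub> g \<in> carrier FG" using g by simp
      have gi: "\<pi> g (\<pi> (inv\<^bsub>FG\<^esub> g) m) = m" "\<pi> (inv\<^bsub>FG\<^esub> g) (\<pi> g m) = m" for m
        using \<pi>_mult[OF g(1) i, of m] \<pi>_mult[OF i g(1), of m] \<pi>_one g(1) by simp_all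
      have "\<pi> (inv\<^bsub>FG\<^esub> g) (xr m m') = xr (\<pi> (inv\<^bsub>FG\<^esub> g) m) (tr (inv\<^bsub>FG\<^esub> g) m')" for m m'
      proof -
        have "\<pi> g (xr (\<pi> (inv\<^bsub>FG\<^esub> g) m) (tr (inv\<^bsub>FG\<^esub> g) m')) = xr m m'"
          unfolding g(2) gi(1) tr_inv(1)[OF g(1)] ..
        then show ?thesis using gi(2) by metis
      qed
      then show "inv\<^bsub>FG\<^esub> g \<in> ?J" using i by blast
    next
      fix g h assume "g \<in> ?J" "h \<in> ?J"
      then have g: "g \<in> carrier FG" "\<And>m m'. \<pi> g (xr m m') = xr (\<pi> g m) (tr g m')"
        and h: "h \<in> carrier FG" "\<And>m m'. \<pi> h (xr m m') = xr (\<pi> h m) (tr h m')" by auto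
      have "\<pi> (g \<otimes>\<^bsub>FG\<^esub> h) (xr m m') = xr (\<pi> (g \<otimes>\<^bsub>FG\<^esub> h) m) (tr (g \<otimes>\<^bsub>FG\<^esub> h) m')" for m m'
        unfolding \<pi>_mult[OF g(1) h(1)] tr_mult[OF g(1) h(1)] h(2) g(2) ..
      then show "g \<otimes>\<^bsub>FG\<^esub> h \<in> ?J" using g h by blast
    qed blast
  next
    fix v g assume v: "v \<in> W" "g \<in> carrier (V v)"
    have "\<pi> (vt v g) (xr m m') = xr (\<pi> (vt v g) m) (tr (vt v g) m')" for m m'
      unfolding \<pi>_vt[OF v] tr_xr by (rule xr_shuffle(3))
    then show "vt v g \<in> ?J" using vt_closed v by blast
  next
    fix e assume e: "e \<in> A"
    have "\<pi> (st e) (xr m m') = xr (\<pi> (st e) m) (tr (st e) m')" for m m'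
      unfolding \<pi>_st[OF e] tr_xr by (rule xr_shuffle(4))
    then show "st e \<in> ?J" using st_closed e by blast
  qed
  then show "g \<in> carrier FG \<Longrightarrow> \<pi> g (xr m m') = xr (\<pi> g m) (tr g m')" by blast
qed

definition D :: "'v \<times> ('v, 'e, 'g) generator word set set \<Rightarrow> 'e \<times> ('v, 'e, 'g) generator word set \<Rightarrow> bool" where
  "D x = \<pi> (SOME g. g \<in> carrier FG \<and> snd x = lc (fst x) g) (potential (fst x))"

text \<open>Elements of the vertex group fix \<open>potential v\<close> under \<open>\<pi>\<close>,
  so the set depends only on the coset.\<close>

lemma D_lc:
  assumes v: "v \<in> W" and g: "g \<in> carrier FG"
  shows "D (v, lc v g) = \<pi> g (potential v)"
proof -
  define k where "k = (SOME k. k \<in> carrier FG \<and> lc v g = lc v k)"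
  have "k \<in> carrier FG \<and> lc v g = lc v k" unfolding k_def by (rule someI[of _ g]) (use g in simp)
  then have k: "k \<in> carrier FG" "lc v k = lc v g" by auto
  then have "inv\<^bsub>FG\<^esub> k \<otimes>\<^bsub>FG\<^esub> g \<in> Vb v" using lc_eq_iff[OF v k(1) g] by blast
  then obtain x where x: "x \<in> carrier (V v)" "inv\<^bsub>FG\<^esub> k \<otimes>\<^bsub>FG\<^esub> g = vt v x" unfolding Vb_def by blast
  have "g = k \<otimes>\<^bsub>FG\<^esub> vt v x" unfolding x(2)[symmetric] using g k(1) by (simp add: FG.mult_inv_cancel)
  then have "\<pi> g (potential v) = \<pi> k (\<pi> (vt v x) (potential v))" using \<pi>_mult[OF k(1) vt_closed[OF v x(1)]] by simp
  also have "\<pi> (vt v x) (potential v) = potential v" unfolding \<pi>_vt[OF v x(1)] xr_self tr_False xr_False ..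
  finally show ?thesis unfolding D_def fst_conv snd_conv k_def[symmetric] by simp
qed

lemma D_edge:
  assumes e: "e \<in> A" and g: "g \<in> carrier FG"
  shows "xr (D (fst (edge e g))) (D (snd (edge e g))) = blk e g"
proof -
  have s: "st e \<in> carrier FG" using st_closed e .
  have 1: "D (fst (edge e g)) = \<pi> g (potential (tl' e))" unfolding edge_def fst_conv by (rule D_lc[OF ends(1)[OF e] g])
  have "D (snd (edge e g)) = \<pi> (g \<otimes>\<^bsub>FG\<^esub> st e) (potential (hd' e))"
    unfolding edge_def snd_conv using g s by (intro D_lc[OF ends(2)[OF e]]) simp
  also have "\<dots> = \<pi> g (xr (potential (tl' e)) (blk e \<one>\<^bsub>FG\<^esub>))"
    unfolding \<pi>_mult[OF g s] \<pi>_st[OF e] xr_self tr_False xr_False ..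
  also have "\<dots> = xr (\<pi> g (potential (tl' e))) (blk e g)"
    unfolding \<pi>_xr[OF g] tr_blk[OF g FG.one_closed] FG.r_one[OF g] ..
  finally show ?thesis unfolding 1 by (simp only: xr_cancel)
qed

lemma blk_self: "e \<in> A \<Longrightarrow> g \<in> carrier FG \<Longrightarrow> blk e g (e, g)"
  unfolding blk_def using subgroup.one_closed[OF Eb_subgroup] by (simp add: FG.lcs_def)

text \<open>The two ends of an edge determine the coset of its representatives, since by
  \<open>D_edge\<close> it is the difference of their sets. This does the work of a normal form
  theorem.\<close>

lemma edge_eq_iff:
  assumes e: "e \<in> A" and g: "g \<in> carrier FG" and k: "k \<in> carrier FG"
  shows "edge e k = edge e g \<longleftrightarrow> inv\<^bsub>FG\<^esub> k \<otimes>\<^bsub>FG\<^esub> g \<in> Eb e"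
proof
  assume "edge e k = edge e g"
  then have "blk e k = blk e g" using D_edge[OF e g] D_edge[OF e k] by simp
  then have "blk e k (e, g)" using blk_self[OF e g] by simp
  then show "inv\<^bsub>FG\<^esub> k \<otimes>\<^bsub>FG\<^esub> g \<in> Eb e" unfolding blk_def by (simp add: FG.lcs_def)
next
  assume kg: "inv\<^bsub>FG\<^esub> k \<otimes>\<^bsub>FG\<^esub> g \<in> Eb e"
  then obtain c where c: "c \<in> carrier (F e)" "inv\<^bsub>FG\<^esub> k \<otimes>\<^bsub>FG\<^esub> g = vt (tl' e) (ti e c)" unfolding Eb_def by blast
  have s: "st e \<in> carrier FG" using st_closed e .
  have "lc (tl' e) k = lc (tl' e) g" using lc_eq_iff[OF ends(1)[OF e] k g] Eb_Vb[OF e kg] by blast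
  moreover have "inv\<^bsub>FG\<^esub> (k \<otimes>\<^bsub>FG\<^esub> st e) \<otimes>\<^bsub>FG\<^esub> (g \<otimes>\<^bsub>FG\<^esub> st e) = inv\<^bsub>FG\<^esub> st e \<otimes>\<^bsub>FG\<^esub> ((inv\<^bsub>FG\<^esub> k \<otimes>\<^bsub>FG\<^esub> g) \<otimes>\<^bsub>FG\<^esub> st e)"
    using g k s by (simp add: FG.inv_mult_group FG.m_assoc)
  then have "inv\<^bsub>FG\<^esub> (k \<otimes>\<^bsub>FG\<^esub> st e) \<otimes>\<^bsub>FG\<^esub> (g \<otimes>\<^bsub>FG\<^esub> st e) = vt (hd' e) (hi e c)"
    using s vt_closed[OF ends(2)[OF e] hi_closed[OF e c(1)]] unfolding c(2) st_vt[OF e c(1), symmetric]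
    by (simp only: FG.mult_inv_cancel)
  then have "inv\<^bsub>FG\<^esub> (k \<otimes>\<^bsub>FG\<^esub> st e) \<otimes>\<^bsub>FG\<^esub> (g \<otimes>\<^bsub>FG\<^esub> st e) \<in> Vb (hd' e)"
    unfolding Vb_def using hi_closed[OF e c(1)] by blast
  then have "lc (hd' e) (k \<otimes>\<^bsub>FG\<^esub> st e) = lc (hd' e) (g \<otimes>\<^bsub>FG\<^esub> st e)"
    using lc_eq_iff[OF ends(2)[OF e], of "k \<otimes>\<^bsub>FG\<^esub> st e" "g \<otimes>\<^bsub>FG\<^esub> st e"] g k s by simp
  ultimately show "edge e k = edge e g" unfolding edge_def by simp
qed

text \<open>Whether the edge belongs to \<open>D x\<close> tells on which side of it
  \<open>x\<close> lies, because the sets of adjacent vertices differ in the connecting edge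
  only.\<close>

lemma walls:
  assumes "(u, v) \<in> ET"
  shows "\<exists>f :: 'v \<times> ('v, 'e, 'g) generator word set set \<Rightarrow> bool. \<forall>a b. (a, b) \<in> ET \<longrightarrow> (f a \<noteq> f b \<longleftrightarrow> a = u \<and> b = v)"
proof -
  obtain e g where e: "e \<in> A" "g \<in> carrier FG" "(u, v) = edge e g" using assms unfolding ET_def by blast
  have D: "D a (e, g) \<noteq> D b (e, g) \<longleftrightarrow> a = u \<and> b = v" if ab: "(a, b) \<in> ET" for a b
  proof -
    obtain e' k where k: "e' \<in> A" "k \<in> carrier FG" "(a, b) = edge e' k" using ab unfolding ET_def by blast
    have "xr (D a) (D b) = blk e' k" using D_edge[OF k(1,2)] unfolding k(3)[symmetric] fst_conv snd_conv .
    from fun_cong[OF this, of "(e, g)"]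
    have 1: "D a (e, g) \<noteq> D b (e, g) \<longleftrightarrow> blk e' k (e, g)" unfolding xr_def .
    show ?thesis
    proof
      assume "D a (e, g) \<noteq> D b (e, g)"
      then have "blk e' k (e, g)" using 1 by blast
      then have "e = e'" "inv\<^bsub>FG\<^esub> k \<otimes>\<^bsub>FG\<^esub> g \<in> Eb e" unfolding blk_def FG.lcs_def by simp_all
      then have "edge e' k = edge e g" using edge_eq_iff[OF e(1,2) k(2)] by blast
      then have "(a, b) = (u, v)" unfolding e(3) k(3) .
      then show "a = u \<and> b = v" by simp
    next
      assume "a = u \<and> b = v"
      then have "xr (D a) (D b) = blk e g" using D_edge[OF e(1,2)] unfolding e(3)[symmetric] by simp
      from fun_cong[OF this, of "(e, g)"] show "D a (e, g) \<noteq> D b (e, g)"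
        using blk_self[OF e(1,2)] unfolding xr_def by blast
    qed
  qed
  show ?thesis by (rule exI[of _ "\<lambda>x. D x (e, g)"]) (intro allI impI, rule D)
qed

section \<open>Orientation and connectedness of the coset graph\<close>

lemma ET_E:
  assumes "(u, v) \<in> ET"
  obtains e g where "e \<in> A" "g \<in> carrier FG" "edge e g = (u, v)"
proof -
  obtain e g where "e \<in> A" "g \<in> carrier FG" "(u, v) = edge e g"
    using assms unfolding ET_def by blast
  then show thesis by (intro that[of e g]) simp_all
qed

lemma edge_ET: "e \<in> A \<Longrightarrow> g \<in> carrier FG \<Longrightarrow> edge e g \<in> ET"
  unfolding ET_def by blast

lemma ET_VT: "(u, v) \<in> ET \<Longrightarrow> u \<in> VT \<and> v \<in> VT"
  by (erule ET_E) (use edge_VT in force)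

lemma ET_act:
  assumes "(u, v) \<in> ET" and g: "g \<in> carrier FG"
  shows "(act g u, act g v) \<in> ET"
proof -
  obtain e k where e: "e \<in> A" "k \<in> carrier FG" "edge e k = (u, v)" by (rule ET_E[OF assms(1)])
  have "(act g u, act g v) = edge e (g \<otimes>\<^bsub>FG\<^esub> k)"
    using act_edge[OF e(1) g e(2)] unfolding e(3) by simp
  then show ?thesis using edge_ET[OF e(1) FG.m_closed[OF g e(2)]] by (simp only:)
qed

text \<open>The wall of an edge separates its ends, hence those of the reversed edge as well; then
  the two edges coincide and the ends are equal, which the wall excludes.\<close>

lemma ET_asym: "(u, v) \<in> ET \<Longrightarrow> (v, u) \<notin> ET"
proof
  assume uv: "(u, v) \<in> ET" and vu: "(v, u) \<in> ET"
  from walls[OF uv] obtain f :: "'v \<times> ('v, 'e, 'g) generator word set set \<Rightarrow> bool"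
    where f: "\<forall>a b. (a, b) \<in> ET \<longrightarrow> (f a \<noteq> f b \<longleftrightarrow> a = u \<and> b = v)" ..
  have 1: "f u \<noteq> f v" using f[rule_format, OF uv] by (rule iffD2) blast
  then have "f v \<noteq> f u" by blast
  then have "v = u \<and> u = v" by (rule iffD1[OF f[rule_format, OF vu]])
  then show False using 1 by blast
qed

lemma act_closed: "g \<in> carrier FG \<Longrightarrow> x \<in> VT \<Longrightarrow> act g x \<in> VT"
  by (erule VT_E) (simp add: act_lc VT_I)

lemma act_one: "x \<in> VT \<Longrightarrow> act \<one>\<^bsub>FG\<^esub> x = x"
  by (erule VT_E) (simp add: act_lc)

lemma act_mult: "g \<in> carrier FG \<Longrightarrow> h \<in> carrier FG \<Longrightarrow> x \<in> VT \<Longrightarrow> act (g \<otimes>\<^bsub>FG\<^esub> h) x = act g (act h x)"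
  by (erule VT_E) (simp add: act_lc FG.m_assoc)

definition "nbr = {(u, v). (u, v) \<in> ET \<or> (v, u) \<in> ET}"

lemma nbr_sym: "(x, z) \<in> nbr\<^sup>* \<Longrightarrow> (z, x) \<in> nbr\<^sup>*"
proof (erule symD[OF sym_rtrancl, rotated])
  show "Relation.sym nbr" unfolding nbr_def by (rule symI) (simp, blast)
qed

lemma nbr_act:
  assumes "(x, z) \<in> nbr\<^sup>*" and g: "g \<in> carrier FG"
  shows "(act g x, act g z) \<in> nbr\<^sup>*"
  using assms(1)
proof (induction rule: rtrancl_induct)
  case (step z w)
  then have "(act g z, act g w) \<in> nbr" using ET_act[OF _ g] unfolding nbr_def by blast
  then show ?case using step.IH by (rule rtrancl_into_rtrancl[rotated])
qed simp

lemma W_nonempty: "W \<noteq> {}"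
  using T_props(2,6) by (simp add: Digraph_Component.connected_def strongly_connected_def)

text \<open>Stable letters of \<open>T\<close> are trivial, so the base cosets span a copy of
  \<open>T\<close> in the coset graph.\<close>

lemma base_nbr:
  assumes "u \<in> W" "v \<in> W"
  shows "((u, lc u \<one>\<^bsub>FG\<^esub>), (v, lc v \<one>\<^bsub>FG\<^esub>)) \<in> nbr\<^sup>*"
proof -
  have "u \<rightarrow>\<^sup>*\<^bsub>with_proj (mk_symmetric T)\<^esub> v"
    using T_props(2,6) assms by (simp add: Digraph_Component.connected_def strongly_connected_def)
  then have "(u, v) \<in> (parcs (mk_symmetric T))\<^sup>*"
    by (auto dest: reachable_rtranclI)
  then show ?thesis
  proof (induction rule: rtrancl_induct)
    case (step a b)
    then obtain e where e: "e \<in> arcs T" "(a, b) = (tl' e, hd' e) \<or> (a, b) = (hd' e, tl' e)"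
      unfolding parcs_mk_symmetric T_props(4,5) by blast
    have "e \<in> A" using e(1) T_props(3) by blast
    then have "((tl' e, lc (tl' e) \<one>\<^bsub>FG\<^esub>), (hd' e, lc (hd' e) \<one>\<^bsub>FG\<^esub>)) \<in> ET"
      using edge_ET[OF _ FG.one_closed] st_T[OF e(1)] unfolding edge_def by force
    then have "((a, lc a \<one>\<^bsub>FG\<^esub>), (b, lc b \<one>\<^bsub>FG\<^esub>)) \<in> nbr"
      using e(2) unfolding nbr_def by auto
    with step.IH show ?case by (rule rtrancl_into_rtrancl)
  qed simp
qed

text \<open>The elements that move a base vertex within its component form a subgroup. It contains
  the vertex groups, each fixing a base vertex, and the stable letters, each moving a base vertex
  next to another one.\<close>

lemma nbr_connected:
  assumes "x \<in> VT" "z \<in> VT"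
  shows "(x, z) \<in> nbr\<^sup>*"
proof -
  obtain r where r: "r \<in> W" using W_nonempty by blast
  let ?b = "\<lambda>v. (v, lc v \<one>\<^bsub>FG\<^esub>)"
  let ?J = "{g \<in> carrier FG. (?b r, act g (?b r)) \<in> nbr\<^sup>*}"
  have br: "?b r \<in> VT" by (rule VT_I[OF r FG.one_closed])
  have "?J = carrier FG"
  proof (rule FG_generated)
    show "subgroup ?J FG"
    proof (rule FG.subgroupI)
      have "\<one>\<^bsub>FG\<^esub> \<in> ?J" using act_one[OF br] by simp
      then show "?J \<noteq> {}" by blast
    next
      fix g assume "g \<in> ?J"
      then have g: "g \<in> carrier FG" "(?b r, act g (?b r)) \<in> nbr\<^sup>*" by simp_all
      have "act (inv\<^bsub>FG\<^esub> g) (act g (?b r)) = ?b r"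
        using g(1) act_mult[OF _ _ br, of "inv\<^bsub>FG\<^esub> g" g] act_one[OF br] by simp
      then show "inv\<^bsub>FG\<^esub> g \<in> ?J"
        using nbr_sym[OF nbr_act[OF g(2), of "inv\<^bsub>FG\<^esub> g"]] g(1) by simp
    next
      fix g h assume "g \<in> ?J" "h \<in> ?J"
      then have g: "g \<in> carrier FG" "(?b r, act g (?b r)) \<in> nbr\<^sup>*"
        and h: "h \<in> carrier FG" "(?b r, act h (?b r)) \<in> nbr\<^sup>*" by simp_all
      have "(act g (?b r), act g (act h (?b r))) \<in> nbr\<^sup>*" by (rule nbr_act[OF h(2) g(1)])
      with g(2) have "(?b r, act g (act h (?b r))) \<in> nbr\<^sup>*" by (rule rtrancl_trans)
      then show "g \<otimes>\<^bsub>FG\<^esub> h \<in> ?J" using g(1) h(1) act_mult[OF g(1) h(1) br] by simp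
    qed blast
  next
    fix v g assume v: "v \<in> W" "g \<in> carrier (V v)"
    have g: "vt v g \<in> carrier FG" by (rule vt_closed[OF v])
    have "vt v g \<in> Vb v" using v(2) unfolding Vb_def by blast
    then have fx: "act (vt v g) (?b v) = ?b v"
      using act_fix[OF v(1) g FG.one_closed] g by simp
    have "(act (vt v g) (?b v), act (vt v g) (?b r)) \<in> nbr\<^sup>*" by (rule nbr_act[OF base_nbr[OF v(1) r] g])
    then have "(?b r, act (vt v g) (?b r)) \<in> nbr\<^sup>*"
      unfolding fx by (rule rtrancl_trans[OF base_nbr[OF r v(1)]])
    then show "vt v g \<in> ?J" using g by simp
  next
    fix e assume e: "e \<in> A"
    have s: "st e \<in> carrier FG" by (rule st_closed[OF e])
    have "(?b (tl' e), act (st e) (?b (hd' e))) \<in> ET"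
      using edge_ET[OF e FG.one_closed] s by (simp add: edge_def act_lc)
    then have 1: "(?b (tl' e), act (st e) (?b (hd' e))) \<in> nbr" unfolding nbr_def by blast
    have "(act (st e) (?b (hd' e)), act (st e) (?b r)) \<in> nbr\<^sup>*"
      by (rule nbr_act[OF base_nbr[OF ends(2)[OF e] r] s])
    with 1 have "(?b (tl' e), act (st e) (?b r)) \<in> nbr\<^sup>*" by (rule converse_rtrancl_into_rtrancl)
    then have "(?b r, act (st e) (?b r)) \<in> nbr\<^sup>*"
      by (rule rtrancl_trans[OF base_nbr[OF r ends(1)[OF e]]])
    then show "st e \<in> ?J" using s by simp
  qed
  then have J: "(?b r, act g (?b r)) \<in> nbr\<^sup>*" if "g \<in> carrier FG" for g using that by blast
  have N: "(?b r, w) \<in> nbr\<^sup>*" if w: "w \<in> VT" for w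
  proof -
    obtain v k where v: "v \<in> W" "k \<in> carrier FG" "w = (v, lc v k)" by (rule VT_E[OF w])
    have "(act k (?b r), act k (?b v)) \<in> nbr\<^sup>*" by (rule nbr_act[OF base_nbr[OF r v(1)] v(2)])
    then have "(act k (?b r), w) \<in> nbr\<^sup>*" using v by (simp add: act_lc)
    then show ?thesis by (rule rtrancl_trans[OF J[OF v(2)]])
  qed
  show ?thesis by (rule rtrancl_trans[OF nbr_sym[OF N[OF assms(1)]] N[OF assms(2)]])
qed

lemma tree_action_FG:
  assumes S: "subgroup S FG"
  shows "tree_action (FG\<lparr>carrier := S\<rparr>) VT act ET"
proof (rule tree_action.intro)
  show "group (FG\<lparr>carrier := S\<rparr>)" by (rule subgroup.subgroup_is_group[OF S FG.is_group])
  have SF: "g \<in> carrier FG" if "g \<in> carrier (FG\<lparr>carrier := S\<rparr>)" for g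
    using that subgroup.subset[OF S] by auto
  show "tree_action_axioms (FG\<lparr>carrier := S\<rparr>) VT act ET"
  proof (rule tree_action_axioms.intro)
    show "VT \<noteq> {}" using W_nonempty VT_I[OF _ FG.one_closed] by blast
    fix r assume r: "r \<in> VT"
    show "\<exists>p (d :: _ \<Rightarrow> nat).
      (\<forall>v\<in>VT - {r}. p v \<in> VT \<and> d v = Suc (d (p v)) \<and> ((p v, v) \<in> ET \<or> (v, p v) \<in> ET)) \<and>
      (\<forall>(u, v)\<in>ET. (v \<noteq> r \<and> u = p v) \<or> (u \<noteq> r \<and> v = p u))"
      by (rule tree_if_walls[OF nbr_connected[OF r, unfolded nbr_def]]) (assumption, rule ET_VT, assumption, rule walls, assumption, rule r)
  next
    fix g v assume "g \<in> carrier (FG\<lparr>carrier := S\<rparr>)" "v \<in> VT"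
    then show "act g v \<in> VT" by (intro act_closed SF)
  next
    fix v assume "v \<in> VT"
    then show "act \<one>\<^bsub>FG\<lparr>carrier := S\<rparr>\<^esub> v = v" using act_one by simp
  next
    fix g h v assume "g \<in> carrier (FG\<lparr>carrier := S\<rparr>)" "h \<in> carrier (FG\<lparr>carrier := S\<rparr>)" "v \<in> VT"
    then show "act (g \<otimes>\<^bsub>FG\<lparr>carrier := S\<rparr>\<^esub> h) v = act g (act h v)" using act_mult[OF SF SF] by simp
  next
    fix u v g assume "(u, v) \<in> ET" "g \<in> carrier (FG\<lparr>carrier := S\<rparr>)"
    then show "(act g u, act g v) \<in> ET" by (intro ET_act SF)
  next
    fix u v assume "(u, v) \<in> ET"
    then show "u \<in> VT \<and> v \<in> VT" "(v, u) \<notin> ET" by (rule ET_VT, rule ET_asym)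
  qed
qed

section \<open>Stabilisers of vertices and edges\<close>

lemma vt_one: "v \<in> W \<Longrightarrow> vt v \<one>\<^bsub>V v\<^esub> = \<one>\<^bsub>FG\<^esub>"
proof -
  assume v: "v \<in> W"
  interpret V: group "V v" by (rule group_V[OF v])
  show ?thesis using vt_mult[OF v V.one_closed V.one_closed] vt_closed[OF v V.one_closed] by simp
qed

text \<open>The translation part of the affine action recovers the element, so the vertex groups
  embed into the fundamental group.\<close>

lemma vt_inj:
  assumes "v \<in> W" "x \<in> carrier (V v)" "z \<in> carrier (V v)" "vt v x = vt v z"
  shows "x = z"
proof -
  have "B v (\<alpha> v x) = B v (\<alpha> v z)" using \<tau>_vt[OF assms(1,2)] \<tau>_vt[OF assms(1,3)] assms(4) by simp
  then have "inv_into UNIV (B v) (B v (\<alpha> v x)) = inv_into UNIV (B v) (B v (\<alpha> v z))" by (simp only:)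
  then have "\<alpha> v x = \<alpha> v z" unfolding lin_inv_f(1)[OF B(1)] .
  then show ?thesis by (rule \<alpha>_inj[OF assms(1-3)])
qed

lemma stab_form:
  assumes v: "v \<in> W" and g: "g \<in> carrier FG" and s: "s \<in> carrier FG" and fx: "act s (v, lc v g) = (v, lc v g)"
  obtains x where "x \<in> carrier (V v)" "inv\<^bsub>FG\<^esub> g \<otimes>\<^bsub>FG\<^esub> (s \<otimes>\<^bsub>FG\<^esub> g) = vt v x"
    "s = g \<otimes>\<^bsub>FG\<^esub> vt v x \<otimes>\<^bsub>FG\<^esub> inv\<^bsub>FG\<^esub> g" "\<tau> s = L g (B v (\<alpha> v x))" "\<And>z. L s z = z"
proof -
  have "inv\<^bsub>FG\<^esub> g \<otimes>\<^bsub>FG\<^esub> (s \<otimes>\<^bsub>FG\<^esub> g) \<in> Vb v" using act_fix[OF v s g] fx by simp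
  then obtain x where x: "x \<in> carrier (V v)" "inv\<^bsub>FG\<^esub> g \<otimes>\<^bsub>FG\<^esub> (s \<otimes>\<^bsub>FG\<^esub> g) = vt v x" unfolding Vb_def by blast
  have c: "vt v x \<in> carrier FG" by (rule vt_closed[OF v x(1)])
  have sx: "s = g \<otimes>\<^bsub>FG\<^esub> vt v x \<otimes>\<^bsub>FG\<^esub> inv\<^bsub>FG\<^esub> g"
    unfolding x(2)[symmetric] using g s by (simp add: FG.m_assoc FG.mult_inv_cancel)
  have "\<tau> s = L g (B v (\<alpha> v x))" "L s z = z" for z
    unfolding sx using \<tau>_conj[OF g c L_vt[OF v x(1)]] \<tau>_vt[OF v x(1)] by simp_all
  then show thesis by (intro that[OF x sx])
qed

lemma Eb_iff:
  assumes e: "e \<in> A" and x: "x \<in> carrier (V (tl' e))"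
  shows "vt (tl' e) x \<in> Eb e \<longleftrightarrow> \<alpha> (tl' e) x \<in> line (yt e)"
proof
  assume "vt (tl' e) x \<in> Eb e"
  then obtain c where c: "c \<in> carrier (F e)" "vt (tl' e) x = vt (tl' e) (ti e c)" unfolding Eb_def by blast
  then have "x = ti e c" by (intro vt_inj[OF ends(1)[OF e] x ti_closed[OF e c(1)]])
  moreover obtain k where "c = cc e k" using cc_surj[OF e c(1)] by blast
  ultimately have "\<alpha> (tl' e) x = scl k (yt e)" using \<alpha>_ti[OF e] by simp
  then show "\<alpha> (tl' e) x \<in> line (yt e)" unfolding line_def by blast
next
  assume "\<alpha> (tl' e) x \<in> line (yt e)"
  then obtain k where "\<alpha> (tl' e) x = scl k (yt e)" unfolding line_def by blast
  then have "\<alpha> (tl' e) x = \<alpha> (tl' e) (ti e (cc e k))" using \<alpha>_ti[OF e] by simp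
  then have "x = ti e (cc e k)" by (rule \<alpha>_inj[OF ends(1)[OF e] x ti_closed[OF e cc_closed[OF e]]])
  then show "vt (tl' e) x \<in> Eb e" using cc_closed[OF e] unfolding Eb_def by blast
qed

lemma Eb_st_iff:
  assumes e: "e \<in> A" and x: "x \<in> carrier (V (hd' e))"
  shows "st e \<otimes>\<^bsub>FG\<^esub> vt (hd' e) x \<otimes>\<^bsub>FG\<^esub> inv\<^bsub>FG\<^esub> st e \<in> Eb e \<longleftrightarrow> \<alpha> (hd' e) x \<in> line (yh e)"
proof -
  have s: "st e \<in> carrier FG" and vx: "vt (hd' e) x \<in> carrier FG"
    using st_closed[OF e] vt_closed[OF ends(2)[OF e] x] .
  have st: "st e \<otimes>\<^bsub>FG\<^esub> vt (hd' e) (hi e c) \<otimes>\<^bsub>FG\<^esub> inv\<^bsub>FG\<^esub> st e = vt (tl' e) (ti e c)" if c: "c \<in> carrier (F e)" for c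
    unfolding st_vt[OF e c] using s vt_closed[OF ends(1)[OF e] ti_closed[OF e c]] by (simp add: FG.m_assoc)
  show ?thesis
  proof
    assume "st e \<otimes>\<^bsub>FG\<^esub> vt (hd' e) x \<otimes>\<^bsub>FG\<^esub> inv\<^bsub>FG\<^esub> st e \<in> Eb e"
    then obtain c where c: "c \<in> carrier (F e)"
      "st e \<otimes>\<^bsub>FG\<^esub> vt (hd' e) x \<otimes>\<^bsub>FG\<^esub> inv\<^bsub>FG\<^esub> st e = vt (tl' e) (ti e c)" unfolding Eb_def by blast
    have vc: "vt (hd' e) (hi e c) \<in> carrier FG" by (rule vt_closed[OF ends(2)[OF e] hi_closed[OF e c(1)]])
    have "vt (hd' e) x = vt (hd' e) (hi e c)"
      using c(2)[folded st[OF c(1)]] s vx vc by (simp add: FG.m_assoc)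
    then have "x = hi e c" by (intro vt_inj[OF ends(2)[OF e] x hi_closed[OF e c(1)]])
    moreover obtain k where "c = cc e k" using cc_surj[OF e c(1)] by blast
    ultimately have "\<alpha> (hd' e) x = scl k (yh e)" using \<alpha>_hi[OF e] by simp
    then show "\<alpha> (hd' e) x \<in> line (yh e)" unfolding line_def by blast
  next
    assume "\<alpha> (hd' e) x \<in> line (yh e)"
    then obtain k where "\<alpha> (hd' e) x = scl k (yh e)" unfolding line_def by blast
    then have "\<alpha> (hd' e) x = \<alpha> (hd' e) (hi e (cc e k))" using \<alpha>_hi[OF e] by simp
    then have "x = hi e (cc e k)" by (rule \<alpha>_inj[OF ends(2)[OF e] x hi_closed[OF e cc_closed[OF e]]])
    then show "st e \<otimes>\<^bsub>FG\<^esub> vt (hd' e) x \<otimes>\<^bsub>FG\<^esub> inv\<^bsub>FG\<^esub> st e \<in> Eb e"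
      using st[OF cc_closed[OF e]] cc_closed[OF e] unfolding Eb_def by simp
  qed
qed

lemma edge_fixed_iff:
  assumes e: "e \<in> A" and g: "g \<in> carrier FG" and s: "s \<in> carrier FG"
  shows "act s (fst (edge e g)) = fst (edge e g) \<and> act s (snd (edge e g)) = snd (edge e g) \<longleftrightarrow>
    inv\<^bsub>FG\<^esub> g \<otimes>\<^bsub>FG\<^esub> (s \<otimes>\<^bsub>FG\<^esub> g) \<in> Eb e"
proof -
  obtain a b where ab: "edge e g = (a, b)" by (rule prod.exhaust)
  have E: "edge e (s \<otimes>\<^bsub>FG\<^esub> g) = (act s a, act s b)"
    using act_edge[OF e s g] unfolding ab by simp
  have "edge e g = edge e (s \<otimes>\<^bsub>FG\<^esub> g) \<longleftrightarrow> act s (fst (edge e g)) = fst (edge e g) \<and> act s (snd (edge e g)) = snd (edge e g)"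
    unfolding E unfolding ab fst_conv snd_conv prod.inject by metis
  then show ?thesis using edge_eq_iff[OF e FG.m_closed[OF s g] g] by simp
qed

end

subsection \<open>The finite index subgroup\<close>

context tubular
begin

text \<open>The choice of a description of the edge is symmetric in \<open>u\<close> and
  \<open>v\<close>, so both orientations get the same vector and not just the same line.\<close>

definition direction :: "'v \<times> ('v, 'e, 'g) generator word set set \<Rightarrow> 'v \<times> ('v, 'e, 'g) generator word set set \<Rightarrow> vec" where
  "direction u v = (let eg = SOME eg. fst eg \<in> A \<and> snd eg \<in> carrier FG \<and>
      (edge (fst eg) (snd eg) = (u, v) \<or> edge (fst eg) (snd eg) = (v, u))
    in L (snd eg) (B (tl' (fst eg)) (yt (fst eg))))"

lemma direction_E:
  assumes "(u, v) \<in> ET \<or> (v, u) \<in> ET"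
  obtains e g where "e \<in> A" "g \<in> carrier FG" "edge e g = (u, v) \<or> edge e g = (v, u)"
    "direction u v = L g (B (tl' e) (yt e))"
proof -
  let ?P = "\<lambda>eg. fst eg \<in> A \<and> snd eg \<in> carrier FG \<and> (edge (fst eg) (snd eg) = (u, v) \<or> edge (fst eg) (snd eg) = (v, u))"
  have "\<exists>eg. ?P eg"
  proof -
    obtain e g where "e \<in> A" "g \<in> carrier FG" "edge e g = (u, v) \<or> edge e g = (v, u)"
    proof (rule disjE[OF assms])
      assume a: "\<And>e g. e \<in> A \<Longrightarrow> g \<in> carrier FG \<Longrightarrow> edge e g = (u, v) \<or> edge e g = (v, u) \<Longrightarrow> thesis"
      show thesis if "(u, v) \<in> ET" by (rule ET_E[OF that]) (rule a, assumption+, rule disjI1)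
      show thesis if "(v, u) \<in> ET" by (rule ET_E[OF that]) (rule a, assumption+, rule disjI2)
    qed
    then show ?thesis by (intro exI[of _ "(e, g)"]) simp
  qed
  then have "?P (SOME eg. ?P eg)" by (rule someI_ex)
  then show thesis
    by (intro that[of "fst (SOME eg. ?P eg)" "snd (SOME eg. ?P eg)"]) (simp_all only: direction_def Let_def)
qed

lemma direction_sym: "direction v u = direction u v"
  unfolding direction_def by (subst disj_commute) (rule HOL.refl)

lemma direction_primitive:
  assumes "(u, v) \<in> ET \<or> (v, u) \<in> ET"
  shows "primitive (direction u v)"
proof -
  obtain e g where e: "e \<in> A" "g \<in> carrier FG" "direction u v = L g (B (tl' e) (yt e))" by (rule direction_E[OF assms])
  then show ?thesis using yt_primitive lin_primitive[OF L_lin] lin_primitive[OF B(1)] by simp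
qed

lemma tail_stab:
  assumes e: "e \<in> A" and g: "g \<in> carrier FG" and s: "s \<in> carrier FG" and fx: "act s (fst (edge e g)) = fst (edge e g)"
  shows "act s (snd (edge e g)) = snd (edge e g) \<longleftrightarrow> det (L g (B (tl' e) (yt e))) (\<tau> s) = 0"
proof -
  have "act s (tl' e, lc (tl' e) g) = (tl' e, lc (tl' e) g)" using fx by (simp only: edge_def fst_conv)
  then obtain x where x: "x \<in> carrier (V (tl' e))" "inv\<^bsub>FG\<^esub> g \<otimes>\<^bsub>FG\<^esub> (s \<otimes>\<^bsub>FG\<^esub> g) = vt (tl' e) x"
    "\<tau> s = L g (B (tl' e) (\<alpha> (tl' e) x))" by (rule stab_form[OF ends(1)[OF e] g s])
  have "det (L g (B (tl' e) (yt e))) (\<tau> s) = 0 \<longleftrightarrow> \<alpha> (tl' e) x \<in> line (yt e)"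
    unfolding x(3) lin_det[OF L_lin[OF g] lin_primitive[OF B(1) yt_primitive[OF e]]] lin_line[OF B(1)] ..
  also have "\<dots> \<longleftrightarrow> act s (snd (edge e g)) = snd (edge e g)"
    using edge_fixed_iff[OF e g s] fx unfolding x(2) Eb_iff[OF e x(1)] by simp
  finally show ?thesis by (rule HOL.sym)
qed

text \<open>Since \<open>P e\<close> takes \<open>yh e\<close> to \<open>yt e\<close>, this identity
  computes the direction of an edge from its head as well as from its tail.\<close>

lemma L_head:
  assumes e: "e \<in> A" and g: "g \<in> carrier FG"
  shows "L (g \<otimes>\<^bsub>FG\<^esub> st e) (B (hd' e) z) = L g (B (tl' e) (P e z))"
  unfolding L_mult[OF g st_closed[OF e]] L_st[OF e] Q_B ..

lemma head_stab:
  assumes e: "e \<in> A" and g: "g \<in> carrier FG" and s: "s \<in> carrier FG" and fx: "act s (snd (edge e g)) = snd (edge e g)"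
  shows "act s (fst (edge e g)) = fst (edge e g) \<longleftrightarrow> det (L g (B (tl' e) (yt e))) (\<tau> s) = 0"
proof -
  have se: "st e \<in> carrier FG" by (rule st_closed[OF e])
  have h: "g \<otimes>\<^bsub>FG\<^esub> st e \<in> carrier FG" using g se by simp
  have "act s (hd' e, lc (hd' e) (g \<otimes>\<^bsub>FG\<^esub> st e)) = (hd' e, lc (hd' e) (g \<otimes>\<^bsub>FG\<^esub> st e))"
    using fx by (simp only: edge_def snd_conv)
  then obtain x where x: "x \<in> carrier (V (hd' e))" "s = (g \<otimes>\<^bsub>FG\<^esub> st e) \<otimes>\<^bsub>FG\<^esub> vt (hd' e) x \<otimes>\<^bsub>FG\<^esub> inv\<^bsub>FG\<^esub> (g \<otimes>\<^bsub>FG\<^esub> st e)"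
    "\<tau> s = L (g \<otimes>\<^bsub>FG\<^esub> st e) (B (hd' e) (\<alpha> (hd' e) x))" by (rule stab_form[OF ends(2)[OF e] h s])
  have vx: "vt (hd' e) x \<in> carrier FG" by (rule vt_closed[OF ends(2)[OF e] x(1)])
  have c: "inv\<^bsub>FG\<^esub> g \<otimes>\<^bsub>FG\<^esub> (s \<otimes>\<^bsub>FG\<^esub> g) = st e \<otimes>\<^bsub>FG\<^esub> vt (hd' e) x \<otimes>\<^bsub>FG\<^esub> inv\<^bsub>FG\<^esub> st e"
    using g se vx by (subst x(2)) (simp add: FG.m_assoc FG.inv_mult_group FG.mult_inv_cancel)
  have "det (L g (B (tl' e) (yt e))) (\<tau> s) = 0 \<longleftrightarrow> \<alpha> (hd' e) x \<in> line (yh e)"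
    unfolding x(3) P(2)[OF e, symmetric] L_head[OF e g, symmetric]
      lin_det[OF L_lin[OF h] lin_primitive[OF B(1) yh_primitive[OF e]]] lin_line[OF B(1)] ..
  also have "\<dots> \<longleftrightarrow> act s (fst (edge e g)) = fst (edge e g)"
    using edge_fixed_iff[OF e g s] fx unfolding c Eb_st_iff[OF e x(1)] by simp
  finally show ?thesis by (rule HOL.sym)
qed

lemma direction_stab:
  assumes "(u, v) \<in> ET \<or> (v, u) \<in> ET" and s: "s \<in> carrier FG" "act s u = u"
  shows "act s v = v \<longleftrightarrow> det (direction u v) (\<tau> s) = 0"
proof -
  obtain e g where e: "e \<in> A" "g \<in> carrier FG" "edge e g = (u, v) \<or> edge e g = (v, u)"
    "direction u v = L g (B (tl' e) (yt e))" by (rule direction_E[OF assms(1)])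
  from e(3) show ?thesis
  proof
    assume "edge e g = (u, v)"
    then show ?thesis using tail_stab[OF e(1,2) s(1)] s(2) e(4) by simp
  next
    assume "edge e g = (v, u)"
    then show ?thesis using head_stab[OF e(1,2) s(1)] s(2) e(4) by simp
  qed
qed

text \<open>Vertex groups act by translations, so the linear part is constant on each of their left
  cosets.\<close>

lemma L_coset:
  assumes v: "v \<in> W" and g: "g \<in> carrier FG" and k: "k \<in> carrier FG" and eq: "lc v k = lc v g"
  shows "L g z = L k z"
proof -
  have "inv\<^bsub>FG\<^esub> k \<otimes>\<^bsub>FG\<^esub> g \<in> Vb v" using lc_eq_iff[OF v k g] eq by simp
  then obtain x where x: "x \<in> carrier (V v)" "inv\<^bsub>FG\<^esub> k \<otimes>\<^bsub>FG\<^esub> g = vt v x" unfolding Vb_def by blast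
  have "k \<otimes>\<^bsub>FG\<^esub> (inv\<^bsub>FG\<^esub> k \<otimes>\<^bsub>FG\<^esub> g) = g" using g k by (simp add: FG.mult_inv_cancel)
  then have "L g z = L (k \<otimes>\<^bsub>FG\<^esub> vt v x) z" unfolding x(2) by simp
  then show ?thesis unfolding L_mult[OF k vt_closed[OF v x(1)]] L_vt[OF v x(1)] .
qed

definition "directions = (\<lambda>e. B (tl' e) (yt e)) ` A \<union> (\<lambda>e. B (hd' e) (yh e)) ` A"

text \<open>
  Modulo \<open>modulus\<close> the finitely many edge directions at a vertex stay apart, up to sign.
\<close>

definition "modulus = 3 + 2 * (\<Sum>z\<in>directions. \<bar>fst z\<bar> + \<bar>snd z\<bar>)"

text \<open>In the coordinates of the vertex given by \<open>L k\<close>, only finitely many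
  directions can occur; hence a single modulus suffices for the whole tree.\<close>

lemma direction_local:
  assumes v: "v \<in> W" and k: "k \<in> carrier FG" and adj: "((v, lc v k), u) \<in> ET \<or> (u, (v, lc v k)) \<in> ET"
  shows "\<exists>z\<in>directions. direction (v, lc v k) u = L k z"
proof -
  obtain e g where e: "e \<in> A" "g \<in> carrier FG" "edge e g = ((v, lc v k), u) \<or> edge e g = (u, (v, lc v k))"
    "direction (v, lc v k) u = L g (B (tl' e) (yt e))" by (rule direction_E[OF adj])
  from e(3) show ?thesis
  proof
    assume "edge e g = ((v, lc v k), u)"
    then have "tl' e = v" "lc v k = lc v g" unfolding edge_def by auto
    then have "direction (v, lc v k) u = L k (B (tl' e) (yt e))" using e(4) L_coset[OF v e(2) k] by simp
    moreover have "B (tl' e) (yt e) \<in> directions" using e(1) unfolding directions_def by blast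
    ultimately show ?thesis by (rule bexI)
  next
    assume "edge e g = (u, (v, lc v k))"
    then have h: "hd' e = v" "lc v k = lc v (g \<otimes>\<^bsub>FG\<^esub> st e)" unfolding edge_def by auto
    have "direction (v, lc v k) u = L (g \<otimes>\<^bsub>FG\<^esub> st e) (B (hd' e) (yh e))"
      unfolding e(4) L_head[OF e(1,2)] P(2)[OF e(1)] ..
    then have "direction (v, lc v k) u = L k (B (hd' e) (yh e))"
      using L_coset[OF v FG.m_closed[OF e(2) st_closed[OF e(1)]] k h(2)] by simp
    moreover have "B (hd' e) (yh e) \<in> directions" using e(1) unfolding directions_def by blast
    ultimately show ?thesis by (rule bexI)
  qed
qed

text \<open>The entries of the difference or sum are bounded by the sum of the two norms. Each norm,
  doubled, stays below \<open>modulus\<close>, also when the vectors coincide, so an entry divisible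
  by \<open>modulus\<close> is 0.\<close>

lemma directions_mod:
  assumes z: "z \<in> directions" "w \<in> directions" and mod: "mod_eq modulus z w \<or> mod_eq modulus z (- w)"
  shows "z = w \<or> z = - w"
proof -
  let ?n = "\<lambda>z. \<bar>fst z\<bar> + \<bar>snd z\<bar> :: int"
  have fin: "finite directions" unfolding directions_def using T_props(9) by blast
  have b: "2 * ?n x + 3 \<le> modulus" if "x \<in> directions" for x
    using member_le_sum[OF that, of ?n] fin unfolding modulus_def by simp
  have small: "c = 0" if "modulus dvd c" "\<bar>c\<bar> \<le> ?n z + ?n w" for c
  proof (rule ccontr)
    assume "c \<noteq> 0"
    then have "modulus \<le> \<bar>c\<bar>" using dvd_imp_le_int[OF _ that(1)] abs_ge_self order_trans by blast
    moreover have "False" if "M \<le> d" "2 * p + 3 \<le> M" "2 * q + 3 \<le> M" "d \<le> p + q" for M d p q :: int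
      using that by linarith
    ultimately show False using b[OF z(1)] b[OF z(2)] that(2) by blast
  qed
  from mod show ?thesis
  proof
    assume "mod_eq modulus z w"
    then have "modulus dvd fst z - fst w" "modulus dvd snd z - snd w" by (simp_all add: mod_eq_def)
    note d = this
    have "fst z - fst w = 0" by (rule small[OF d(1)]) linarith
    moreover have "snd z - snd w = 0" by (rule small[OF d(2)]) linarith
    ultimately show ?thesis by (simp add: prod_eq_iff)
  next
    assume "mod_eq modulus z (- w)"
    then have "modulus dvd fst z + fst w" "modulus dvd snd z + snd w" by (simp_all add: mod_eq_def)
    note d = this
    have "fst z + fst w = 0" by (rule small[OF d(1)]) linarith
    moreover have "snd z + snd w = 0" by (rule small[OF d(2)]) linarith
    ultimately show ?thesis by (simp add: prod_eq_iff eq_neg_iff_add_eq_0)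
  qed
qed

text \<open>The linear map of the vertex and its inverse preserve congruences, which reduces the
  comparison to the finite set \<open>directions\<close>.\<close>

lemma direction_mod:
  assumes v: "x \<in> VT" and u: "(x, u) \<in> ET \<or> (u, x) \<in> ET" and w: "(x, w) \<in> ET \<or> (w, x) \<in> ET"
    and mod: "mod_eq modulus (direction x u) (direction x w) \<or> mod_eq modulus (direction x u) (- direction x w)"
  shows "det (direction x u) (direction x w) = 0"
proof -
  obtain v k where x: "v \<in> W" "k \<in> carrier FG" "x = (v, lc v k)" by (rule VT_E[OF v])
  have i: "inv\<^bsub>FG\<^esub> k \<in> carrier FG" using x(2) by simp
  obtain a where a: "a \<in> directions" "direction x u = L k a" using direction_local[OF x(1,2)] u unfolding x(3) by blast
  obtain b where b: "b \<in> directions" "direction x w = L k b" using direction_local[OF x(1,2)] w unfolding x(3) by blast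
  have "mod_eq modulus a b \<or> mod_eq modulus a (- b)"
    using mod
  proof
    assume "mod_eq modulus (direction x u) (direction x w)"
    from lin_mod_eq[OF L_lin[OF i] this] show ?thesis unfolding a(2) b(2) L_inv(1)[OF x(2)] by (rule disjI1)
  next
    assume "mod_eq modulus (direction x u) (- direction x w)"
    from lin_mod_eq[OF L_lin[OF i] this] show ?thesis
      unfolding lin_minus[OF L_lin[OF i]] a(2) b(2) L_inv(1)[OF x(2)] by (rule disjI2)
  qed
  then have "a = b \<or> a = - b" by (rule directions_mod[OF a(1) b(1)])
  then have "direction x u = direction x w \<or> direction x u = - direction x w"
    unfolding a(2) b(2) using lin_minus[OF L_lin[OF x(2)]] by metis
  then show ?thesis by (elim disjE) (simp_all add: det_def)
qed

lemma subgroup_lattice_tree: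
  assumes S: "subgroup S FG" and mod: "\<And>g z. g \<in> S \<Longrightarrow> mod_eq modulus (L g z) z"
  shows "lattice_tree (FG\<lparr>carrier := S\<rparr>) VT act ET \<tau> direction L modulus"
proof -
  interpret S: tree_action "FG\<lparr>carrier := S\<rparr>" VT act ET by (rule tree_action_FG[OF S])
  have SF: "g \<in> carrier FG" if "g \<in> S" for g using that subgroup.subset[OF S] by blast
  have stab: "s \<in> S.stab v \<longleftrightarrow> s \<in> S \<and> act s v = v" for s v by (simp add: S.stab_def)
  have form: "\<exists>w\<in>W. \<exists>g\<in>carrier FG. \<exists>x\<in>carrier (V w). s = g \<otimes>\<^bsub>FG\<^esub> vt w x \<otimes>\<^bsub>FG\<^esub> inv\<^bsub>FG\<^esub> g \<and>
      \<tau> s = L g (B w (\<alpha> w x)) \<and> (\<forall>z. L s z = z)" if vs: "v \<in> VT" "s \<in> S.stab v" for v s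
  proof -
    obtain w g where w: "w \<in> W" "g \<in> carrier FG" "v = (w, lc w g)" by (rule VT_E[OF vs(1)])
    have s: "s \<in> carrier FG" "act s (w, lc w g) = (w, lc w g)" using vs(2) SF w(3) by (simp_all add: stab)
    show ?thesis
    proof (rule stab_form[OF w(1,2) s])
      fix x assume "x \<in> carrier (V w)" "s = g \<otimes>\<^bsub>FG\<^esub> vt w x \<otimes>\<^bsub>FG\<^esub> inv\<^bsub>FG\<^esub> g"
        "\<tau> s = L g (B w (\<alpha> w x))" "\<And>z. L s z = z"
      then show ?thesis using w(1,2) by blast
    qed
  qed
  show ?thesis
  proof (rule lattice_tree.intro[OF S.tree_action_axioms], rule lattice_tree_axioms.intro)
    fix v s t assume v: "v \<in> VT" "s \<in> S.stab v" "t \<in> S.stab v"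
    have c: "s \<in> carrier FG" "t \<in> carrier FG" using v(2,3) SF by (simp_all add: stab)
    have "L s z = z" for z using form[OF v(1,2)] by blast
    then show "\<tau> (s \<otimes>\<^bsub>FG\<lparr>carrier := S\<rparr>\<^esub> t) = \<tau> s + \<tau> t"
      using \<tau>_mult[OF c] by (simp add: add.commute)
  next
    fix v s assume v: "v \<in> VT" "s \<in> S.stab v" and 0: "\<tau> s = 0"
    from form[OF v] obtain w g x where w: "w \<in> W" "g \<in> carrier FG" "x \<in> carrier (V w)"
      "s = g \<otimes>\<^bsub>FG\<^esub> vt w x \<otimes>\<^bsub>FG\<^esub> inv\<^bsub>FG\<^esub> g" "\<tau> s = L g (B w (\<alpha> w x))" by blast
    have "B w (\<alpha> w x) = L (inv\<^bsub>FG\<^esub> g) (\<tau> s)" unfolding w(5) L_inv(1)[OF w(2)] ..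
    also have "\<dots> = 0" unfolding 0 using lin_zero[OF L_lin] w(2) by simp
    finally have "inv_into UNIV (B w) (B w (\<alpha> w x)) = 0" using lin_zero[OF lin_inv[OF B(1)]] by simp
    then have "\<alpha> w x = \<alpha> w \<one>\<^bsub>V w\<^esub>" unfolding lin_inv_f(1)[OF B(1)] using \<alpha>_one[OF w(1)] by simp
    then have "x = \<one>\<^bsub>V w\<^esub>"
      by (rule \<alpha>_inj[OF w(1,3) monoid.one_closed[OF group.is_monoid[OF group_V[OF w(1)]]]])
    then show "s = \<one>\<^bsub>FG\<lparr>carrier := S\<rparr>\<^esub>" unfolding w(4) using vt_one[OF w(1)] w(2) by simp
  next
    fix g v s assume g: "g \<in> carrier (FG\<lparr>carrier := S\<rparr>)" and v: "v \<in> VT" "s \<in> S.stab v"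
    have gS: "g \<in> S" "g \<in> carrier FG" using g SF by simp_all
    have s: "s \<in> carrier FG" using v(2) SF by (simp add: stab)
    have Ls: "L s z = z" for z using form[OF v] by blast
    show "\<tau> (g \<otimes>\<^bsub>FG\<lparr>carrier := S\<rparr>\<^esub> s \<otimes>\<^bsub>FG\<lparr>carrier := S\<rparr>\<^esub> inv\<^bsub>FG\<lparr>carrier := S\<rparr>\<^esub> g) = L g (\<tau> s)"
      using \<tau>_conj(1)[OF gS(2) s Ls] FG.m_inv_consistent[OF S gS(1)] by simp
  next
    fix u v assume "S.adj u v"
    then show "primitive (direction u v)" unfolding S.adj_def by (rule direction_primitive)
  next
    fix u v show "direction v u = direction u v" by (rule direction_sym)
  next
    fix u v s assume "S.adj u v" "s \<in> S.stab u"
    then show "s \<in> S.stab v \<longleftrightarrow> det (direction u v) (\<tau> s) = 0"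
      using direction_stab[of u v s] SF by (simp add: S.adj_def stab)
  next
    fix g k z assume "g \<in> carrier (FG\<lparr>carrier := S\<rparr>)"
    then show "L g (scl k z) = scl k (L g z)" using lin_scl[OF L_lin] SF by simp
  next
    fix g z assume "g \<in> carrier (FG\<lparr>carrier := S\<rparr>)" "primitive z"
    then show "primitive (L g z)" using lin_primitive[OF L_lin] SF by simp
  next
    fix g z assume "g \<in> carrier (FG\<lparr>carrier := S\<rparr>)"
    then show "mod_eq modulus (L g z) z" using mod by simp
  next
    show "3 \<le> modulus" unfolding modulus_def by (simp add: sum_nonneg)
  next
    fix x u v assume "S.adj x u" "S.adj x v" "mod_eq modulus (direction x u) (direction x v) \<or> mod_eq modulus (direction x u) (- direction x v)"
    then show "det (direction x u) (direction x v) = 0"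
      using direction_mod[of x u v] S.adj_verts[of x u] by (simp add: S.adj_def)
  qed
qed

definition "congruence_subgroup = {g \<in> carrier FG. \<forall>z. mod_eq modulus (L g z) z}"

lemma congruence_subgroup: "subgroup congruence_subgroup FG"
proof (rule FG.subgroupI)
  have "mod_eq modulus z z" for z by (simp add: mod_eq_def)
  then have "\<one>\<^bsub>FG\<^esub> \<in> congruence_subgroup" by (simp add: congruence_subgroup_def L_one)
  then show "congruence_subgroup \<noteq> {}" by blast
next
  fix g assume "g \<in> congruence_subgroup"
  then have g: "g \<in> carrier FG" "\<And>z. mod_eq modulus (L g z) z" unfolding congruence_subgroup_def by blast+
  have "mod_eq modulus (L (inv\<^bsub>FG\<^esub> g) z) z" for z
    using mod_eq_sym[OF g(2)[of "L (inv\<^bsub>FG\<^esub> g) z"]] unfolding L_inv(2)[OF g(1)] .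
  then show "inv\<^bsub>FG\<^esub> g \<in> congruence_subgroup" using g(1) by (simp add: congruence_subgroup_def)
next
  fix g h assume "g \<in> congruence_subgroup" "h \<in> congruence_subgroup"
  then have g: "g \<in> carrier FG" "\<And>z. mod_eq modulus (L g z) z" and h: "h \<in> carrier FG" "\<And>z. mod_eq modulus (L h z) z"
    unfolding congruence_subgroup_def by blast+
  have "mod_eq modulus (L (g \<otimes>\<^bsub>FG\<^esub> h) z) z" for z
    unfolding L_mult[OF g(1) h(1)] by (rule mod_eq_trans[OF g(2) h(2)])
  then show "g \<otimes>\<^bsub>FG\<^esub> h \<in> congruence_subgroup" using g(1) h(1) by (simp add: congruence_subgroup_def)
qed (simp add: congruence_subgroup_def)

lemma finite_rcosets_congruence_subgroup: "finite (rcosets\<^bsub>FG\<^esub> congruence_subgroup)"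
proof -
  let ?c = "\<lambda>z. (fst z mod modulus, snd z mod modulus)"
  \<comment> \<open>Modulo \<open>modulus\<close> a linear map is determined by the residues of the
    images of the two unit vectors, which leaves finitely many possibilities.\<close>
  let ?f = "\<lambda>g. (?c (L g (1, 0)), ?c (L g (0, 1)))"
  have m: "modulus > 0" unfolding modulus_def by (smt (verit) sum_nonneg abs_ge_zero)
  show ?thesis
  proof (rule FG.finite_rcosets_if[OF congruence_subgroup, of ?f])
    let ?I = "{0..<modulus}"
    have "?f ` carrier FG \<subseteq> (?I \<times> ?I) \<times> (?I \<times> ?I)" using m by auto
    then show "finite (?f ` carrier FG)" by (rule finite_subset) simp
  next
    fix a b assume a: "a \<in> carrier FG" and b: "b \<in> carrier FG" and eq: "?f a = ?f b"
    have e: "mod_eq modulus (L a z) (L b z)" if "z = (1, 0) \<or> z = (0, 1)" for z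
      using eq that unfolding mod_eq_def by (auto simp: mod_eq_dvd_iff)
    have eq': "mod_eq modulus (L a z) (L b z)" for z
    proof -
      have z: "z = scl (fst z) (1, 0) + scl (snd z) (0, 1)" by (simp add: scl_def)
      have L: "L g z = scl (fst z) (L g (1, 0)) + scl (snd z) (L g (0, 1))" if "g \<in> carrier FG" for g
        by (subst z) (simp only: lin_add[OF L_lin[OF that]] lin_scl[OF L_lin[OF that]])
      have d: "modulus dvd fst z * p + snd z * q" if "modulus dvd p" "modulus dvd q" for p q
        using that by (simp add: dvd_add)
      have "fst (L a z - L b z) = fst z * fst (L a (1, 0) - L b (1, 0)) + snd z * fst (L a (0, 1) - L b (0, 1))"
        "snd (L a z - L b z) = fst z * snd (L a (1, 0) - L b (1, 0)) + snd z * snd (L a (0, 1) - L b (0, 1))"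
        unfolding L[OF a] L[OF b] by (simp_all add: scl_def algebra_simps)
      then show ?thesis using d e[of "(1, 0)"] e[of "(0, 1)"] unfolding mod_eq_def by simp
    qed
    have ib: "inv\<^bsub>FG\<^esub> b \<in> carrier FG" using b by simp
    have "mod_eq modulus (L (a \<otimes>\<^bsub>FG\<^esub> inv\<^bsub>FG\<^esub> b) z) z" for z
      using eq'[of "L (inv\<^bsub>FG\<^esub> b) z"] unfolding L_mult[OF a ib] L_inv(2)[OF b] .
    then show "a \<otimes>\<^bsub>FG\<^esub> inv\<^bsub>FG\<^esub> b \<in> congruence_subgroup" using a ib by (simp add: congruence_subgroup_def)
  qed
qed

lemma congruence_subgroup_dichotomy:
  assumes "subgroup S (FG\<lparr>carrier := congruence_subgroup\<rparr>)"
  shows "surjects_to_F2 (FG\<lparr>carrier := S\<rparr>) \<or> small_free_abelian (FG\<lparr>carrier := S\<rparr>)"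
proof -
  have S: "subgroup S FG" by (rule FG.incl_subgroup[OF congruence_subgroup assms])
  have "S \<subseteq> congruence_subgroup" using subgroup.subset[OF assms] by simp
  then have "mod_eq modulus (L g z) z" if "g \<in> S" for g z
    using that unfolding congruence_subgroup_def by blast
  then show ?thesis by (rule lattice_tree.dichotomy[OF subgroup_lattice_tree[OF S]])
qed

end

theorem theorem3p7:
  fixes \<G> :: "('v, 'e, 'g, 'h) pre_graph_of_groups"
    and T :: "('v, 'e) pre_digraph"
    and G :: "('v, 'e, 'g) generator word set monoid"
  assumes "graph_of_groups \<G>"
    and "fin_digraph (base_graph \<G>)"
    and "connected (base_graph \<G>)"
    and "\<And>v. v \<in> verts (base_graph \<G>) \<Longrightarrow> vgroup \<G> v \<cong> integer_group \<times>\<times> integer_group"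
    and "\<And>e. e \<in> arcs (base_graph \<G>) \<Longrightarrow> egroup \<G> e \<cong> integer_group"
    and "\<And>e. e \<in> arcs (base_graph \<G>) \<Longrightarrow>
      maximal_inclusion (egroup \<G> e) (vgroup \<G> (tail (base_graph \<G>) e)) (tail_incl \<G> e)"
    and "\<And>e. e \<in> arcs (base_graph \<G>) \<Longrightarrow>
      maximal_inclusion (egroup \<G> e) (vgroup \<G> (head (base_graph \<G>) e)) (head_incl \<G> e)"
    and "undirected_spanning_tree T (base_graph \<G>)"
    and "G = fundamental_group \<G> T"
  shows "\<exists>H. subgroup H G \<and> finite (rcosets\<^bsub>G\<^esub> H) \<and>
    (\<forall>S. subgroup S (G\<lparr>carrier := H\<rparr>) \<longrightarrow>
      surjects_to_F2 (G\<lparr>carrier := S\<rparr>) \<or>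
      (free_abelian (G\<lparr>carrier := S\<rparr>) \<and>
        (trivial_group (G\<lparr>carrier := S\<rparr>) \<or>
         G\<lparr>carrier := S\<rparr> \<cong> integer_group \<or>
         G\<lparr>carrier := S\<rparr> \<cong> integer_group \<times>\<times> integer_group)))"
proof -
  interpret tubular \<G> T using assms(1,2,4-8) by (rule tubular.intro)
  show ?thesis
    unfolding assms(9)
    using congruence_subgroup finite_rcosets_congruence_subgroup congruence_subgroup_dichotomy[unfolded small_free_abelian_def]
    by blast
qed

end
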